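(* Let $\sigma\in C^2(\mathbb T)$ with $\int_{\mathbb T}\sigma=eZ$, let $R>0$, and let $X(0)=(\psi_0,q_0,p_0)\in\mathcal V$ with $|X(0)|_{\mathcal V}=\|\psi_0\|_{\mathcal F}+|p_0|\le R$. Then there exists $\tau=\tau(R)>0$ such that the Schrödinger–Poisson–Newton system has a unique solution $X\in C([-\tau,\tau],\mathcal V)$ with initial state $X(0)$, and for each $t\in[-\tau,\tau]$ the map $U(t):X(0)\mapsto X(t)$ is continuous in $\mathcal V$ (on the set of initial data with $|X(0)|_{\mathcal V}\le R$).
   Context: Setting. Fix $N\in\mathbb N$, constants $e>0$, $Z>0$, $M>0$. Let $\mathbb T:=\mathbb R^3/N\mathbb Z^3$, $\Gamma:=\mathbb Z^3/N\mathbb Z^3\subset\mathbb T$, $\overline N:=N^3$, $\overline{\mathbb T}:=\mathbb T^{\overline N}$ with points $\overline x=(x_1,\dots,x_{\overline N})$. The ion charge density $\sigma:\mathbb T\to\mathbb R$ satisfies $\sigma\in C^2(\mathbb T)$ and $\int_{\mathbb T}\sigma\,dx=eZ$. Let $\mathcal F$ be the real Hilbert space of complex-valued functions $\psi\in H^1(\overline{\mathbb T})$ antisymmetric under permutations of $x_1,\dots,x_{\overline N}$, with norm $\|\psi\|_{\mathcal F}^2=\|\nabla^\otimes\psi\|_{L^2(\overline{\mathbb T})}^2+\|\psi\|_{L^2(\overline{\mathbb T})}^2$ ($\nabla^\otimes$ = gradient in $\overline x$); real scalar products are $(f,g)=\mathrm{Re}\int f\bar g$. Let $\Xi:=\frac{2\pi}{N}\mathbb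 Z^3$ and write functions on $\mathbb T$ as Fourier series $f(x)=\sum_{\xi\in\Xi}\tilde f(\xi)e^{i\xi x}$; define $Gf:=\sum_{\xi\in\Xi\setminus0}\tilde f(\xi)|\xi|^{-2}e^{i\xi x}$. The phase space $\mathcal V$ is the set of triples $X=(\psi,q,p)$ with $\psi\in\mathcal F$, $q=(q(n))_{n\in\Gamma}\in\mathbb T^{\overline N}$, $p=(p(n))_{n\in\Gamma}\in\mathbb R^{3\overline N}$, with metric $d_{\mathcal V}(X,X')=\|\psi-\psi'\|_{\mathcal F}+|q-q'|+|p-p'|$ and quasinorm $|X|_{\mathcal V}=\|\psi\|_{\mathcal F}+|p|$. For $X=(\psi,q,p)$ define $\rho^i(x)=\sum_{n\in\Gamma}\sigma(x-n-q(n))$, $\rho^e(x)=-e\sum_{j=1}^{\overline N}\int_{\mathbb T^{\overline N-1}}|\psi(\overline x)|^2\big|_{x_j=x}\prod_{l\neq j}dx_l$, $\rho=\rho^i+\rho^e$, $\Phi=G\rho$, $\Phi^\otimes(\overline x)=\sum_{j}\Phi(x_j)$, $\Delta^\otimes=\sum_j\Delta_{x_j}$. The Schrödinger–Poisson–Newton system is $i\partial_t\psi=-\frac12\Delta^\otimes\psi-e\Phi^\otimes\psi$, $\dot q(n)=p(n)/M$ (mod $N\mathbb Z^3$), $\dot p(n)=-\int_{\mathbb T}\nabla\Phi(x)\,\sigma(x-n-q(n))\,dx$ ($n\in\Gamma$), where $\Phi=G\rho$ is computed from the current state; a solution on an interval $I\ni0$ is $X\in C(I,\mathcal V)$ satisfying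 it in Duhamel form: $\psi(t)=e^{\frac i2t\Delta^\otimes}\psi(0)+ie\int_0^te^{\frac i2(t-s)\Delta^\otimes}[\Phi^\otimes(s)\psi(s)]ds$, $q(n,t)=q(n,0)+\frac1M\int_0^tp(n,s)ds$, $p(n,t)=p(n,0)-\int_0^t(\nabla\Phi(s),\sigma(\cdot-n-q(n,s)))ds$. *)

theory Defs
  imports "HOL-Analysis.Analysis" "HOL-Combinatorics.Permutations"
begin

(* Points of the torus T = R^3 / N Z^3 are represented by points of R^3 (functions on T
   by N-periodic functions, or equivalently by their restriction to the fundamental cube).
   Electron configurations xbar = (x_1,...,x_Nbar) are functions on {..<N^3}. *)

type_synonym cfg = "nat \<Rightarrow> real^3"
type_synonym wf = "cfg \<Rightarrow> complex"
type_synonym state = "wf \<times> (real^3 \<Rightarrow> real^3) \<times> (real^3 \<Rightarrow> real^3)"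

definition cube :: "nat \<Rightarrow> (real^3) set" where
  "cube N = {x. \<forall>k. 0 \<le> x$k \<and> x$k < real N}"

text \<open>The lattice Gamma = Z^3 / N Z^3, represented by {0,...,N-1}^3.\<close>
definition Gam :: "nat \<Rightarrow> (real^3) set" where
  "Gam N = {n. \<forall>k. \<exists>m\<in>{..<N}. n$k = real m}"

definition Xi :: "nat \<Rightarrow> (real^3) set" where
  "Xi N = {\<xi>. \<forall>k. \<exists>m::int. \<xi>$k = 2 * pi / real N * of_int m}"

definition cfgM :: "nat \<Rightarrow> cfg measure" where
  "cfgM N = PiM {..<N^3} (\<lambda>_. lebesgue_on (cube N))"

definition XiC :: "nat \<Rightarrow> cfg set" where
  "XiC N = PiE {..<N^3} (\<lambda>_. Xi N)"

definition cdot :: "nat \<Rightarrow> cfg \<Rightarrow> cfg \<Rightarrow> real" where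
  "cdot N \<xi> x = (\<Sum>j<N^3. \<xi> j \<bullet> x j)"

definition csq :: "nat \<Rightarrow> cfg \<Rightarrow> real" where
  "csq N \<xi> = (\<Sum>j<N^3. (norm (\<xi> j))^2)"

text \<open>Fourier coefficients, convention f(x) = sum_xi f~(xi) e^{i xi x}.\<close>
definition fcoef :: "nat \<Rightarrow> wf \<Rightarrow> cfg \<Rightarrow> complex" where
  "fcoef N \<psi> \<xi> = integral\<^sup>L (cfgM N) (\<lambda>x. \<psi> x * cis (- cdot N \<xi> x))
                   / complex_of_real (real N ^ (3 * N^3))"

definition fcoef1 :: "nat \<Rightarrow> (real^3 \<Rightarrow> complex) \<Rightarrow> real^3 \<Rightarrow> complex" where
  "fcoef1 N f \<xi> = (LINT x|lebesgue_on (cube N). f x * cis (- (\<xi> \<bullet> x)))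
                   / complex_of_real (real N ^ 3)"

definition L2norm2 :: "nat \<Rightarrow> wf \<Rightarrow> real" where
  "L2norm2 N \<psi> = integral\<^sup>L (cfgM N) (\<lambda>x. (cmod (\<psi> x))^2)"

text \<open>||grad psi||^2_{L^2} via Plancherel.\<close>
definition gradnorm2 :: "nat \<Rightarrow> wf \<Rightarrow> real" where
  "gradnorm2 N \<psi> = real N ^ (3 * N^3) * infsum (\<lambda>\<xi>. csq N \<xi> * (cmod (fcoef N \<psi> \<xi>))^2) (XiC N)"

definition normF :: "nat \<Rightarrow> wf \<Rightarrow> real" where
  "normF N \<psi> = sqrt (L2norm2 N \<psi> + gradnorm2 N \<psi>)"

definition antisym_wf :: "nat \<Rightarrow> wf \<Rightarrow> bool" where
  "antisym_wf N \<psi> = (\<forall>\<pi>. \<pi> permutes {..<N^3} \<longrightarrow>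
      (AE x in cfgM N. \<psi> (x \<circ> \<pi>) = of_int (sign \<pi>) * \<psi> x))"

definition inF :: "nat \<Rightarrow> wf \<Rightarrow> bool" where
  "inF N \<psi> = (\<psi> \<in> borel_measurable (cfgM N)
     \<and> integrable (cfgM N) (\<lambda>x. (cmod (\<psi> x))^2)
     \<and> (\<lambda>\<xi>. csq N \<xi> * (cmod (fcoef N \<psi> \<xi>))^2) summable_on XiC N
     \<and> antisym_wf N \<psi>)"

definition tdist :: "nat \<Rightarrow> real^3 \<Rightarrow> real^3 \<Rightarrow> real" where
  "tdist N a b = Inf {norm (a - b - real N *\<^sub>R k) | k. \<forall>i. k$i \<in> \<int>}"

definition qdist :: "nat \<Rightarrow> (real^3 \<Rightarrow> real^3) \<Rightarrow> (real^3 \<Rightarrow> real^3) \<Rightarrow> real" where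
  "qdist N q q' = sqrt (\<Sum>n\<in>Gam N. (tdist N (q n) (q' n))^2)"

definition pnorm :: "nat \<Rightarrow> (real^3 \<Rightarrow> real^3) \<Rightarrow> real" where
  "pnorm N p = sqrt (\<Sum>n\<in>Gam N. (norm (p n))^2)"

definition psi :: "state \<Rightarrow> wf" where "psi X = fst X"
definition qq :: "state \<Rightarrow> (real^3 \<Rightarrow> real^3)" where "qq X = fst (snd X)"
definition pp :: "state \<Rightarrow> (real^3 \<Rightarrow> real^3)" where "pp X = snd (snd X)"

definition dV :: "nat \<Rightarrow> state \<Rightarrow> state \<Rightarrow> real" where
  "dV N X X' = normF N (\<lambda>x. psi X x - psi X' x) + qdist N (qq X) (qq X')
               + pnorm N (\<lambda>n. pp X n - pp X' n)"

definition absV :: "nat \<Rightarrow> state \<Rightarrow> real" where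
  "absV N X = normF N (psi X) + pnorm N (pp X)"

definition inV :: "nat \<Rightarrow> state \<Rightarrow> bool" where
  "inV N X = inF N (psi X)"

definition rho_i :: "nat \<Rightarrow> (real^3 \<Rightarrow> real) \<Rightarrow> (real^3 \<Rightarrow> real^3) \<Rightarrow> real^3 \<Rightarrow> real" where
  "rho_i N \<sigma> q x = (\<Sum>n\<in>Gam N. \<sigma> (x - n - q n))"

definition rho_e :: "nat \<Rightarrow> real \<Rightarrow> wf \<Rightarrow> real^3 \<Rightarrow> real" where
  "rho_e N e \<psi> x = - e * (\<Sum>j<N^3.
      integral\<^sup>L (PiM ({..<N^3} - {j}) (\<lambda>_. lebesgue_on (cube N)))
                (\<lambda>y. (cmod (\<psi> (y(j := x))))^2))"

definition rho :: "nat \<Rightarrow> real \<Rightarrow> (real^3 \<Rightarrow> real) \<Rightarrow> state \<Rightarrow> real^3 \<Rightarrow> real" where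
  "rho N e \<sigma> X x = rho_i N \<sigma> (qq X) x + rho_e N e (psi X) x"

definition L2T :: "nat \<Rightarrow> (real^3 \<Rightarrow> complex) \<Rightarrow> bool" where
  "L2T N f = (f \<in> borel_measurable (lebesgue_on (cube N))
     \<and> integrable (lebesgue_on (cube N)) (\<lambda>x. (cmod (f x))^2))"

definition Gop :: "nat \<Rightarrow> (real^3 \<Rightarrow> complex) \<Rightarrow> real^3 \<Rightarrow> complex" where
  "Gop N f = (SOME \<Phi>. L2T N \<Phi> \<and> (\<forall>\<xi>\<in>Xi N. fcoef1 N \<Phi> \<xi> =
       (if \<xi> = 0 then 0 else fcoef1 N f \<xi> / complex_of_real ((norm \<xi>)^2))))"

definition Phi :: "nat \<Rightarrow> real \<Rightarrow> (real^3 \<Rightarrow> real) \<Rightarrow> state \<Rightarrow> real^3 \<Rightarrow> complex" where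
  "Phi N e \<sigma> X = Gop N (\<lambda>x. complex_of_real (rho N e \<sigma> X x))"

text \<open>Weak partial derivative d/dx_k on T (tested against the characters e^{i xi x}).\<close>
definition dpart :: "nat \<Rightarrow> (real^3 \<Rightarrow> complex) \<Rightarrow> 3 \<Rightarrow> real^3 \<Rightarrow> complex" where
  "dpart N \<Phi> k = (SOME g. L2T N g \<and> (\<forall>\<xi>\<in>Xi N.
       fcoef1 N g \<xi> = \<i> * complex_of_real (\<xi>$k) * fcoef1 N \<Phi> \<xi>))"

text \<open>(grad Phi, sigma(. - n - q(n))) with (f,g) = Re int f conj g.\<close>
definition force :: "nat \<Rightarrow> real \<Rightarrow> (real^3 \<Rightarrow> real) \<Rightarrow> state \<Rightarrow> real^3 \<Rightarrow> real^3" where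
  "force N e \<sigma> X n = (\<chi> k. Re (LINT x|lebesgue_on (cube N).
       dpart N (Phi N e \<sigma> X) k x * cnj (complex_of_real (\<sigma> (x - n - qq X n)))))"

definition mulPhi :: "nat \<Rightarrow> (real^3 \<Rightarrow> complex) \<Rightarrow> wf \<Rightarrow> wf" where
  "mulPhi N \<Phi> \<psi> x = (\<Sum>j<N^3. \<Phi> (x j)) * \<psi> x"

definition is_solution :: "nat \<Rightarrow> real \<Rightarrow> real \<Rightarrow> (real^3 \<Rightarrow> real) \<Rightarrow> real set \<Rightarrow> (real \<Rightarrow> state) \<Rightarrow> bool" where
  "is_solution N e M \<sigma> I X =
    ((\<forall>t\<in>I. inV N (X t))
     \<and> (\<forall>t\<in>I. \<forall>\<epsilon>>0. \<exists>\<delta>>0. \<forall>s\<in>I. \<bar>s - t\<bar> < \<delta> \<longrightarrow> dV N (X s) (X t) < \<epsilon>)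
     \<and> (\<forall>t\<in>I. \<forall>\<xi>\<in>XiC N.
          interval_lebesgue_integrable lborel (ereal 0) (ereal t)
            (\<lambda>s. cis (- ((t - s) * csq N \<xi> / 2))
                  * fcoef N (mulPhi N (Phi N e \<sigma> (X s)) (psi (X s))) \<xi>)
        \<and> fcoef N (psi (X t)) \<xi> =
            cis (- (t * csq N \<xi> / 2)) * fcoef N (psi (X 0)) \<xi>
            + \<i> * complex_of_real e *
              interval_lebesgue_integral lborel (ereal 0) (ereal t)
                (\<lambda>s. cis (- ((t - s) * csq N \<xi> / 2))
                      * fcoef N (mulPhi N (Phi N e \<sigma> (X s)) (psi (X s))) \<xi>))
     \<and> (\<forall>t\<in>I. \<forall>n\<in>Gam N.
          interval_lebesgue_integrable lborel (ereal 0) (ereal t) (\<lambda>s. pp (X s) n)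
        \<and> (\<forall>k. \<exists>m::int. (qq (X t) n - qq (X 0) n
              - (1 / M) *\<^sub>R interval_lebesgue_integral lborel (ereal 0) (ereal t) (\<lambda>s. pp (X s) n)) $ k
              = real N * of_int m))
     \<and> (\<forall>t\<in>I. \<forall>n\<in>Gam N.
          interval_lebesgue_integrable lborel (ereal 0) (ereal t) (\<lambda>s. force N e \<sigma> (X s) n)
        \<and> pp (X t) n = pp (X 0) n
            - interval_lebesgue_integral lborel (ereal 0) (ereal t) (\<lambda>s. force N e \<sigma> (X s) n)))"

definition C2 :: "(real^3 \<Rightarrow> real) \<Rightarrow> bool" where
  "C2 f = (\<exists>(D1 :: real^3 \<Rightarrow> ((real^3) \<Rightarrow>\<^sub>L real)) (D2 :: real^3 \<Rightarrow> ((real^3) \<Rightarrow>\<^sub>L ((real^3) \<Rightarrow>\<^sub>L real))).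
      (\<forall>x. (f has_derivative blinfun_apply (D1 x)) (at x))
    \<and> (\<forall>x. (D1 has_derivative blinfun_apply (D2 x)) (at x))
    \<and> continuous_on UNIV D2)"

end

theory Submission
  imports Defs
begin

text \<open>
  All objects are expressed through Fourier coefficients. With the weight \<open>w(\<eta>) = 1 + |\<eta>|\<^sup>2\<close>, the
  space F becomes a weighted square-summable sequence space; Parseval's identity and the Riesz-Fischer theorem
  (which rest on the completeness of the characters: Stone-Weierstrass on the three-dimensional torus,
  Fubini for the product) translate in both directions.
  Since the sum of \<open>(1 + |\<xi>|\<^sup>2)\<^sup>-\<^sup>2\<close> over the dual lattice of the three-dimensional torus converges,
  Cauchy-Schwarz shows that \<open>(\<psi>, \<psi>) \<mapsto> \<rho>\<close> is a bounded bilinear map into square-summable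
  sequences and that \<open>(\<rho>, \<psi>) \<mapsto> G\<rho> \<psi>\<close> is a bounded bilinear map into F. The ion density and the
  force depend on the displacements only through the translates of \<open>\<sigma>\<close>, whose coefficients are bounded
  and Lipschitz in the translation. Passing to the interaction picture removes the unbounded Laplacian, and
  the system becomes an ordinary differential equation in a Banach space whose right-hand side is bounded and Lipschitz
  wherever \<open>\<psi>\<close> and \<open>p\<close> are bounded, so that Picard's theorem applies. Antisymmetry is preserved because it
  is the common kernel of bounded functionals that is invariant under the right-hand side.
\<close>

section \<open>Square-summable families\<close>

text \<open>States are functions, not classes modulo null sets, and the potential and its weak
  gradient are chosen by \<open>SOME\<close> among all functions with prescribed coefficients.
  Uniqueness of solutions therefore means distance zero in \<open>dV\<close>, and choices can be
  used only after a function with the prescribed coefficients has been shown to exist. The torus of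
  ion displacements is not a linear space, so displacements are lifted to \<open>real^3\<close>,
  where the vector field is periodic. The field has bounds uniform in the lifted displacement; this
  is why the existence time depends on \<open>R\<close> alone. Closeness of two displacements on the
  torus is visible only for suitable lifts, so a solution is lifted from an arbitrary representative
  of its initial displacement, and that freedom gives continuity in the initial data. A solution is
  not assumed to stay near its initial state. An exit time argument confines every continuous
  solution to the region where the field is Lipschitz, so that uniqueness holds without a side
  condition.\<close>

typedef (overloaded) ('a, 'b::banach) l2 =
  "{f :: 'a \<Rightarrow> 'b. \<exists>c. \<forall>F. finite F \<longrightarrow> (\<Sum>x\<in>F. (norm (f x))\<^sup>2) \<le> c}"
  morphisms l2_apply Abs_l2
  by (rule exI[of _ "\<lambda>_. 0"]) auto

lemma l2_eqI: "(\<And>x. l2_apply f x = l2_apply g x) \<Longrightarrow> f = g"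
  by (metis l2_apply_inject ext)

text \<open>Estimates arise for sums of squares, whereas Minkowski's inequality speaks of
  \<open>L2_set\<close>; this switches between the two forms.\<close>

lemma sum_sq_L2_set: "(\<Sum>x\<in>F. (norm (f x))\<^sup>2) \<le> c\<^sup>2 \<longleftrightarrow> L2_set (\<lambda>x. norm (f x)) F \<le> c" if "0 \<le> c"
  using that by (simp add: L2_set_def real_sqrt_le_iff' sum_nonneg)

lemma l2_apply_Abs:
  assumes "\<And>F. finite F \<Longrightarrow> (\<Sum>x\<in>F. (norm (f x))\<^sup>2) \<le> c"
  shows "l2_apply (Abs_l2 f) = f"
  by (rule Abs_l2_inverse) (use assms in auto)

lemma l2_bounded: "\<exists>c. \<forall>F. finite F \<longrightarrow> (\<Sum>x\<in>F. (norm (l2_apply f x))\<^sup>2) \<le> c"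
  using l2_apply[of f] by simp

lemma l2_summable: "(\<lambda>x. (norm (l2_apply f x))\<^sup>2) summable_on A"
proof -
  obtain c where "\<And>F. finite F \<Longrightarrow> (\<Sum>x\<in>F. (norm (l2_apply f x))\<^sup>2) \<le> c"
    using l2_bounded by blast
  then show ?thesis
    by (intro nonneg_bdd_above_summable_on) (auto intro!: bdd_aboveI2[where M=c])
qed

instantiation l2 :: (type, banach) real_normed_vector
begin

definition "0 = Abs_l2 (\<lambda>_. 0)"
definition "f + g = Abs_l2 (\<lambda>x. l2_apply f x + l2_apply g x)"
definition "f - g = Abs_l2 (\<lambda>x. l2_apply f x - l2_apply g x)"
definition "- f = Abs_l2 (\<lambda>x. - l2_apply f x)"
definition "scaleR r f = Abs_l2 (\<lambda>x. r *\<^sub>R l2_apply f x)"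
definition norm_l2_def: "norm f = sqrt (\<Sum>\<^sub>\<infinity>x. (norm (l2_apply f x))\<^sup>2)"
definition "sgn f = scaleR (inverse (norm f)) (f :: ('a, 'b) l2)"
definition "dist f g = norm (f - g :: ('a, 'b) l2)"
definition "uniformity = (INF e\<in>{0 <..}. principal {(x, y :: ('a, 'b) l2). dist x y < e})"
definition "open (U :: ('a, 'b) l2 set) \<longleftrightarrow> (\<forall>x\<in>U. \<forall>\<^sub>F (x', y) in uniformity. x' = x \<longrightarrow> y \<in> U)"

lemma L2_set_le_norm_l2: "finite F \<Longrightarrow> L2_set (\<lambda>x. norm (l2_apply f x)) F \<le> norm f"
  unfolding norm_l2_def L2_set_def
  by (intro real_sqrt_le_mono finite_sum_le_infsum l2_summable) auto

lemma norm_l2_leI: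
  assumes "0 \<le> c" "\<And>F. finite F \<Longrightarrow> L2_set (\<lambda>x. norm (l2_apply f x)) F \<le> c"
  shows "norm f \<le> c"
proof -
  have "(\<Sum>\<^sub>\<infinity>x. (norm (l2_apply f x))\<^sup>2) \<le> c\<^sup>2"
    by (rule infsum_le_finite_sums[OF l2_summable]) (use assms in \<open>simp add: sum_sq_L2_set\<close>)
  then show ?thesis
    unfolding norm_l2_def using assms(1) real_le_lsqrt by (simp add: real_sqrt_le_iff')
qed

lemma l2_apply_0: "l2_apply (0 :: ('a, 'b) l2) x = 0"
  unfolding zero_l2_def by (subst l2_apply_Abs[where c=0]) auto

text \<open>Minkowski's inequality on each finite set gives a bound that does not depend on the set,
  which is what membership in the type asks for.\<close>

lemma l2_apply_add: "l2_apply (f + g :: ('a, 'b) l2) x = l2_apply f x + l2_apply g x"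
  unfolding plus_l2_def
proof (subst l2_apply_Abs[where c="(norm f + norm g)\<^sup>2"])
  fix F :: "'a set" assume F: "finite F"
  have "L2_set (\<lambda>x. norm (l2_apply f x + l2_apply g x)) F
      \<le> L2_set (\<lambda>x. norm (l2_apply f x) + norm (l2_apply g x)) F"
    by (rule L2_set_mono) (auto intro: norm_triangle_ineq)
  also have "\<dots> \<le> norm f + norm g"
    by (rule order_trans[OF L2_set_triangle_ineq add_mono[OF L2_set_le_norm_l2[OF F] L2_set_le_norm_l2[OF F]]])
  finally show "(\<Sum>x\<in>F. (norm (l2_apply f x + l2_apply g x))\<^sup>2) \<le> (norm f + norm g)\<^sup>2"
    by (subst sum_sq_L2_set) (auto simp: norm_l2_def infsum_nonneg)
qed auto

lemma l2_apply_scaleR: "l2_apply (r *\<^sub>R f :: ('a, 'b) l2) x = r *\<^sub>R l2_apply f x"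
  unfolding scaleR_l2_def
proof (subst l2_apply_Abs[where c="r\<^sup>2 * (norm f)\<^sup>2"])
  fix F :: "'a set" assume F: "finite F"
  have "(\<Sum>x\<in>F. (norm (l2_apply f x))\<^sup>2) \<le> (norm f)\<^sup>2"
    by (subst sum_sq_L2_set) (auto simp: norm_l2_def infsum_nonneg L2_set_le_norm_l2[OF F, unfolded norm_l2_def])
  then show "(\<Sum>x\<in>F. (norm (r *\<^sub>R l2_apply f x))\<^sup>2) \<le> r\<^sup>2 * (norm f)\<^sup>2"
    by (simp add: power_mult_distrib sum_distrib_left[symmetric] mult_left_mono)
qed auto

lemma l2_apply_uminus: "l2_apply (- f :: ('a, 'b) l2) x = - l2_apply f x"
proof -
  have "- f = (-1) *\<^sub>R f" unfolding uminus_l2_def scaleR_l2_def by simp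
  then show ?thesis by (simp add: l2_apply_scaleR)
qed

lemma l2_apply_diff: "l2_apply (f - g :: ('a, 'b) l2) x = l2_apply f x - l2_apply g x"
proof -
  have "f - g = f + (- g)" unfolding plus_l2_def minus_l2_def by (simp add: l2_apply_uminus)
  then show ?thesis by (simp add: l2_apply_add l2_apply_uminus)
qed

instance
proof
  fix f g :: "('a, 'b) l2" and r :: real
  show "norm f = 0 \<longleftrightarrow> f = 0"
  proof
    assume "norm f = 0"
    then have "L2_set (\<lambda>x. norm (l2_apply f x)) {x} \<le> 0" for x
      using L2_set_le_norm_l2[of "{x}" f] by simp
    then show "f = 0" by (intro l2_eqI) (simp add: l2_apply_0)
  next
    assume "f = 0"
    then show "norm f = 0" by (simp add: norm_l2_def l2_apply_0)
  qed
  show "norm (f + g) \<le> norm f + norm g"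
  proof (rule norm_l2_leI)
    show "0 \<le> norm f + norm g" by (simp add: norm_l2_def infsum_nonneg)
    fix F :: "'a set" assume F: "finite F"
    have "L2_set (\<lambda>x. norm (l2_apply (f + g) x)) F
        \<le> L2_set (\<lambda>x. norm (l2_apply f x) + norm (l2_apply g x)) F"
      by (rule L2_set_mono) (auto simp: l2_apply_add intro: norm_triangle_ineq)
    also have "\<dots> \<le> norm f + norm g"
      by (rule order_trans[OF L2_set_triangle_ineq add_mono[OF L2_set_le_norm_l2[OF F] L2_set_le_norm_l2[OF F]]])
    finally show "L2_set (\<lambda>x. norm (l2_apply (f + g) x)) F \<le> norm f + norm g" .
  qed
  show "norm (r *\<^sub>R f) = \<bar>r\<bar> * norm f"
    by (simp add: norm_l2_def l2_apply_scaleR power_mult_distrib infsum_cmult_right' real_sqrt_mult)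
qed (auto intro!: l2_eqI simp: l2_apply_0 l2_apply_add l2_apply_scaleR l2_apply_uminus l2_apply_diff
    scaleR_add_right scaleR_add_left dist_l2_def sgn_l2_def uniformity_l2_def open_l2_def)

end

lemmas l2_apply_simps [simp] = l2_apply_0 l2_apply_add l2_apply_scaleR l2_apply_uminus l2_apply_diff

lemma l2_sum_le: "finite F \<Longrightarrow> (\<Sum>x\<in>F. (norm (l2_apply f x))\<^sup>2) \<le> (norm f)\<^sup>2"
  using L2_set_le_norm_l2[of F f] by (simp add: sum_sq_L2_set)

lemma norm_l2_le:
  assumes "0 \<le> c" "\<And>F. finite F \<Longrightarrow> (\<Sum>x\<in>F. (norm (l2_apply f x))\<^sup>2) \<le> c\<^sup>2"
  shows "norm f \<le> c"
  using assms by (intro norm_l2_leI) (auto simp: sum_sq_L2_set)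

lemma norm_l2_sq: "(norm f)\<^sup>2 = (\<Sum>\<^sub>\<infinity>x. (norm (l2_apply f x))\<^sup>2)"
  by (simp add: norm_l2_def infsum_nonneg)

lemma norm_l2_apply_le: "norm (l2_apply f x) \<le> norm f"
  using L2_set_le_norm_l2[of "{x}" f] by simp

lemma bounded_linear_l2_apply: "bounded_linear (\<lambda>f. l2_apply f x)"
  by (rule bounded_linear_intro[where K=1]) (auto simp: norm_l2_apply_le)

text \<open>Coordinates are Cauchy and hence converge. On a fixed finite set the Cauchy estimate
  passes to the coordinatewise limit \<open>g\<close>, with a bound that is uniform in the
  set.\<close>

instance l2 :: (type, banach) banach
proof
  fix X :: "nat \<Rightarrow> ('a, 'b) l2" assume X: "Cauchy X"
  have "Cauchy (\<lambda>n. l2_apply (X n) x)" for x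
    by (rule bounded_linear.Cauchy[OF bounded_linear_l2_apply X])
  then have "\<exists>g. \<forall>x. (\<lambda>n. l2_apply (X n) x) \<longlonglongrightarrow> g x"
    by (intro choice) (auto simp: Cauchy_convergent_iff convergent_def)
  then obtain g where g: "\<And>x. (\<lambda>n. l2_apply (X n) x) \<longlonglongrightarrow> g x" by auto
  have est: "(\<Sum>x\<in>F. (norm (l2_apply (X n) x - g x))\<^sup>2) \<le> \<epsilon>\<^sup>2"
    if "finite F" "\<And>m. m \<ge> k \<Longrightarrow> norm (X n - X m) \<le> \<epsilon>" for F n k \<epsilon>
  proof (rule LIMSEQ_le_const2)
    show "(\<lambda>m. \<Sum>x\<in>F. (norm (l2_apply (X n) x - l2_apply (X m) x))\<^sup>2)
        \<longlonglongrightarrow> (\<Sum>x\<in>F. (norm (l2_apply (X n) x - g x))\<^sup>2)"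
      by (intro tendsto_intros g)
    show "\<exists>N. \<forall>m\<ge>N. (\<Sum>x\<in>F. (norm (l2_apply (X n) x - l2_apply (X m) x))\<^sup>2) \<le> \<epsilon>\<^sup>2"
    proof (intro exI allI impI)
      fix m assume "k \<le> m"
      have "(\<Sum>x\<in>F. (norm (l2_apply (X n) x - l2_apply (X m) x))\<^sup>2) \<le> (norm (X n - X m))\<^sup>2"
        using l2_sum_le[OF \<open>finite F\<close>, of "X n - X m"] by simp
      also have "\<dots> \<le> \<epsilon>\<^sup>2" using that(2)[OF \<open>k \<le> m\<close>] by (intro power_mono) auto
      finally show "(\<Sum>x\<in>F. (norm (l2_apply (X n) x - l2_apply (X m) x))\<^sup>2) \<le> \<epsilon>\<^sup>2" .
    qed
  qed
  have cau: "\<exists>k. \<forall>m\<ge>k. \<forall>n\<ge>k. norm (X n - X m) \<le> \<epsilon>" if "\<epsilon> > 0" for \<epsilon>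
    using CauchyD[OF X that] by (meson less_imp_le)
  obtain k1 where k1: "\<And>m n. m \<ge> k1 \<Longrightarrow> n \<ge> k1 \<Longrightarrow> norm (X n - X m) \<le> 1"
    using cau[of 1] by auto
  \<comment> \<open>Square summability of \<open>g\<close> is not known yet. Its difference from the
    late member \<open>X k1\<close> has all finite sums of squares at most 1, so \<open>g\<close>
    arises as the difference of two elements of the space.\<close>
  define d where "d = Abs_l2 (\<lambda>x. l2_apply (X k1) x - g x)"
  have d: "l2_apply d x = l2_apply (X k1) x - g x" for x
    unfolding d_def by (subst l2_apply_Abs[where c="1\<^sup>2"]) (use est k1 in blast)+
  define Y where "Y = X k1 - d"
  have Y: "l2_apply Y x = g x" for x by (simp add: Y_def d)
  have "X \<longlonglongrightarrow> Y"
  proof (rule LIMSEQ_I)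
    fix \<epsilon> :: real assume "\<epsilon> > 0"
    then obtain k where k: "\<And>m n. m \<ge> k \<Longrightarrow> n \<ge> k \<Longrightarrow> norm (X n - X m) \<le> \<epsilon> / 2"
      using cau[of "\<epsilon> / 2"] by auto
    have "norm (X n - Y) \<le> \<epsilon> / 2" if "n \<ge> k" for n
      using \<open>\<epsilon> > 0\<close> est[of _ k n "\<epsilon> / 2"] k that by (intro norm_l2_le) (auto simp: Y)
    then show "\<exists>k. \<forall>n\<ge>k. norm (X n - Y) < \<epsilon>" using \<open>\<epsilon> > 0\<close> by (smt (verit) field_sum_of_halves)
  qed
  then show "convergent X" by (auto simp: convergent_def)
qed

definition single_l2 :: "'a \<Rightarrow> 'b::banach \<Rightarrow> ('a, 'b) l2" where
  "single_l2 a b = Abs_l2 (\<lambda>x. if x = a then b else 0)"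

lemma l2_apply_single [simp]: "l2_apply (single_l2 a b) x = (if x = a then b else 0)"
proof -
  have "(\<Sum>x\<in>F. (norm (if x = a then b else 0))\<^sup>2) \<le> (norm b)\<^sup>2" if "finite F" for F
  proof -
    have "(\<Sum>x\<in>F. (norm (if x = a then b else 0))\<^sup>2) = (\<Sum>x\<in>F. if x = a then (norm b)\<^sup>2 else 0)"
      by (rule sum.cong) auto
    then show ?thesis using that by (simp add: sum.delta')
  qed
  then show ?thesis unfolding single_l2_def by (subst l2_apply_Abs) auto
qed

lemma norm_single_l2: "norm (single_l2 a b) \<le> norm b"
proof (rule norm_l2_le)
  fix F :: "'a set" assume F: "finite F"
  have "(\<Sum>x\<in>F. (norm (l2_apply (single_l2 a b) x))\<^sup>2) = (\<Sum>x\<in>F. if x = a then (norm b)\<^sup>2 else 0)"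
    by (rule sum.cong) auto
  then show "(\<Sum>x\<in>F. (norm (l2_apply (single_l2 a b) x))\<^sup>2) \<le> (norm b)\<^sup>2"
    using F by (simp add: sum.delta')
qed simp

lemma bounded_linear_single_l2: "bounded_linear (single_l2 a)"
  by (rule bounded_linear_intro[where K=1]) (auto intro!: l2_eqI simp: norm_single_l2)

lemma l2_apply_sum [simp]: "l2_apply (\<Sum>i\<in>I. f i) x = (\<Sum>i\<in>I. l2_apply (f i) x)"
  by (induction I rule: infinite_finite_induct) auto

text \<open>Bounds on finite double sums are enough to define a bilinear map by a series.\<close>

locale l2_bilinear_series =
  fixes h :: "'c \<Rightarrow> 'i \<Rightarrow> ('a, 'x::banach) l2 \<Rightarrow> ('b, 'y::banach) l2 \<Rightarrow> 'z::banach" and I :: "'i set" and C :: real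
  assumes add_left: "h k i (u + u') v = h k i u v + h k i u' v"
    and add_right: "h k i u (v + v') = h k i u v + h k i u v'"
    and scale_left: "h k i (r *\<^sub>R u) v = r *\<^sub>R h k i u v"
    and scale_right: "h k i u (r *\<^sub>R v) = r *\<^sub>R h k i u v"
    and C: "0 \<le> C"
    and bound: "finite F \<Longrightarrow> finite G \<Longrightarrow> G \<subseteq> I \<Longrightarrow>
      (\<Sum>k\<in>F. (\<Sum>i\<in>G. norm (h k i u v))\<^sup>2) \<le> (C * norm u * norm v)\<^sup>2"
begin

lemma abs_summable: "(\<lambda>i. norm (h k i u v)) summable_on I"
proof (rule nonneg_bdd_above_summable_on)
  have "(\<Sum>i\<in>G. norm (h k i u v)) \<le> C * norm u * norm v" if "finite G" "G \<subseteq> I" for G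
    using bound[of "{k}" G u v] that C by (simp add: abs_le_square_iff[symmetric] sum_nonneg)
  then show "bdd_above (sum (\<lambda>i. norm (h k i u v)) ` {F. F \<subseteq> I \<and> finite F})"
    by (auto intro!: bdd_aboveI2[where M="C * norm u * norm v"])
qed auto

lemma summable: "(\<lambda>i. h k i u v) summable_on I"
  by (rule abs_summable_summable[OF abs_summable])

text \<open>The assumed bound concerns finite \<open>G\<close>. It survives the limit along finite
  subsets of \<open>I\<close> because only the finitely many coordinates in \<open>F\<close> are
  involved.\<close>

lemma series_bound: "finite F \<Longrightarrow> (\<Sum>k\<in>F. (norm (\<Sum>\<^sub>\<infinity>i\<in>I. h k i u v))\<^sup>2) \<le> (C * norm u * norm v)\<^sup>2"
proof -
  assume F: "finite F"
  have lim: "((\<lambda>G. \<Sum>k\<in>F. (\<Sum>i\<in>G. norm (h k i u v))\<^sup>2) \<longlongrightarrow>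
      (\<Sum>k\<in>F. (\<Sum>\<^sub>\<infinity>i\<in>I. norm (h k i u v))\<^sup>2)) (finite_subsets_at_top I)"
    by (intro tendsto_intros infsum_tendsto abs_summable)
  have "(\<Sum>k\<in>F. (norm (\<Sum>\<^sub>\<infinity>i\<in>I. h k i u v))\<^sup>2) \<le> (\<Sum>k\<in>F. (\<Sum>\<^sub>\<infinity>i\<in>I. norm (h k i u v))\<^sup>2)"
    by (intro sum_mono power_mono norm_infsum_bound abs_summable) auto
  also have "\<dots> \<le> (C * norm u * norm v)\<^sup>2"
    by (rule tendsto_upperbound[OF lim])
      (use F bound in \<open>auto intro!: eventually_finite_subsets_at_top_weakI\<close>)
  finally show ?thesis .
qed

definition series :: "('a, 'x) l2 \<Rightarrow> ('b, 'y) l2 \<Rightarrow> ('c, 'z) l2" where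
  "series u v = Abs_l2 (\<lambda>k. \<Sum>\<^sub>\<infinity>i\<in>I. h k i u v)"

lemma l2_apply_series: "l2_apply (series u v) k = (\<Sum>\<^sub>\<infinity>i\<in>I. h k i u v)"
  unfolding series_def by (subst l2_apply_Abs[OF series_bound]) auto

lemma bounded_bilinear_series: "bounded_bilinear series"
proof
  show "\<exists>K. \<forall>a b. norm (series a b) \<le> norm a * norm b * K"
  proof (intro exI allI)
    show "norm (series a b) \<le> norm a * norm b * C" for a b
      using C series_bound by (intro norm_l2_le) (auto simp: l2_apply_series mult_ac)
  qed
qed (auto intro!: l2_eqI simp: l2_apply_series add_left add_right scale_left scale_right
    infsum_add summable infsum_scaleR_right)

end

section \<open>The Picard theorem on an interval around zero\<close>

text \<open>The integral from 0 to \<open>t\<close>, where \<open>t\<close> may have either sign.\<close>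

definition oint :: "real \<Rightarrow> (real \<Rightarrow> 'e::banach) \<Rightarrow> real \<Rightarrow> 'e" where
  "oint T g t = integral {-T..t} g - integral {-T..0} g"

context
  fixes T :: real and g :: "real \<Rightarrow> 'e::banach"
  assumes T: "0 \<le> T" and g: "continuous_on {-T..T} g"
begin

lemma oint_integrable: "-T \<le> a \<Longrightarrow> b \<le> T \<Longrightarrow> g integrable_on {a..b}"
  by (rule integrable_continuous_interval) (auto intro: continuous_on_subset[OF g])

lemma oint_nonneg: "0 \<le> t \<Longrightarrow> t \<le> T \<Longrightarrow> oint T g t = integral {0..t} g"
  using T Henstock_Kurzweil_Integration.integral_combine[of "-T" 0 t g] oint_integrable[of "-T" t]
  by (simp add: oint_def algebra_simps)

lemma oint_nonpos: "t \<le> 0 \<Longrightarrow> -T \<le> t \<Longrightarrow> oint T g t = - integral {t..0} g"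
  using T Henstock_Kurzweil_Integration.integral_combine[of "-T" t 0 g] oint_integrable[of "-T" 0]
  by (simp add: oint_def algebra_simps)

lemma norm_oint_le:
  assumes "t \<in> {-T..T}" "\<And>s. s \<in> closed_segment 0 t \<Longrightarrow> norm (g s) \<le> B"
  shows "norm (oint T g t) \<le> \<bar>t\<bar> * B"
proof (cases "0 \<le> t")
  case True
  then have "norm (integral {0..t} g) \<le> B * (t - 0)"
    using assms by (intro integral_bound) (auto intro: continuous_on_subset[OF g] simp: closed_segment_eq_real_ivl)
  then show ?thesis using True assms by (simp add: oint_nonneg mult.commute)
next
  case False
  then have "norm (integral {t..0} g) \<le> B * (0 - t)"
    using assms T by (intro integral_bound) (auto intro: continuous_on_subset[OF g] simp: closed_segment_eq_real_ivl)
  then show ?thesis using False assms by (simp add: oint_nonpos mult.commute)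
qed

lemma continuous_on_oint: "continuous_on {-T..T} (oint T g)"
  unfolding oint_def
  by (intro continuous_intros indefinite_integral_continuous_1 oint_integrable) auto

lemma bounded_linear_oint:
  assumes "bounded_linear \<phi>" "t \<in> {-T..T}"
  shows "\<phi> (oint T g t) = oint T (\<lambda>s. \<phi> (g s)) t"
proof -
  interpret bounded_linear \<phi> by fact
  have "integral {-T..s} (\<lambda>s. \<phi> (g s)) = \<phi> (integral {-T..s} g)" if "s \<le> T" for s
    using integral_linear[OF oint_integrable[of "-T" s] assms(1)] that by (simp add: comp_def)
  then show ?thesis using assms T by (simp add: oint_def diff)
qed

end

lemma oint_diff:
  assumes "0 \<le> T" "continuous_on {-T..T} g" "continuous_on {-T..T} h" "t \<in> {-T..T}"
  shows "oint T (\<lambda>s. g s - h s) t = oint T g t - oint T h t"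
  using assms oint_integrable[of T g "-T"] oint_integrable[of T h "-T"]
  by (simp add: oint_def integral_diff)

text \<open>The notion of solution uses Lebesgue interval integrals of finite-dimensional
  coordinates, while the fixed point argument integrates curves in a Banach space. For continuous
  integrands both agree, including the sign convention for negative \<open>t\<close>.\<close>

lemma interval_integral_eq_oint:
  fixes g :: "real \<Rightarrow> 'e::euclidean_space"
  assumes "0 \<le> T" "continuous_on {-T..T} g" "t \<in> {-T..T}"
  shows "interval_lebesgue_integrable lborel (ereal 0) (ereal t) g"
    and "interval_lebesgue_integral lborel (ereal 0) (ereal t) g = oint T g t"
proof -
  have c: "continuous_on {a..b} g" if "-T \<le> a" "b \<le> T" for a b
    by (rule continuous_on_subset[OF assms(2)]) (use that in auto)
  show "interval_lebesgue_integrable lborel (ereal 0) (ereal t) g"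
  proof (cases "0 \<le> t")
    case False
    then show ?thesis using assms
      by (subst interval_integrable_endpoints_reverse) (auto intro!: interval_integrable_continuous_on c)
  qed (use assms in \<open>auto intro!: interval_integrable_continuous_on c\<close>)
  show "interval_lebesgue_integral lborel (ereal 0) (ereal t) g = oint T g t"
  proof (cases "0 \<le> t")
    case True
    then show ?thesis using assms
      by (subst interval_integral_eq_integral) (auto intro!: borel_integrable_atLeastAtMost' c simp: oint_nonneg)
  next
    case False
    then show ?thesis using assms
      by (subst interval_integral_endpoints_reverse, subst interval_integral_eq_integral)
        (auto intro!: borel_integrable_atLeastAtMost' c simp: oint_nonpos)
  qed
qed

text \<open>\<open>T * C < 1\<close> keeps a curve strictly inside the unit ball around its initial
  value, and \<open>T * L \<le> 1 / 2\<close> makes the Picard map a contraction. Continuity is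
  required on the whole space, so that the right-hand side is integrable along a curve before the
  curve is known to stay in \<open>D\<close>; the quantitative bounds are confined to
  \<open>D\<close>.\<close>

locale picard =
  fixes f :: "real \<Rightarrow> 'e::banach \<Rightarrow> 'e" and D :: "'e set" and T C L :: real
  assumes T: "0 < T" and C: "0 \<le> C" "T * C < 1" and L: "0 \<le> L" "T * L \<le> 1 / 2"
    and cont: "continuous_on UNIV (\<lambda>z. f (fst z) (snd z))"
    and f_bound: "y \<in> D \<Longrightarrow> norm (f s y) \<le> C"
    and f_lipschitz: "y \<in> D \<Longrightarrow> z \<in> D \<Longrightarrow> norm (f s y - f s z) \<le> L * norm (y - z)"
begin

definition sol :: "'e \<Rightarrow> (real \<Rightarrow> 'e) \<Rightarrow> bool" where
  "sol x0 y \<longleftrightarrow> continuous_on {-T..T} y \<and> (\<forall>t\<in>{-T..T}. y t = x0 + oint T (\<lambda>s. f s (y s)) t)"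

lemma continuous_on_rhs: "continuous_on A y \<Longrightarrow> continuous_on A (\<lambda>s. f s (y s))"
  using continuous_on_compose2[OF cont, of A "\<lambda>s. (s, y s)"] by (simp add: continuous_on_Pair continuous_on_id)

lemma rhs_integral_bound:
  assumes "continuous_on {-T..T} y" "t \<in> {-T..T}" "\<And>s. s \<in> closed_segment 0 t \<Longrightarrow> y s \<in> D"
  shows "norm (oint T (\<lambda>s. f s (y s)) t) \<le> T * C"
proof -
  have "norm (oint T (\<lambda>s. f s (y s)) t) \<le> \<bar>t\<bar> * C"
    using T assms by (intro norm_oint_le continuous_on_rhs f_bound) auto
  also have "\<dots> \<le> T * C" using assms C by (intro mult_right_mono) auto
  finally show ?thesis .
qed

lemma rhs_integral_lipschitz:
  assumes "continuous_on {-T..T} y" "continuous_on {-T..T} z" "t \<in> {-T..T}"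
    "\<And>s. s \<in> {-T..T} \<Longrightarrow> y s \<in> D" "\<And>s. s \<in> {-T..T} \<Longrightarrow> z s \<in> D"
    "\<And>s. s \<in> {-T..T} \<Longrightarrow> norm (y s - z s) \<le> B"
  shows "norm (oint T (\<lambda>s. f s (y s)) t - oint T (\<lambda>s. f s (z s)) t) \<le> B / 2"
proof -
  have B: "0 \<le> B" using assms(6)[of 0] T by (smt (verit) atLeastAtMost_iff norm_ge_zero)
  have "norm (oint T (\<lambda>s. f s (y s) - f s (z s)) t) \<le> \<bar>t\<bar> * (L * B)"
  proof (intro norm_oint_le continuous_intros continuous_on_rhs assms)
    fix s assume "s \<in> closed_segment 0 t"
    then have s: "s \<in> {-T..T}" using assms(3) by (auto simp: closed_segment_eq_real_ivl split: if_splits)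
    have "norm (f s (y s) - f s (z s)) \<le> L * norm (y s - z s)"
      using s assms by (intro f_lipschitz) auto
    also have "\<dots> \<le> L * B" using s assms L by (intro mult_left_mono) auto
    finally show "norm (f s (y s) - f s (z s)) \<le> L * B" .
  qed (use T in auto)
  also have "\<dots> \<le> (T * L) * B" using assms(3) L B by (auto intro!: mult_right_mono simp flip: mult.assoc)
  also have "\<dots> \<le> B / 2" using mult_right_mono[OF L(2) B] by simp
  finally show ?thesis using T assms by (simp add: oint_diff continuous_on_rhs)
qed

text \<open>The family \<open>\<Lambda>\<close> encodes linear constraints. Their common kernel is
  closed and the integral commutes with each functional, so the constraints can be built into the
  complete set in which the fixed point is sought, and the solution inherits them.\<close>

lemma sol_exists:
  fixes \<Lambda> :: "('e \<Rightarrow> 'w::banach) set"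
  assumes D: "cball x0 1 \<subseteq> D"
    and \<Lambda>: "\<And>\<phi>. \<phi> \<in> \<Lambda> \<Longrightarrow> bounded_linear \<phi>" "\<And>\<phi>. \<phi> \<in> \<Lambda> \<Longrightarrow> \<phi> x0 = 0"
    and inv: "\<And>\<phi> s y. \<phi> \<in> \<Lambda> \<Longrightarrow> (\<And>\<phi>. \<phi> \<in> \<Lambda> \<Longrightarrow> \<phi> y = 0) \<Longrightarrow> \<phi> (f s y) = 0"
  obtains y where "sol x0 y" "\<And>t \<phi>. t \<in> {-T..T} \<Longrightarrow> \<phi> \<in> \<Lambda> \<Longrightarrow> \<phi> (y t) = 0"
proof -
  \<comment> \<open>Clamping time to \<open>{-T..T}\<close> lets the fixed point be sought among
    bounded continuous functions on the whole line.\<close>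
  define cl where "cl t = max (-T) (min T t)" for t
  have cl: "cl t \<in> {-T..T}" "continuous_on UNIV cl" "t \<in> {-T..T} \<Longrightarrow> cl t = t" for t
    using T by (auto simp: cl_def intro!: continuous_intros)
  define A where "A = cball x0 1 \<inter> {y. \<forall>\<phi>\<in>\<Lambda>. \<phi> y = 0}"
  have A: "closed A" "A \<subseteq> D" "x0 \<in> A"
  proof -
    have "{y. \<forall>\<phi>\<in>\<Lambda>. \<phi> y = 0} = (\<Inter>\<phi>\<in>\<Lambda>. {y. \<phi> y = 0})" by auto
    then show "closed A" unfolding A_def
      by (simp only:) (intro closed_Int closed_cball closed_INT ballI closed_Collect_eq
        linear_continuous_on \<Lambda>(1) continuous_on_const)
  qed (use D \<Lambda> in \<open>auto simp: A_def\<close>)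
  define P :: "(real \<Rightarrow>\<^sub>C 'e) \<Rightarrow> real \<Rightarrow> 'e"
    where "P y t = x0 + oint T (\<lambda>s. f s (apply_bcontfun y s)) (cl t)" for y t
  define S where "S = (PiC UNIV (\<lambda>_. A) :: (real \<Rightarrow>\<^sub>C 'e) set)"
  have SD: "apply_bcontfun y s \<in> A" if "y \<in> S" for y s
    using that by (auto simp: S_def mem_PiC_iff)
  have P_bound: "norm (oint T (\<lambda>s. f s (apply_bcontfun y s)) (cl t)) \<le> T * C" if "y \<in> S" for y t
    using SD[OF that] A cl by (intro rhs_integral_bound) auto
  have P: "apply_bcontfun (Bcontfun (P y)) = P y" if "y \<in> S" for y
  proof (rule Bcontfun_inverse)
    have "continuous_on UNIV (P y)" unfolding P_def
      by (intro continuous_intros continuous_on_compose2[OF continuous_on_oint cl(2)])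
        (use T cl in \<open>auto intro!: continuous_on_rhs\<close>)
    moreover have "norm (P y t) \<le> norm x0 + T * C" for t
      unfolding P_def using norm_triangle_le P_bound[OF that] by (meson add_left_mono order_trans norm_triangle_ineq)
    ultimately show "P y \<in> bcontfun" by (rule bcontfun_normI)
  qed
  have "\<exists>!y\<in>S. Bcontfun (P y) = y"
  proof (rule Banach_fix[where c="1/2"])
    show "complete S" unfolding S_def
      by (intro closed_PiC A complete_eq_closed[THEN iffD2])
    have "const_bcontfun x0 \<in> S" using A by (auto simp: S_def mem_PiC_iff)
    then show "S \<noteq> {}" by auto
    show "(\<lambda>y. Bcontfun (P y)) ` S \<subseteq> S"
    proof clarify
      fix y assume y: "y \<in> S"
      have "P y t \<in> A" for t
      proof -
        have "dist x0 (P y t) \<le> 1"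
          using P_bound[OF y, of t] C by (simp add: P_def dist_norm)
        moreover have "\<phi> (P y t) = 0" if "\<phi> \<in> \<Lambda>" for \<phi>
        proof -
          have "\<phi> (oint T (\<lambda>s. f s (apply_bcontfun y s)) (cl t))
              = oint T (\<lambda>s. \<phi> (f s (apply_bcontfun y s))) (cl t)"
            using T cl by (intro bounded_linear_oint continuous_on_rhs \<Lambda> that) auto
          also have "(\<lambda>s. \<phi> (f s (apply_bcontfun y s))) = (\<lambda>s. 0)"
            using inv[OF that] SD[OF y] by (auto simp: A_def)
          also have "oint T (\<lambda>s. 0) (cl t) = (0 :: 'w)" by (simp add: oint_def)
          finally show ?thesis
            using \<Lambda>[OF that] by (simp add: P_def linear_add bounded_linear.linear)
        qed
        ultimately show ?thesis by (simp add: A_def)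
      qed
      then show "Bcontfun (P y) \<in> S" by (auto simp: S_def mem_PiC_iff P[OF y])
    qed
    fix y z assume "y \<in> S" "z \<in> S"
    then show "dist (Bcontfun (P y)) (Bcontfun (P z)) \<le> 1/2 * dist y z"
    proof (intro dist_bound)
      fix t
      have "norm (oint T (\<lambda>s. f s (apply_bcontfun y s)) (cl t) - oint T (\<lambda>s. f s (apply_bcontfun z s)) (cl t))
          \<le> dist y z / 2"
        using cl SD A \<open>y \<in> S\<close> \<open>z \<in> S\<close>
        by (intro rhs_integral_lipschitz) (auto simp flip: dist_norm intro: dist_bounded)
      then show "dist (Bcontfun (P y) t) (Bcontfun (P z) t) \<le> 1/2 * dist y z"
        using \<open>y \<in> S\<close> \<open>z \<in> S\<close> by (simp add: P) (simp add: P_def dist_norm)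
    qed
  qed auto
  then obtain y where y: "y \<in> S" "Bcontfun (P y) = y" by blast
  show ?thesis
  proof (rule that[of "apply_bcontfun y"])
    have "apply_bcontfun y t = P y t" for t using P[OF y(1)] y(2) by metis
    then have "apply_bcontfun y t = x0 + oint T (\<lambda>s. f s (apply_bcontfun y s)) (cl t)" for t
      unfolding P_def .
    then show "sol x0 (apply_bcontfun y)" using cl(3) unfolding sol_def
      by (metis continuous_on_apply_bcontfun)
  qed (use SD[OF y(1)] in \<open>auto simp: A_def\<close>)
qed

text \<open>Up to the first time \<open>r\<close> at which the distance from \<open>x0\<close>
  equals 1 the curve lies in \<open>D\<close>, so the integral there has norm at most
  \<open>T * C < 1\<close>, a contradiction. Thus membership in the ball is a conclusion about every
  solution and not a restriction on the solutions compared.\<close>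

lemma sol_in_cball:
  assumes D: "cball x0 1 \<subseteq> D" and y: "sol x0 y" and t: "t \<in> {-T..T}"
  shows "y t \<in> cball x0 1"
proof (rule ccontr)
  assume out: "y t \<notin> cball x0 1"
  have cy: "continuous_on {-T..T} y" using y by (simp add: sol_def)
  define d where "d s = dist x0 (y s)" for s
  have cd: "continuous_on {-T..T} d" unfolding d_def by (intro continuous_intros cy)
  have y0: "d 0 = 0" using y T by (simp add: sol_def d_def oint_def)
  have seg: "closed_segment 0 r \<subseteq> {-T..T}" if "r \<in> {-T..T}" for r
    using that T by (auto simp: closed_segment_eq_real_ivl)
  have ivt: "\<exists>s\<in>closed_segment 0 r. d s = 1" if r: "r \<in> {-T..T}" "1 < d r" for r
  proof -
    have "connected (d ` closed_segment 0 r)"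
      using r seg by (intro connected_continuous_image continuous_on_subset[OF cd]) auto
    moreover have "d 0 \<in> d ` closed_segment 0 r" "d r \<in> d ` closed_segment 0 r" by auto
    ultimately have "1 \<in> d ` closed_segment 0 r"
      using y0 r(2) unfolding connected_iff_interval by (metis less_imp_le zero_le_one)
    then show ?thesis by force
  qed
  define S where "S = {s \<in> {-T..T}. d s = 1}"
  have "compact S"
    unfolding S_def using continuous_closed_preimage_constant[OF cd, of 1]
    by (metis (lifting) bounded_closed_interval bounded_subset closed_real_atLeastAtMost compact_eq_bounded_closed mem_Collect_eq subsetI)
  moreover have "S \<noteq> {}" using ivt[OF t] subsetD[OF seg[OF t]] out by (fastforce simp: S_def d_def)
  \<comment> \<open>The smallest absolute value gives a first exit time for positive and negative
    times alike.\<close>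
  ultimately obtain r where r: "r \<in> S" "\<And>s. s \<in> S \<Longrightarrow> \<bar>r\<bar> \<le> \<bar>s\<bar>"
    using continuous_attains_inf[of S "\<lambda>s. \<bar>s\<bar>"] continuous_on_rabs[OF continuous_on_id] by blast
  have "y s \<in> D" if "s \<in> closed_segment 0 r" for s
  proof -
    have s: "s \<in> {-T..T}" using that r seg[of r] by (auto simp: S_def)
    have "d s \<le> 1"
    proof (rule ccontr)
      assume "\<not> d s \<le> 1"
      then obtain s' where s': "s' \<in> closed_segment 0 s" "d s' = 1" using ivt[OF s] by force
      then have "\<bar>r\<bar> \<le> \<bar>s'\<bar>" using seg[OF s] r by (auto simp: S_def)
      then have "s = s'" using s'(1) that by (auto simp: closed_segment_eq_real_ivl split: if_splits)
      then show False using s'(2) \<open>\<not> d s \<le> 1\<close> by simp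
    qed
    then show ?thesis using D by (auto simp: d_def)
  qed
  then have "norm (oint T (\<lambda>s. f s (y s)) r) \<le> T * C"
    using r cy by (intro rhs_integral_bound) (auto simp: S_def)
  then have "d r < 1" using y r C by (auto simp: S_def d_def sol_def dist_norm)
  then show False using r by (simp add: S_def)
qed

text \<open>This takes the place of Gronwall's inequality: at a time where the difference is
  largest, the integral contributes at most half of that maximum, which is absorbed on the left.
  Hence the factor 2.\<close>

lemma sol_dist:
  assumes D: "cball x0 1 \<subseteq> D" "cball z0 1 \<subseteq> D" and y: "sol x0 y" "sol z0 z" and t: "t \<in> {-T..T}"
  shows "norm (y t - z t) \<le> 2 * norm (x0 - z0)"
proof -
  have c: "continuous_on {-T..T} y" "continuous_on {-T..T} z" using y by (auto simp: sol_def)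
  obtain r where r: "r \<in> {-T..T}" "\<And>s. s \<in> {-T..T} \<Longrightarrow> norm (y s - z s) \<le> norm (y r - z r)"
  proof -
    have "\<exists>r\<in>{-T..T}. \<forall>s\<in>{-T..T}. norm (y s - z s) \<le> norm (y r - z r)"
      using T by (intro continuous_attains_sup continuous_intros c) auto
    then show ?thesis using that by blast
  qed
  have "y r - z r = (x0 - z0) + (oint T (\<lambda>s. f s (y s)) r - oint T (\<lambda>s. f s (z s)) r)"
    using y r by (auto simp: sol_def)
  moreover have "norm (oint T (\<lambda>s. f s (y s)) r - oint T (\<lambda>s. f s (z s)) r) \<le> norm (y r - z r) / 2"
    using sol_in_cball[OF D(1) y(1)] sol_in_cball[OF D(2) y(2)] D r c
    by (intro rhs_integral_lipschitz) auto
  ultimately have "norm (y r - z r) \<le> norm (x0 - z0) + norm (y r - z r) / 2"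
    by (metis add_left_mono norm_triangle_ineq order_trans)
  then show ?thesis using r(2)[OF t] by simp
qed

end

section \<open>Fourier series in a finite measure space\<close>

lemma borel_measurable_cnj [measurable]:
  "f \<in> borel_measurable M \<Longrightarrow> (\<lambda>x. cnj (f x)) \<in> borel_measurable M"
  by (rule borel_measurable_continuous_on[OF continuous_on_cnj[OF continuous_on_id]])

text \<open>Used for the cube and for the configuration space. \<open>V\<close> is the common
  squared norm of the characters. Completeness is demanded for integrable functions, a class whose
  sections are again integrable almost everywhere, as the passage to products requires.\<close>

locale fourier_basis = finite_measure M for M :: "'x measure" +
  fixes K :: "'k set" and c :: "'k \<Rightarrow> 'x \<Rightarrow> complex" and V :: real
  assumes V: "0 < V"
    and c_measurable [measurable]: "c k \<in> borel_measurable M"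
    and norm_c [simp]: "cmod (c k x) = 1"
    and orthogonal: "k \<in> K \<Longrightarrow> l \<in> K \<Longrightarrow>
      (\<integral>x. c k x * cnj (c l x) \<partial>M) = (if k = l then complex_of_real V else 0)"
    and complete: "integrable M f \<Longrightarrow> (\<And>k. k \<in> K \<Longrightarrow> (\<integral>x. f x * cnj (c k x) \<partial>M) = 0)
      \<Longrightarrow> AE x in M. f x = 0"
begin

definition coef :: "('x \<Rightarrow> complex) \<Rightarrow> 'k \<Rightarrow> complex" where
  "coef f k = (\<integral>x. f x * cnj (c k x) \<partial>M) / complex_of_real V"

definition sqint :: "('x \<Rightarrow> complex) \<Rightarrow> bool" where
  "sqint f \<longleftrightarrow> f \<in> borel_measurable M \<and> integrable M (\<lambda>x. (cmod (f x))\<^sup>2)"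

lemma sqint_measurable: "sqint f \<Longrightarrow> f \<in> borel_measurable M"
  by (simp add: sqint_def)

lemma sqint_mult_cnj:
  assumes "sqint f" "sqint g"
  shows "integrable M (\<lambda>x. f x * cnj (g x))"
proof (rule Bochner_Integration.integrable_bound)
  show "integrable M (\<lambda>x. (cmod (f x))\<^sup>2 + (cmod (g x))\<^sup>2)"
    using assms by (simp add: sqint_def)
  show "(\<lambda>x. f x * cnj (g x)) \<in> borel_measurable M"
    using assms[THEN sqint_measurable] by measurable
  show "AE x in M. cmod (f x * cnj (g x)) \<le> norm ((cmod (f x))\<^sup>2 + (cmod (g x))\<^sup>2)"
  proof (rule AE_I2)
    fix x
    have "0 \<le> (cmod (f x) - cmod (g x))\<^sup>2" by simp
    then have "2 * (cmod (f x) * cmod (g x)) \<le> (cmod (f x))\<^sup>2 + (cmod (g x))\<^sup>2"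
      by (simp add: power2_diff)
    moreover have "0 \<le> cmod (f x) * cmod (g x)" by simp
    ultimately have "cmod (f x) * cmod (g x) \<le> (cmod (f x))\<^sup>2 + (cmod (g x))\<^sup>2" by linarith
    then show "cmod (f x * cnj (g x)) \<le> norm ((cmod (f x))\<^sup>2 + (cmod (g x))\<^sup>2)"
      by (simp add: norm_mult)
  qed
qed

lemma sqint_bounded:
  assumes "f \<in> borel_measurable M" "\<And>x. cmod (f x) \<le> B"
  shows "sqint f"
  unfolding sqint_def
proof
  show "integrable M (\<lambda>x. (cmod (f x))\<^sup>2)"
    by (rule integrable_const_bound[where B="B\<^sup>2"]) (use assms in \<open>auto intro!: AE_I2 power_mono\<close>)
qed (use assms in auto)

lemma sqint_c: "sqint (c k)"
  by (rule sqint_bounded[where B=1]) auto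

lemma sqint_integrable: "sqint f \<Longrightarrow> integrable M f"
  using sqint_mult_cnj[of f "\<lambda>_. 1"] sqint_bounded[of "\<lambda>_. 1" 1] by simp

lemma sqint_scale: "sqint f \<Longrightarrow> sqint (\<lambda>x. a * f x)"
  unfolding sqint_def by (auto simp: norm_mult power_mult_distrib)

lemma norm_sq_add_real: "(cmod (a + b))\<^sup>2 = (cmod a)\<^sup>2 + (cmod b)\<^sup>2 + 2 * Re (a * cnj b)"
  unfolding cmod_power2 by (simp add: power2_eq_square algebra_simps)

lemma sqint_add:
  assumes "sqint f" "sqint g" shows "sqint (\<lambda>x. f x + g x)"
  unfolding sqint_def norm_sq_add_real
  using assms sqint_mult_cnj[OF assms] by (auto simp: sqint_def simp del: times_complex.sel)

lemma sqint_diff: "sqint f \<Longrightarrow> sqint g \<Longrightarrow> sqint (\<lambda>x. f x - g x)"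
  using sqint_add[of f "\<lambda>x. -1 * g x"] sqint_scale[of g "-1"] by simp

lemma sqint_unit_mult:
  assumes "sqint f" "u \<in> borel_measurable M" "\<And>x. cmod (u x) = 1"
  shows "sqint (\<lambda>x. u x * f x)"
  using assms unfolding sqint_def by (auto simp: norm_mult)

lemma integrable_mult_c: "integrable M f \<Longrightarrow> integrable M (\<lambda>x. f x * cnj (c k x))"
  by (rule Bochner_Integration.integrable_bound[of M f]) (auto simp: norm_mult)

lemma coef_add: "integrable M f \<Longrightarrow> integrable M g \<Longrightarrow> coef (\<lambda>x. f x + g x) k = coef f k + coef g k"
  using integrable_mult_c[of f k] integrable_mult_c[of g k]
  by (simp add: coef_def distrib_right add_divide_distrib)

lemma coef_diff: "integrable M f \<Longrightarrow> integrable M g \<Longrightarrow> coef (\<lambda>x. f x - g x) k = coef f k - coef g k"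
  using integrable_mult_c[of f k] integrable_mult_c[of g k]
  by (simp add: coef_def left_diff_distrib diff_divide_distrib)

lemma coef_scale: "coef (\<lambda>x. a * f x) k = a * coef f k"
  by (simp add: coef_def mult.assoc)

lemma coef_sum: "(\<And>i. i \<in> I \<Longrightarrow> integrable M (f i)) \<Longrightarrow> coef (\<lambda>x. \<Sum>i\<in>I. f i x) k = (\<Sum>i\<in>I. coef (f i) k)"
  using integrable_mult_c[of "f _" k] by (simp add: coef_def sum_distrib_right sum_divide_distrib)

lemma coef_cong_AE:
  assumes "f \<in> borel_measurable M" "g \<in> borel_measurable M" "AE x in M. f x = g x"
  shows "coef f k = coef g k"
proof -
  have "(\<integral>x. f x * cnj (c k x) \<partial>M) = (\<integral>x. g x * cnj (c k x) \<partial>M)"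
    using assms by (intro integral_cong_AE) auto
  then show ?thesis by (simp add: coef_def)
qed

lemma coef_inject:
  assumes "integrable M f" "integrable M g" "\<And>k. k \<in> K \<Longrightarrow> coef f k = coef g k"
  shows "AE x in M. f x = g x"
proof -
  have "AE x in M. f x - g x = 0"
  proof (rule complete)
    fix k assume "k \<in> K"
    then have "coef (\<lambda>x. f x - g x) k = 0" using assms by (simp add: coef_diff)
    then show "(\<integral>x. (f x - g x) * cnj (c k x) \<partial>M) = 0" using V by (simp add: coef_def)
  qed (use assms in auto)
  then show ?thesis by auto
qed

definition trig :: "'k set \<Rightarrow> ('k \<Rightarrow> complex) \<Rightarrow> 'x \<Rightarrow> complex" where
  "trig F a x = (\<Sum>k\<in>F. a k * c k x)"

lemma sqint_trig: "sqint (trig F a)"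
proof (induction F rule: infinite_finite_induct)
  case (insert k F)
  then show ?case
    using sqint_add[OF sqint_scale[OF sqint_c] insert.IH, of "a k" k] by (simp add: trig_def[abs_def])
qed (auto simp: trig_def[abs_def] intro!: sqint_bounded[where B=0])

lemma coef_trig:
  assumes "finite F" "F \<subseteq> K" "l \<in> K"
  shows "coef (trig F a) l = (if l \<in> F then a l else 0)"
proof -
  have "coef (trig F a) l = (\<Sum>k\<in>F. a k * coef (c k) l)"
    unfolding trig_def by (subst coef_sum) (auto simp: coef_scale sqint_integrable sqint_scale sqint_c)
  also have "\<dots> = (\<Sum>k\<in>F. if l = k then a l else 0)"
    using assms V by (intro sum.cong) (auto simp: coef_def orthogonal subset_eq)
  finally show ?thesis using assms by simp
qed

lemma integral_mult_trig:
  assumes "sqint f"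
  shows "(\<integral>x. f x * cnj (trig F a x) \<partial>M) = V * (\<Sum>k\<in>F. cnj (a k) * coef f k)"
proof -
  have "(\<integral>x. f x * cnj (trig F a x) \<partial>M) = (\<integral>x. (\<Sum>k\<in>F. cnj (a k) * (f x * cnj (c k x))) \<partial>M)"
    by (simp add: trig_def sum_distrib_left mult_ac)
  also have "\<dots> = (\<Sum>k\<in>F. cnj (a k) * (\<integral>x. f x * cnj (c k x) \<partial>M))"
    by (subst Bochner_Integration.integral_sum) (auto intro!: sqint_mult_cnj assms sqint_c)
  finally show ?thesis using V by (simp add: coef_def sum_distrib_left)
qed

lemma integral_norm_trig:
  assumes "finite F" "F \<subseteq> K"
  shows "(\<integral>x. (cmod (trig F a x))\<^sup>2 \<partial>M) = V * (\<Sum>k\<in>F. (cmod (a k))\<^sup>2)"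
proof -
  have "complex_of_real (\<integral>x. (cmod (trig F a x))\<^sup>2 \<partial>M) = (\<integral>x. trig F a x * cnj (trig F a x) \<partial>M)"
    by (subst integral_complex_of_real[symmetric]) (simp only: complex_norm_square)
  also have "\<dots> = V * (\<Sum>k\<in>F. cnj (a k) * coef (trig F a) k)"
    by (rule integral_mult_trig[OF sqint_trig])
  also have "(\<Sum>k\<in>F. cnj (a k) * coef (trig F a) k) = (\<Sum>k\<in>F. complex_of_real ((cmod (a k))\<^sup>2))"
    using assms by (intro sum.cong) (auto simp: coef_trig subset_eq complex_norm_square mult.commute simp del: of_real_power)
  finally have "complex_of_real (\<integral>x. (cmod (trig F a x))\<^sup>2 \<partial>M) = complex_of_real (V * (\<Sum>k\<in>F. (cmod (a k))\<^sup>2))"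
    by simp
  then show ?thesis using of_real_eq_iff by blast
qed

lemma bessel:
  assumes f: "sqint f" and F: "finite F" "F \<subseteq> K"
  shows "V * (\<Sum>k\<in>F. (cmod (coef f k))\<^sup>2) \<le> (\<integral>x. (cmod (f x))\<^sup>2 \<partial>M)"
proof -
  \<comment> \<open>The coefficients are negated so that the expansion of the squared norm of a sum
    applies to \<open>f\<close> minus its partial sum.\<close>
  define S where "S = trig F (\<lambda>k. - coef f k)"
  have S: "sqint S" unfolding S_def by (rule sqint_trig)
  have "0 \<le> (\<integral>x. (cmod (f x + S x))\<^sup>2 \<partial>M)" by simp
  also have "\<dots> = (\<integral>x. (cmod (f x))\<^sup>2 \<partial>M) + (\<integral>x. (cmod (S x))\<^sup>2 \<partial>M) + 2 * Re (\<integral>x. f x * cnj (S x) \<partial>M)"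
  proof -
    have "(\<integral>x. Re (f x * cnj (S x)) \<partial>M) = Re (\<integral>x. f x * cnj (S x) \<partial>M)"
      by (rule integral_Re[OF sqint_mult_cnj[OF f S]])
    then show ?thesis
      unfolding norm_sq_add_real using f S integrable_Re[OF sqint_mult_cnj[OF f S]]
      by (simp add: sqint_def del: times_complex.sel)
  qed
  also have "(\<integral>x. f x * cnj (S x) \<partial>M) = - complex_of_real (V * (\<Sum>k\<in>F. (cmod (coef f k))\<^sup>2))"
    unfolding S_def
    by (subst integral_mult_trig[OF f]) (simp add: complex_norm_square mult.commute sum_negf del: of_real_power)
  also have "(\<integral>x. (cmod (S x))\<^sup>2 \<partial>M) = V * (\<Sum>k\<in>F. (cmod (coef f k))\<^sup>2)"
    unfolding S_def by (subst integral_norm_trig[OF F]) simp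
  finally show ?thesis by simp
qed

lemma coef_summable: "sqint f \<Longrightarrow> (\<lambda>k. (cmod (coef f k))\<^sup>2) summable_on K"
  using bessel[of f] V
  by (intro nonneg_bdd_above_summable_on)
    (auto intro!: bdd_aboveI2[where M="(\<integral>x. (cmod (f x))\<^sup>2 \<partial>M) / V"] simp: field_simps)

text \<open>The limit must be an actual function. Finite sets \<open>G n\<close> are chosen that
  miss at most \<open>(1/4) ^ n\<close> of the total mass. The blocks between consecutive sets then
  have summable integrals of their absolute values, so the series of blocks converges absolutely
  almost everywhere.\<close>

lemma riesz_fischer:
  assumes a: "(\<lambda>k. (cmod (a k))\<^sup>2) summable_on K"
  obtains f where "sqint f" "\<And>k. k \<in> K \<Longrightarrow> coef f k = a k"
    "(\<integral>x. (cmod (f x))\<^sup>2 \<partial>M) \<le> V * (\<Sum>\<^sub>\<infinity>k\<in>K. (cmod (a k))\<^sup>2)"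
proof -
  define s where "s = (\<Sum>\<^sub>\<infinity>k\<in>K. (cmod (a k))\<^sup>2)"
  have "\<exists>F. finite F \<and> F \<subseteq> K \<and> s - (1/4) ^ n \<le> (\<Sum>k\<in>F. (cmod (a k))\<^sup>2)" for n
    using infsum_finite_approximation[OF a, of "(1/4) ^ n"]
    by (auto simp: s_def dist_real_def abs_le_iff)
  then obtain F where F: "\<And>n. finite (F n)" "\<And>n. F n \<subseteq> K"
    "\<And>n. s - (1/4) ^ n \<le> (\<Sum>k\<in>F n. (cmod (a k))\<^sup>2)" by metis
  define G where "G n = (\<Union>m\<le>n. F m)" for n
  have G: "finite (G n)" "G n \<subseteq> K" "G n \<subseteq> G (Suc n)" for n
    using F by (auto simp: G_def intro: le_SucI)
  have le_s: "(\<Sum>k\<in>H. (cmod (a k))\<^sup>2) \<le> s" if "finite H" "H \<subseteq> K" for H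
    unfolding s_def by (rule finite_sum_le_infsum[OF a]) (use that in auto)
  have tail: "(\<Sum>k\<in>H. (cmod (a k))\<^sup>2) \<le> (1/4) ^ n" if "finite H" "H \<subseteq> K" "H \<inter> G n = {}" for H n
  proof -
    have "(\<Sum>k\<in>F n. (cmod (a k))\<^sup>2) \<le> (\<Sum>k\<in>G n. (cmod (a k))\<^sup>2)"
      by (rule sum_mono2) (use G in \<open>auto simp: G_def\<close>)
    moreover have "(\<Sum>k\<in>H. (cmod (a k))\<^sup>2) + (\<Sum>k\<in>G n. (cmod (a k))\<^sup>2) = (\<Sum>k\<in>H \<union> G n. (cmod (a k))\<^sup>2)"
      using that G by (subst sum.union_disjoint) auto
    moreover have "\<dots> \<le> s" using that G by (intro le_s) auto
    ultimately show ?thesis using F(3)[of n] by linarith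
  qed
  define d where "d n = trig (G (Suc n) - G n) a" for n
  have d: "sqint (d n)" for n unfolding d_def by (rule sqint_trig)
  have S_Suc: "trig (G (Suc n)) a x = trig (G n) a x + d n x" for n x
    unfolding trig_def d_def using G[of n] G[of "Suc n"]
    by (subst sum.subset_diff[of "G n" "G (Suc n)"]) auto
  have S_eq: "(\<Sum>i<n. d i x) = trig (G n) a x - trig (G 0) a x" for n x
    by (induction n) (auto simp: S_Suc)
  define B where "B = (V + measure M (space M)) / 2"
  have int_d: "(\<integral>x. cmod (d n x) \<partial>M) \<le> B * (1/2) ^ n" for n
  proof -
    \<comment> \<open>The arithmetic-geometric inequality with weight \<open>2 ^ n\<close>: a square
      integral of order \<open>(1/4) ^ n\<close> becomes an absolute integral of order
      \<open>(1/2) ^ n\<close>, the remainder being paid for by the finite total measure.\<close>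
    have pt: "cmod (d n x) \<le> (2 ^ n * (cmod (d n x))\<^sup>2 + (1/2) ^ n) / 2" for x
    proof -
      have "0 \<le> (2 ^ n * cmod (d n x) - 1)\<^sup>2" by simp
      then have "2 * 2 ^ n * cmod (d n x) \<le> 2 ^ n * 2 ^ n * (cmod (d n x))\<^sup>2 + 1"
        by (simp add: power2_eq_square algebra_simps)
      then show ?thesis by (simp add: field_simps power_divide)
    qed
    have "(\<integral>x. cmod (d n x) \<partial>M) \<le> (\<integral>x. (2 ^ n * (cmod (d n x))\<^sup>2 + (1/2) ^ n) / 2 \<partial>M)"
      using d[of n] sqint_integrable[OF d[of n]] by (intro integral_mono pt) (auto simp: sqint_def)
    also have "\<dots> = (2 ^ n * (\<integral>x. (cmod (d n x))\<^sup>2 \<partial>M) + (1/2) ^ n * measure M (space M)) / 2"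
      using d[of n] by (simp add: sqint_def)
    also have "(\<integral>x. (cmod (d n x))\<^sup>2 \<partial>M) = V * (\<Sum>k\<in>G (Suc n) - G n. (cmod (a k))\<^sup>2)"
      unfolding d_def using G by (intro integral_norm_trig) auto
    also have "(2 ^ n * (V * (\<Sum>k\<in>G (Suc n) - G n. (cmod (a k))\<^sup>2)) + (1/2) ^ n * measure M (space M)) / 2
        \<le> (2 ^ n * (V * (1/4) ^ n) + (1/2) ^ n * measure M (space M)) / 2"
      using V G[of "Suc n"] by (intro divide_right_mono add_right_mono mult_left_mono tail) auto
    also have "2 ^ n * (V * (1/4) ^ n) = V * (1/2) ^ n"
      by (simp add: power_divide field_simps flip: power_mult_distrib)
    finally show ?thesis by (simp add: B_def field_simps)
  qed
  have sum_int: "summable (\<lambda>n. \<integral>x. cmod (d n x) \<partial>M)"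
    by (rule summable_comparison_test'[where g="\<lambda>n. B * (1/2) ^ n" and N=0])
      (auto intro!: summable_mult summable_geometric int_d)
  have AE_sum: "AE x in M. summable (\<lambda>n. cmod (d n x))"
  proof -
    have "(\<integral>\<^sup>+x. (\<Sum>n. ennreal (cmod (d n x))) \<partial>M) = (\<Sum>n. ennreal (\<integral>x. cmod (d n x) \<partial>M))"
    proof -
      have "(\<integral>\<^sup>+x. ennreal (cmod (d n x)) \<partial>M) = ennreal (\<integral>x. cmod (d n x) \<partial>M)" for n
        by (rule nn_integral_eq_integral) (auto intro!: integrable_norm sqint_integrable d)
      then show ?thesis
        using sqint_measurable[OF d] by (subst nn_integral_suminf) auto
    qed
    also have "\<dots> = ennreal (\<Sum>n. \<integral>x. cmod (d n x) \<partial>M)"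
      by (rule suminf_ennreal_eq) (auto intro!: summable_sums sum_int)
    finally have "(\<integral>\<^sup>+x. (\<Sum>n. ennreal (cmod (d n x))) \<partial>M) \<noteq> \<infinity>" by simp
    then have "AE x in M. (\<Sum>n. ennreal (cmod (d n x))) \<noteq> \<infinity>"
      using sqint_measurable[OF d] by (intro nn_integral_PInf_AE) auto
    then show ?thesis
      by eventually_elim (auto intro: summable_suminf_not_top)
  qed
  define f where "f x = trig (G 0) a x + (\<Sum>n. d n x)" for x
  have f_meas [measurable]: "f \<in> borel_measurable M"
    unfolding f_def using sqint_measurable[OF d] sqint_measurable[OF sqint_trig] by measurable
  have lim: "AE x in M. (\<lambda>n. trig (G n) a x) \<longlonglongrightarrow> f x"
    using AE_sum
  proof eventually_elim
    case (elim x)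
    then have "(\<lambda>n. \<Sum>i<n. d i x) \<longlonglongrightarrow> (\<Sum>n. d n x)"
      by (rule summable_LIMSEQ[OF summable_norm_cancel])
    then have "(\<lambda>n. trig (G 0) a x + (\<Sum>i<n. d i x)) \<longlonglongrightarrow> f x"
      unfolding f_def by (intro tendsto_intros)
    then show ?case by (simp add: S_eq)
  qed
  \<comment> \<open>Fatou's lemma along the partial sums gives square integrability and the norm
    bound together.\<close>
  have nn: "(\<integral>\<^sup>+x. ennreal ((cmod (f x))\<^sup>2) \<partial>M) \<le> ennreal (V * s)"
  proof -
    have "(\<integral>\<^sup>+x. ennreal ((cmod (f x))\<^sup>2) \<partial>M) = (\<integral>\<^sup>+x. liminf (\<lambda>n. ennreal ((cmod (trig (G n) a x))\<^sup>2)) \<partial>M)"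
    proof (rule nn_integral_cong_AE, use lim in eventually_elim)
      case (elim x)
      then have "(\<lambda>n. ennreal ((cmod (trig (G n) a x))\<^sup>2)) \<longlonglongrightarrow> ennreal ((cmod (f x))\<^sup>2)"
        by (intro tendsto_intros)
      then show ?case by (intro lim_imp_Liminf[symmetric]) auto
    qed
    also have "\<dots> \<le> liminf (\<lambda>n. \<integral>\<^sup>+x. ennreal ((cmod (trig (G n) a x))\<^sup>2) \<partial>M)"
      using sqint_measurable[OF sqint_trig] by (intro nn_integral_liminf) auto
    also have "\<dots> = liminf (\<lambda>n. ennreal (V * (\<Sum>k\<in>G n. (cmod (a k))\<^sup>2)))"
      using sqint_trig G
      by (intro arg_cong[where f=liminf] ext, subst nn_integral_eq_integral)
        (auto simp: sqint_def integral_norm_trig)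
    also have "\<dots> \<le> liminf (\<lambda>n. ennreal (V * s))"
      using V le_s G by (intro Liminf_mono always_eventually allI ennreal_leI mult_left_mono) auto
    also have "\<dots> = ennreal (V * s)" by (simp add: Liminf_const)
    finally show ?thesis .
  qed
  have f: "sqint f" unfolding sqint_def
    using nn by (auto intro!: integrableI_bounded simp: le_less_trans)
  have s0: "0 \<le> V * s" using V by (simp add: s_def infsum_nonneg)
  show ?thesis
  proof (rule that[OF f])
    show "(\<integral>x. (cmod (f x))\<^sup>2 \<partial>M) \<le> V * (\<Sum>\<^sub>\<infinity>k\<in>K. (cmod (a k))\<^sup>2)"
      using nn f s0 by (simp add: nn_integral_eq_integral sqint_def flip: s_def)
    fix k assume k: "k \<in> K"
    \<comment> \<open>The absolute integrals of the blocks are summable, so the series may be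
      integrated term by term against a character.\<close>
    have "(\<lambda>n. \<integral>x. d n x * cnj (c k x) \<partial>M) sums (\<integral>x. (\<Sum>n. d n x * cnj (c k x)) \<partial>M)"
    proof (rule sums_integral)
      show "integrable M (\<lambda>x. d n x * cnj (c k x))" for n
        using sqint_integrable[OF d] by (rule integrable_mult_c)
    qed (use AE_sum sum_int in \<open>auto simp: norm_mult\<close>)
    also have "(\<integral>x. (\<Sum>n. d n x * cnj (c k x)) \<partial>M) = (\<integral>x. (\<Sum>n. d n x) * cnj (c k x) \<partial>M)"
    proof (rule integral_cong_AE)
      show "AE x in M. (\<Sum>n. d n x * cnj (c k x)) = (\<Sum>n. d n x) * cnj (c k x)"
        using AE_sum by eventually_elim (simp add: suminf_mult2 summable_norm_cancel)
    qed (use sqint_measurable[OF d] in measurable)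
    finally have "(\<lambda>n. (\<integral>x. d n x * cnj (c k x) \<partial>M) / V) sums coef (\<lambda>x. \<Sum>n. d n x) k"
      unfolding coef_def by (rule sums_divide)
    then have "(\<lambda>n. coef (d n) k) sums coef (\<lambda>x. \<Sum>n. d n x) k" by (simp add: coef_def)
    then have "(\<lambda>n. coef (trig (G 0) a) k + (\<Sum>i<n. coef (d i) k)) \<longlonglongrightarrow> coef (trig (G 0) a) k + coef (\<lambda>x. \<Sum>n. d n x) k"
      unfolding sums_def by (intro tendsto_intros)
    moreover have "coef (trig (G 0) a) k + (\<Sum>i<n. coef (d i) k) = coef (trig (G n) a) k" for n
    proof -
      have "coef (trig (G n) a) k = coef (\<lambda>x. trig (G 0) a x + (\<Sum>i<n. d i x)) k"
        by (simp add: S_eq)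
      also have "\<dots> = coef (trig (G 0) a) k + coef (\<lambda>x. \<Sum>i<n. d i x) k"
        by (intro coef_add Bochner_Integration.integrable_sum sqint_integrable sqint_trig d)
      also have "coef (\<lambda>x. \<Sum>i<n. d i x) k = (\<Sum>i<n. coef (d i) k)"
        by (intro coef_sum sqint_integrable d)
      finally show ?thesis by simp
    qed
    moreover have "coef f k = coef (trig (G 0) a) k + coef (\<lambda>x. \<Sum>n. d n x) k"
    proof -
      have "integrable M (\<lambda>x. \<Sum>n. d n x)"
        by (rule integrable_suminf) (auto intro!: sqint_integrable d AE_sum sum_int)
      then show ?thesis unfolding f_def by (rule coef_add[OF sqint_integrable[OF sqint_trig]])
    qed
    ultimately have lim1: "(\<lambda>n. coef (trig (G n) a) k) \<longlonglongrightarrow> coef f k" by simp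
    have "(\<lambda>n. coef (trig (G n) a) k) \<longlonglongrightarrow> a k"
    proof (cases "\<exists>n. k \<in> G n")
      case True
      then obtain n where "k \<in> G n" by auto
      then have "k \<in> G m" if "m \<ge> n" for m using that by (auto simp: G_def)
      then have "\<forall>\<^sub>F m in sequentially. coef (trig (G m) a) k = a k"
        using G k by (auto simp: eventually_sequentially coef_trig)
      then show ?thesis by (rule tendsto_eventually)
    next
      \<comment> \<open>An index outside every \<open>G n\<close> carries mass at most
        \<open>(1/4) ^ n\<close> for all \<open>n\<close>, so its prescribed coefficient is
        0.\<close>
      case False
      then have "(cmod (a k))\<^sup>2 \<le> (1/4) ^ n" for n using tail[of "{k}" n] k by auto
      moreover have "(\<lambda>n. (1/4) ^ n :: real) \<longlonglongrightarrow> 0" by (intro LIMSEQ_power_zero) auto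
      ultimately have "(cmod (a k))\<^sup>2 \<le> 0" by (intro LIMSEQ_le_const) auto
      then show ?thesis using False G k by (simp add: coef_trig)
    qed
    then show "coef f k = a k" using lim1 LIMSEQ_unique by blast
  qed
qed

text \<open>One inequality is Bessel's. For the other, Riesz-Fischer supplies a function with the
  same coefficients and a norm bounded by them, and completeness identifies it with \<open>f\<close>
  almost everywhere.\<close>

theorem parseval:
  assumes f: "sqint f"
  shows "(\<integral>x. (cmod (f x))\<^sup>2 \<partial>M) = V * (\<Sum>\<^sub>\<infinity>k\<in>K. (cmod (coef f k))\<^sup>2)"
proof (rule antisym)
  obtain g where g: "sqint g" "\<And>k. k \<in> K \<Longrightarrow> coef g k = coef f k"
    "(\<integral>x. (cmod (g x))\<^sup>2 \<partial>M) \<le> V * (\<Sum>\<^sub>\<infinity>k\<in>K. (cmod (coef f k))\<^sup>2)"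
    using riesz_fischer[OF coef_summable[OF f]] by metis
  have "AE x in M. g x = f x"
    by (rule coef_inject) (auto intro!: sqint_integrable f g)
  then have "(\<integral>x. (cmod (f x))\<^sup>2 \<partial>M) = (\<integral>x. (cmod (g x))\<^sup>2 \<partial>M)"
    using f g by (intro integral_cong_AE) (auto simp: sqint_def)
  then show "(\<integral>x. (cmod (f x))\<^sup>2 \<partial>M) \<le> V * (\<Sum>\<^sub>\<infinity>k\<in>K. (cmod (coef f k))\<^sup>2)"
    using g(3) by simp
  have "(\<Sum>\<^sub>\<infinity>k\<in>K. (cmod (coef f k))\<^sup>2) \<le> (\<integral>x. (cmod (f x))\<^sup>2 \<partial>M) / V"
    using bessel[OF f] V by (intro infsum_le_finite_sums coef_summable f) (auto simp: field_simps)
  then show "V * (\<Sum>\<^sub>\<infinity>k\<in>K. (cmod (coef f k))\<^sup>2) \<le> (\<integral>x. (cmod (f x))\<^sup>2 \<partial>M)"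
    using V by (simp add: field_simps)
qed

lemma parseval_has_sum:
  assumes f: "sqint f"
  shows "((\<lambda>k. complex_of_real ((cmod (coef f k))\<^sup>2)) has_sum
    (\<integral>x. complex_of_real ((cmod (f x))\<^sup>2) \<partial>M) / V) K"
proof -
  have "((\<lambda>k. (cmod (coef f k))\<^sup>2) has_sum (\<integral>x. (cmod (f x))\<^sup>2 \<partial>M) / V) K"
    using V by (simp add: parseval[OF f] has_sum_infsum coef_summable[OF f])
  then show ?thesis
    by (subst integral_complex_of_real) (metis has_sum_of_real of_real_divide)
qed

lemma has_sum_sub:
  fixes f g :: "'i \<Rightarrow> complex"
  assumes "(f has_sum a) A" "(g has_sum b) A"
  shows "((\<lambda>k. f k - g k) has_sum (a - b)) A"
  using has_sum_add[OF assms(1) has_sum_uminusI[OF assms(2)]] by simp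

text \<open>Polarization of \<open>parseval_has_sum\<close>. With \<open>has_sum\<close> the
  convergence of the series comes together with its value, so later coefficient formulas are
  obtained by rewriting under the sum.\<close>

theorem parseval_inner:
  assumes f: "sqint f" and g: "sqint g"
  shows "((\<lambda>k. coef f k * cnj (coef g k)) has_sum (\<integral>x. f x * cnj (g x) \<partial>M) / V) K"
proof -
  have pol: "x * cnj y = (complex_of_real ((cmod (x + y))\<^sup>2) - complex_of_real ((cmod (x - y))\<^sup>2)
      + \<i> * complex_of_real ((cmod (x + \<i> * y))\<^sup>2) - \<i> * complex_of_real ((cmod (x - \<i> * y))\<^sup>2)) / 4" for x y
    by (simp add: complex_norm_square algebra_simps del: of_real_power)
  have ig: "sqint (\<lambda>x. \<i> * g x)" by (rule sqint_scale[OF g])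
  note s = sqint_add[OF f g] sqint_diff[OF f g] sqint_add[OF f ig] sqint_diff[OF f ig]
  have i: "integrable M (\<lambda>x. complex_of_real ((cmod (h x))\<^sup>2))" if "sqint h" for h
    using that unfolding sqint_def by (intro integrable_of_real) auto
  have "((\<lambda>k. (complex_of_real ((cmod (coef (\<lambda>x. f x + g x) k))\<^sup>2) - complex_of_real ((cmod (coef (\<lambda>x. f x - g x) k))\<^sup>2)
      + \<i> * complex_of_real ((cmod (coef (\<lambda>x. f x + \<i> * g x) k))\<^sup>2)
      - \<i> * complex_of_real ((cmod (coef (\<lambda>x. f x - \<i> * g x) k))\<^sup>2)) * (1 / 4)) has_sum
      ((\<integral>x. complex_of_real ((cmod (f x + g x))\<^sup>2) \<partial>M) / V - (\<integral>x. complex_of_real ((cmod (f x - g x))\<^sup>2) \<partial>M) / V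
      + \<i> * ((\<integral>x. complex_of_real ((cmod (f x + \<i> * g x))\<^sup>2) \<partial>M) / V)
      - \<i> * ((\<integral>x. complex_of_real ((cmod (f x - \<i> * g x))\<^sup>2) \<partial>M) / V)) * (1 / 4)) K"
    by (intro has_sum_cmult_left has_sum_sub has_sum_add has_sum_cmult_right parseval_has_sum s)
  also have "(\<lambda>k. (complex_of_real ((cmod (coef (\<lambda>x. f x + g x) k))\<^sup>2) - complex_of_real ((cmod (coef (\<lambda>x. f x - g x) k))\<^sup>2)
      + \<i> * complex_of_real ((cmod (coef (\<lambda>x. f x + \<i> * g x) k))\<^sup>2)
      - \<i> * complex_of_real ((cmod (coef (\<lambda>x. f x - \<i> * g x) k))\<^sup>2)) * (1 / 4)) = (\<lambda>k. coef f k * cnj (coef g k))"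
    by (rule ext, subst pol) (simp add: coef_add coef_diff coef_scale sqint_integrable f g ig del: of_real_power)
  also have "((\<integral>x. complex_of_real ((cmod (f x + g x))\<^sup>2) \<partial>M) / V - (\<integral>x. complex_of_real ((cmod (f x - g x))\<^sup>2) \<partial>M) / V
      + \<i> * ((\<integral>x. complex_of_real ((cmod (f x + \<i> * g x))\<^sup>2) \<partial>M) / V)
      - \<i> * ((\<integral>x. complex_of_real ((cmod (f x - \<i> * g x))\<^sup>2) \<partial>M) / V)) * (1 / 4)
    = (\<integral>x. (complex_of_real ((cmod (f x + g x))\<^sup>2) - complex_of_real ((cmod (f x - g x))\<^sup>2)
      + \<i> * complex_of_real ((cmod (f x + \<i> * g x))\<^sup>2) - \<i> * complex_of_real ((cmod (f x - \<i> * g x))\<^sup>2)) / 4 \<partial>M) / V"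
    using i[OF s(1)] i[OF s(2)] i[OF s(3)] i[OF s(4)]
    by (simp add: add_divide_distrib diff_divide_distrib mult.commute[of _ 4] del: of_real_power)
  finally show ?thesis by (simp only: flip: pol)
qed

end

section \<open>Characters of the cube\<close>

lemma borel_measurable_cis [measurable]: "f \<in> borel_measurable M \<Longrightarrow> (\<lambda>x. cis (f x)) \<in> borel_measurable M"
  unfolding cis_conv_exp by measurable

lemma cube_borel [measurable]: "cube N \<in> sets borel"
proof -
  have "cube N = (\<Inter>k\<in>UNIV. {x. 0 \<le> x$k} \<inter> {x. x$k < real N})" by (auto simp: cube_def)
  moreover have "{x::real^3. 0 \<le> x$k} \<in> sets borel" "{x::real^3. x$k < real N} \<in> sets borel" for k
    by (auto intro!: borel_closed borel_open closed_Collect_le open_Collect_less continuous_intros)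
  ultimately show ?thesis by (auto intro!: sets.finite_INT)
qed

lemma cube_lebesgue [simp]: "cube N \<in> sets lebesgue"
  using cube_borel by simp

lemma measurable_cube: "f \<in> borel_measurable borel \<Longrightarrow> f \<in> borel_measurable (lebesgue_on (cube N))"
  by (intro measurable_restrict_space1 measurable_completion) simp

lemma integral_cube:
  fixes f :: "real^3 \<Rightarrow> complex"
  assumes "f \<in> borel_measurable borel"
  shows "(LINT x|lebesgue_on (cube N). f x) = (LINT x|lborel. indicator (cube N) x *\<^sub>R f x)"
  using assms by (simp add: integral_restrict_space integral_completion)

lemma lborel_integral_prod:
  fixes h :: "'a::euclidean_space \<Rightarrow> real \<Rightarrow> complex"
  assumes h: "\<And>b. b \<in> Basis \<Longrightarrow> integrable lborel (h b)"
  shows "(LINT x|(lborel::'a measure). (\<Prod>b\<in>Basis. h b (x \<bullet> b))) = (\<Prod>b\<in>Basis. (LINT y|lborel. h b y))"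
proof -
  interpret product_sigma_finite "\<lambda>_::'a. lborel :: real measure" ..
  have [measurable]: "h b \<in> borel_measurable borel" if "b \<in> Basis" for b
    using borel_measurable_integrable[OF h[OF that]] by simp
  have "(LINT x|(lborel::'a measure). (\<Prod>b\<in>Basis. h b (x \<bullet> b)))
      = (LINT f|(\<Pi>\<^sub>M b\<in>Basis. lborel). (\<Prod>b\<in>Basis. h b ((\<Sum>b\<in>Basis. f b *\<^sub>R b) \<bullet> (b::'a))))"
    by (subst lborel_eq, subst integral_distr) auto
  also have "\<dots> = (LINT f|(\<Pi>\<^sub>M b\<in>Basis. lborel). (\<Prod>b\<in>Basis. h (b::'a) (f b)))"
    by (intro Bochner_Integration.integral_cong prod.cong refl) (auto simp: inner_sum_left inner_Basis if_distrib sum.delta' cong: if_cong)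
  also have "\<dots> = (\<Prod>b\<in>Basis. (LINT y|lborel. h b y))"
    by (rule product_integral_prod) (auto intro: h)
  finally show ?thesis .
qed

lemma integral_cis_interval:
  assumes "0 < N"
  shows "(LINT y|lborel. indicator {0..<real N} y *\<^sub>R cis (2 * pi / real N * of_int m * y))
    = (if m = 0 then of_nat N else 0)"
proof -
  have "(LINT y|lborel. indicator {0..<real N} y *\<^sub>R cis (2 * pi / real N * of_int m * y))
      = (LINT y|lborel. indicator {0..real N} y *\<^sub>R cis (2 * pi / real N * of_int m * y))"
    using AE_lborel_singleton[of "real N"]
    by (intro integral_cong_AE) (auto simp: indicator_def cis_conv_exp)
  also have "\<dots> = (if m = 0 then of_nat N else 0)"
  proof (cases "m = 0")
    case True
    then show ?thesis by (simp add: scaleR_conv_of_real)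
  next
    case False
    define a where "a = 2 * pi / real N * of_int m"
    have a: "a \<noteq> 0" using False assms by (simp add: a_def)
    have cis0: "cis (a * real N) = 1"
      using assms cis_multiple_2pi[of "of_int m"] by (simp add: a_def mult.commute)
    have "(LINT y|lborel. indicator {0..real N} y *\<^sub>R cis (a * y))
        = cis (a * real N) / (\<i> * complex_of_real a) - cis (a * 0) / (\<i> * complex_of_real a)"
    proof (rule integral_FTC_Icc)
      fix x
      have "((\<lambda>y. exp (\<i> * complex_of_real (a * y)) / (\<i> * complex_of_real a)) has_vector_derivative
         exp (\<i> * complex_of_real (a * x))) (at x within {0..real N})"
        using a by (auto intro!: derivative_eq_intros has_vector_derivative_real_field)
          (simp add: mult.commute mult.left_commute)
      then show "((\<lambda>y. cis (a * y) / (\<i> * complex_of_real a)) has_vector_derivative cis (a * x)) (at x within {0..real N})"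
        by (simp only: cis_conv_exp)
    qed (auto intro!: continuous_intros simp: cis_conv_exp)
    then have "(LINT y|lborel. indicator {0..real N} y *\<^sub>R cis (a * y)) = 0" by (simp only: cis0) simp
    then show ?thesis using False unfolding a_def by simp
  qed
  finally show ?thesis .
qed

lemma cis_sum: "finite A \<Longrightarrow> cis (\<Sum>x\<in>A. f x) = (\<Prod>x\<in>A. cis (f x))"
  by (induction A rule: finite_induct) (auto simp flip: cis_mult)

lemma integral_cis_cube:
  assumes "0 < N" "\<xi> \<in> Xi N"
  shows "(LINT x|lebesgue_on (cube N). cis (\<xi> \<bullet> x)) = (if \<xi> = 0 then complex_of_real (real N ^ 3) else 0)"
proof -
  have "\<forall>k. \<exists>m::int. \<xi>$k = 2 * pi / real N * of_int m" using assms(2) by (simp add: Xi_def)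
  from choice[OF this] obtain m where m: "\<And>k. \<xi>$k = 2 * pi / real N * of_int (m k)" by blast
  define h where "h b y = indicator {0..<real N} y *\<^sub>R cis ((\<xi> \<bullet> b) * y)" for b :: "real^3" and y
  have Basis: "Basis = range (\<lambda>k::3. axis k (1::real))" by (auto simp: Basis_vec_def)
  have inj: "inj (\<lambda>k::3. axis k (1::real))" by (auto intro!: injI simp: axis_eq_axis)
  have hi: "(LINT y|lborel. h (axis k 1) y) = (if m k = 0 then of_nat N else 0)" for k
    using integral_cis_interval[OF assms(1), of "m k"] by (simp add: h_def inner_axis m)
  have prod: "(\<Prod>b\<in>Basis. h b (x \<bullet> b)) = indicator (cube N) x *\<^sub>R cis (\<xi> \<bullet> x)" for x
  proof -
    have "(\<Prod>b\<in>Basis. h b (x \<bullet> b)) = (\<Prod>k\<in>UNIV. indicator {0..<real N} (x$k) *\<^sub>R cis ((\<xi>$k) * (x$k)))"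
      unfolding Basis by (subst prod.reindex[OF inj]) (simp add: h_def inner_axis)
    also have "\<dots> = (\<Prod>k\<in>UNIV. complex_of_real (indicator {0..<real N} (x$k))) * (\<Prod>k\<in>UNIV. cis ((\<xi>$k) * (x$k)))"
      by (simp add: scaleR_conv_of_real prod.distrib)
    also have "(\<Prod>k\<in>UNIV. complex_of_real (indicator {0..<real N} (x$k))) = complex_of_real (indicator (cube N) x)"
      by (auto simp: cube_def indicator_def intro!: prod.neutral)
    also have "(\<Prod>k\<in>UNIV. cis ((\<xi>$k) * (x$k))) = cis (\<xi> \<bullet> x)"
      by (simp add: inner_vec_def cis_sum)
    finally show ?thesis by (simp add: scaleR_conv_of_real)
  qed
  have "integrable lborel (h b)" for b
    unfolding h_def
  proof (rule integrableI_bounded_set_indicator[where B=1])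
    show "(\<lambda>y. cis ((\<xi> \<bullet> b) * y)) \<in> borel_measurable lborel" by (simp add: cis_conv_exp)
  qed auto
  then have "(LINT x|(lborel::(real^3) measure). (\<Prod>b\<in>Basis. h b (x \<bullet> b))) = (\<Prod>b\<in>Basis. (LINT y|lborel. h b y))"
    by (rule lborel_integral_prod)
  also have "\<dots> = (\<Prod>k\<in>UNIV. (LINT y|lborel. h (axis k 1) y))"
    unfolding Basis by (subst prod.reindex[OF inj]) simp
  also have "\<dots> = (if \<xi> = 0 then complex_of_real (real N ^ 3) else 0)"
  proof (cases "\<xi> = 0")
    case True
    then have "m k = 0" for k using m[of k] assms by simp
    then show ?thesis using True by (simp add: hi)
  next
    case False
    then obtain k where "\<xi>$k \<noteq> 0" by (auto simp: vec_eq_iff)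
    then have "m k \<noteq> 0" using m[of k] by auto
    then show ?thesis using False by (auto simp: hi)
  qed
  finally show ?thesis
    by (subst integral_cube) (measurable, simp only: prod)
qed

lemma Xi_diff:
  assumes "\<xi> \<in> Xi N" "\<eta> \<in> Xi N" shows "\<xi> - \<eta> \<in> Xi N"
  unfolding Xi_def
proof (intro CollectI allI)
  fix k
  obtain m n :: int where "\<xi>$k = 2 * pi / real N * of_int m" "\<eta>$k = 2 * pi / real N * of_int n"
    using assms unfolding Xi_def by blast
  then have "(\<xi> - \<eta>)$k = 2 * pi / real N * of_int (m - n)" by (simp add: right_diff_distrib)
  then show "\<exists>m::int. (\<xi> - \<eta>)$k = 2 * pi / real N * of_int m" by blast
qed

lemma Xi_0 [simp]: "0 \<in> Xi N"
  by (auto simp: Xi_def intro!: exI[of _ 0])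

lemma Xi_uminus: "\<xi> \<in> Xi N \<Longrightarrow> - \<xi> \<in> Xi N"
  using Xi_diff[OF Xi_0, of \<xi> N] by simp

lemma Xi_add: "\<xi> \<in> Xi N \<Longrightarrow> \<eta> \<in> Xi N \<Longrightarrow> \<xi> + \<eta> \<in> Xi N"
  using Xi_diff[of \<xi> N "- \<eta>"] Xi_uminus[of \<eta> N] by simp

lemma emeasure_cube: "0 < N \<Longrightarrow> emeasure (lebesgue_on (cube N)) (cube N) < \<infinity>"
proof -
  assume "0 < N"
  have "cube N \<subseteq> cbox 0 (\<chi> k. real N)" by (auto simp: cube_def mem_box_cart less_imp_le)
  then have "emeasure lborel (cube N) \<le> emeasure lborel (cbox 0 (\<chi> k. real N) :: (real^3) set)"
    by (intro emeasure_mono) auto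
  also have "\<dots> < \<infinity>" using emeasure_bounded_finite[OF bounded_cbox] by simp
  finally show ?thesis by (simp add: emeasure_restrict_space)
qed

lemma finite_measure_cube: "0 < N \<Longrightarrow> finite_measure (lebesgue_on (cube N))"
  by (rule finite_measureI) (use emeasure_cube[of N] in auto)

lemma axis_in_Xi: "axis k (2 * pi / real N) \<in> Xi N"
proof -
  have "axis k (2 * pi / real N) $ i = 2 * pi / real N * of_int (if i = k then 1 else 0)" for i
    by (simp add: axis_def)
  then show ?thesis unfolding Xi_def by blast
qed

section \<open>Completeness of the characters on the cube\<close>

definition vanishing_coefs :: "nat \<Rightarrow> (real^3 \<Rightarrow> complex) \<Rightarrow> bool" where
  "vanishing_coefs N f \<longleftrightarrow> integrable (lebesgue_on (cube N)) f \<and>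
    (\<forall>\<xi>\<in>Xi N. (LINT x|lebesgue_on (cube N). f x * cnj (cis (\<xi> \<bullet> x))) = 0)"

text \<open>Embeds the torus into complex 3-space as a product of unit circles. Real polynomials
  there pull back to trigonometric polynomials, so Stone-Weierstrass on a ball applies although the
  half-open cube is not compact.\<close>

definition torus_map :: "nat \<Rightarrow> real^3 \<Rightarrow> complex^3" where
  "torus_map N x = (\<chi> k. cis (2 * pi / real N * x$k))"

lemma continuous_torus_map: "continuous_on UNIV (torus_map N)"
  unfolding torus_map_def cis_conv_exp by (intro continuous_intros)

lemma integrable_mult_bounded:
  fixes f g :: "'a \<Rightarrow> complex"
  assumes "integrable M f" "g \<in> borel_measurable M" "\<And>x. cmod (g x) \<le> B"
  shows "integrable M (\<lambda>x. f x * g x)"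
proof (rule Bochner_Integration.integrable_bound[of M "\<lambda>x. B * cmod (f x)"])
  show "(\<lambda>x. f x * g x) \<in> borel_measurable M" using assms by measurable
  show "AE x in M. cmod (f x * g x) \<le> norm (B * cmod (f x))"
  proof (rule AE_I2)
    fix x
    have "0 \<le> B" using assms(3) norm_ge_zero order_trans by blast
    then show "cmod (f x * g x) \<le> norm (B * cmod (f x))"
      using mult_right_mono[OF assms(3), of "cmod (f x)" x] by (simp add: norm_mult mult.commute)
  qed
qed (use assms in auto)

lemma cis_inner_measurable [measurable]: "(\<lambda>x. cis (\<xi> \<bullet> x)) \<in> borel_measurable (lebesgue_on (cube N))"
  by (rule measurable_cube) measurable

lemma vanishing_coefs_cis:
  assumes "vanishing_coefs N f" "\<eta> \<in> Xi N"
  shows "vanishing_coefs N (\<lambda>x. f x * cis (\<eta> \<bullet> x))"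
  unfolding vanishing_coefs_def
proof (intro conjI ballI)
  show "integrable (lebesgue_on (cube N)) (\<lambda>x. f x * cis (\<eta> \<bullet> x))"
    using assms by (intro integrable_mult_bounded[where B=1]) (auto simp: vanishing_coefs_def)
  fix \<xi> assume "\<xi> \<in> Xi N"
  then have "\<xi> - \<eta> \<in> Xi N" using assms by (intro Xi_diff)
  then have "(LINT x|lebesgue_on (cube N). f x * cnj (cis ((\<xi> - \<eta>) \<bullet> x))) = 0"
    using assms by (simp add: vanishing_coefs_def)
  moreover have "cis (\<eta> \<bullet> x) * cnj (cis (\<xi> \<bullet> x)) = cnj (cis ((\<xi> - \<eta>) \<bullet> x))" for x
    by (simp add: cis_cnj cis_mult inner_diff_left)
  ultimately show "(LINT x|lebesgue_on (cube N). f x * cis (\<eta> \<bullet> x) * cnj (cis (\<xi> \<bullet> x))) = 0"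
    by (simp add: mult.assoc)
qed

lemma vanishing_coefs_add:
  assumes "vanishing_coefs N f" "vanishing_coefs N g"
  shows "vanishing_coefs N (\<lambda>x. f x + g x)"
proof -
  have "integrable (lebesgue_on (cube N)) (\<lambda>x. f x * cnj (cis (\<xi> \<bullet> x)))"
    if "vanishing_coefs N f" for f \<xi>
    using that by (intro integrable_mult_bounded[where B=1]) (auto simp: vanishing_coefs_def)
  then show ?thesis
    using assms by (auto simp: vanishing_coefs_def distrib_right)
qed

lemma vanishing_coefs_scale: "vanishing_coefs N f \<Longrightarrow> vanishing_coefs N (\<lambda>x. c * f x)"
  by (auto simp: vanishing_coefs_def mult.assoc)

lemma vanishing_coefs_sum:
  assumes "\<And>i. i \<in> I \<Longrightarrow> vanishing_coefs N (f i)" "finite I"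
  shows "vanishing_coefs N (\<lambda>x. \<Sum>i\<in>I. f i x)"
  using assms(2,1)
proof (induction I rule: finite_induct)
  case empty
  then show ?case by (simp add: vanishing_coefs_def)
next
  case (insert i I)
  then show ?case using vanishing_coefs_add[of N "f i" "\<lambda>x. \<Sum>i\<in>I. f i x"] by simp
qed

text \<open>Multiplication by a character only shifts frequencies, and a real linear form in the
  circle coordinates is a combination of characters with frequencies along the axes. For a product
  of polynomials the two factors are applied in turn, hence the induction with arbitrary
  \<open>f\<close>.\<close>

lemma vanishing_coefs_polynomial:
  assumes "real_polynomial_function p" "vanishing_coefs N f"
  shows "vanishing_coefs N (\<lambda>x. f x * complex_of_real (p (torus_map N x)))"
  using assms
proof (induction p arbitrary: f rule: real_polynomial_function.induct)
  case (linear p)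
  interpret bounded_linear p by fact
  define a where "a k = p (axis k 1)" for k
  define b where "b k = p (axis k \<i>)" for k
  have p: "p z = (\<Sum>k\<in>UNIV. Re (z$k) * a k + Im (z$k) * b k)" for z
  proof -
    have "z = (\<Sum>k\<in>UNIV. Re (z$k) *\<^sub>R axis k 1 + Im (z$k) *\<^sub>R axis k \<i>)"
      by (simp add: vec_eq_iff axis_def if_distrib[of "\<lambda>t. _ *\<^sub>R t"] sum.distrib complex_eq_iff cong: if_cong)
    then have "p z = p (\<Sum>k\<in>UNIV. Re (z$k) *\<^sub>R axis k 1 + Im (z$k) *\<^sub>R axis k \<i>)" by metis
    also have "\<dots> = (\<Sum>k\<in>UNIV. Re (z$k) * a k + Im (z$k) * b k)"
      by (simp add: sum add scaleR a_def b_def)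
    finally show ?thesis .
  qed
  define \<eta> where "\<eta> k = (axis k (2 * pi / real N) :: real^3)" for k
  have E: "torus_map N x $ k = cis (\<eta> k \<bullet> x)" for x k
    by (simp add: torus_map_def \<eta>_def inner_axis')
  \<comment> \<open>For a point \<open>z\<close> of the circle with conjugate \<open>z'\<close>,
    real numbers satisfy \<open>a * Re z + b * Im z = ((a - \<i> * b) * z + (a + \<i> * b) * z') /
    2\<close>, and \<open>z'\<close> is the character of the opposite frequency.\<close>
  have eq: "complex_of_real (p (torus_map N x)) = (\<Sum>k\<in>UNIV. ((complex_of_real (a k) - \<i> * b k) / 2) * cis (\<eta> k \<bullet> x)
     + ((complex_of_real (a k) + \<i> * b k) / 2) * cis (- \<eta> k \<bullet> x))" for x
    unfolding p of_real_sum
    by (intro sum.cong refl) (auto simp: E complex_eq_iff field_simps)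
  have eq2: "(\<lambda>x. f x * complex_of_real (p (torus_map N x))) = (\<lambda>x. \<Sum>k\<in>UNIV.
     ((complex_of_real (a k) - \<i> * b k) / 2) * (f x * cis (\<eta> k \<bullet> x))
     + ((complex_of_real (a k) + \<i> * b k) / 2) * (f x * cis (- \<eta> k \<bullet> x)))"
    unfolding eq sum_distrib_left
    by (intro ext sum.cong refl) (simp only: distrib_left mult.left_commute[of "f x" for x])
  show ?case
    unfolding eq2 using axis_in_Xi
    by (intro vanishing_coefs_sum vanishing_coefs_add vanishing_coefs_scale vanishing_coefs_cis linear.prems Xi_uminus)
      (auto simp: \<eta>_def)
next
  case (const c)
  then show ?case using vanishing_coefs_scale[of N f "complex_of_real c"] by (simp add: mult.commute)
next
  case (add p q)
  then show ?case using vanishing_coefs_add[OF add.IH] by (simp add: distrib_left)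
next
  case (mult p q)
  from mult.IH(2)[OF mult.IH(1)[OF mult.prems]] show ?case by (simp add: mult.assoc)
qed

lemma vanishing_coefs_integral:
  assumes "vanishing_coefs N f" shows "(LINT x|lebesgue_on (cube N). f x) = 0"
proof -
  have "(LINT x|lebesgue_on (cube N). f x * cnj (cis (0 \<bullet> x))) = 0"
    using assms Xi_0[of N] unfolding vanishing_coefs_def by blast
  then show ?thesis by simp
qed

text \<open>The torus map takes values in the ball of radius 3, on which \<open>h\<close> is a
  uniform limit of polynomials. Replacing \<open>h\<close> by a polynomial within \<open>e\<close>
  changes the integral by at most \<open>e\<close> times the integral of \<open>cmod (f x)\<close>,
  and for polynomials the integral vanishes.\<close>

lemma vanishing_coefs_continuous:
  assumes f: "vanishing_coefs N f" and h: "continuous_on UNIV h" "\<And>z. \<bar>h z\<bar> \<le> B"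
  shows "(LINT x|lebesgue_on (cube N). f x * complex_of_real (h (torus_map N x))) = 0"
proof -
  define I where "I = (LINT x|lebesgue_on (cube N). f x * complex_of_real (h (torus_map N x)))"
  define A where "A = (LINT x|lebesgue_on (cube N). cmod (f x))"
  have fi: "integrable (lebesgue_on (cube N)) f" using f by (simp add: vanishing_coefs_def)
  have hm: "(\<lambda>x. complex_of_real (h (torus_map N x))) \<in> borel_measurable (lebesgue_on (cube N))"
    by (intro measurable_cube borel_measurable_continuous_onI continuous_intros
        continuous_on_compose2[OF h(1) continuous_torus_map]) auto
  have int: "integrable (lebesgue_on (cube N)) (\<lambda>x. f x * complex_of_real (h (torus_map N x)))"
    by (rule integrable_mult_bounded[OF fi hm, of B]) (simp add: h)
  have "cmod I \<le> e * A" if e: "e > 0" for e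
  proof -
    obtain p where p: "real_polynomial_function p" "\<And>z. z \<in> cball (0::complex^3) 3 \<Longrightarrow> \<bar>h z - p z\<bar> < e"
      using Stone_Weierstrass_real_polynomial_function[OF compact_cball[of "0::complex^3" 3] continuous_on_subset[OF h(1) subset_UNIV] e] by blast
    have "norm (torus_map N x) \<le> 3" for x
    proof -
      have "norm (torus_map N x) \<le> (\<Sum>k\<in>UNIV. norm (torus_map N x $ k))" unfolding norm_vec_def by (rule L2_set_le_sum) simp
      also have "\<dots> = 3" by (simp add: torus_map_def)
      finally show ?thesis .
    qed
    then have close: "\<bar>h (torus_map N x) - p (torus_map N x)\<bar> \<le> e" for x
      using p(2)[of "torus_map N x"] by (simp add: less_imp_le)
    have v: "vanishing_coefs N (\<lambda>x. f x * complex_of_real (p (torus_map N x)))"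
      by (rule vanishing_coefs_polynomial[OF p(1) f])
    then have int2: "integrable (lebesgue_on (cube N)) (\<lambda>x. f x * complex_of_real (p (torus_map N x)))"
      by (simp add: vanishing_coefs_def)
    have "I = I - (LINT x|lebesgue_on (cube N). f x * complex_of_real (p (torus_map N x)))"
      using vanishing_coefs_integral[OF v] by simp
    also have "\<dots> = (LINT x|lebesgue_on (cube N). f x * complex_of_real (h (torus_map N x)) - f x * complex_of_real (p (torus_map N x)))"
      unfolding I_def using int int2 by simp
    finally have "cmod I \<le> (LINT x|lebesgue_on (cube N). cmod (f x * complex_of_real (h (torus_map N x)) - f x * complex_of_real (p (torus_map N x))))"
      by simp
    also have "\<dots> \<le> (LINT x|lebesgue_on (cube N). e * cmod (f x))"
    proof (rule integral_mono)
      fix x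
      have "cmod (f x * complex_of_real (h (torus_map N x)) - f x * complex_of_real (p (torus_map N x)))
          = cmod (f x) * \<bar>h (torus_map N x) - p (torus_map N x)\<bar>"
        by (simp flip: right_diff_distrib of_real_diff add: norm_mult)
      also have "\<dots> \<le> e * cmod (f x)" using mult_left_mono[OF close[of x], of "cmod (f x)"] by (simp add: mult.commute)
      finally show "cmod (f x * complex_of_real (h (torus_map N x)) - f x * complex_of_real (p (torus_map N x))) \<le> e * cmod (f x)" .
    qed (use int int2 fi in auto)
    finally show ?thesis by (simp add: A_def)
  qed
  then have "cmod I \<le> 0 + e" if "e > 0" for e
  proof -
    have A: "0 \<le> A" by (simp add: A_def)
    have "cmod I \<le> e / (A + 1) * A" using A that \<open>\<And>e. e > 0 \<Longrightarrow> cmod I \<le> e * A\<close>[of "e / (A + 1)"] by simp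
    also have "\<dots> \<le> e" using A that by (simp add: field_simps)
    finally show ?thesis by simp
  qed
  then have "cmod I \<le> 0" by (rule field_le_epsilon)
  then show ?thesis by (simp add: I_def)
qed

lemma vanishing_coefs_open:
  assumes f: "vanishing_coefs N f" and U: "open U"
  shows "(LINT x|lebesgue_on (cube N). f x * complex_of_real (indicator U (torus_map N x))) = 0"
proof -
  \<comment> \<open>Continuous functions tending to the indicator of \<open>U\<close>. The whole
    space is treated apart, since \<open>infdist\<close> to the empty set is 0 and would give the
    wrong limit.\<close>
  define h where "h n z = (if U = UNIV then 1 else min 1 (real n * infdist z (- U)))" for n z
  have h: "continuous_on UNIV (h n)" "\<bar>h n z\<bar> \<le> 1" for n z
  proof -
    show "continuous_on UNIV (h n)" unfolding h_def[abs_def]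
      by (cases "U = UNIV") (auto intro!: continuous_intros)
    have "0 \<le> real n * infdist z (- U)" by (simp add: infdist_nonneg)
    then show "\<bar>h n z\<bar> \<le> 1" by (simp add: h_def)
  qed
  have hlim: "(\<lambda>n. h n z) \<longlonglongrightarrow> indicator U z" for z
  proof (cases "z \<in> U \<and> U \<noteq> UNIV")
    case True
    then have pos: "infdist z (- U) > 0"
      using infdist_pos_not_in_closed[of "- U" z] U by (auto simp: closed_Compl)
    then obtain n0 where n0: "1 / infdist z (- U) < real n0" using reals_Archimedean2 by blast
    have "\<forall>\<^sub>F n in sequentially. h n z = 1"
      unfolding eventually_sequentially
    proof (intro exI[of _ n0] allI impI)
      fix n assume "n0 \<le> n"
      then have "1 / infdist z (- U) \<le> real n" using n0 by linarith
      then have "1 \<le> real n * infdist z (- U)" using pos by (simp add: field_simps)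
      then show "h n z = 1" using True by (simp add: h_def)
    qed
    then show ?thesis using True by (simp add: tendsto_eventually)
  next
    case False
    then have "h n z = indicator U z" for n by (auto simp: h_def)
    then show ?thesis by simp
  qed
  have fi: "integrable (lebesgue_on (cube N)) f" using f by (simp add: vanishing_coefs_def)
  have "(\<lambda>n. LINT x|lebesgue_on (cube N). f x * complex_of_real (h n (torus_map N x)))
     \<longlonglongrightarrow> (LINT x|lebesgue_on (cube N). f x * complex_of_real (indicator U (torus_map N x)))"
  proof (rule integral_dominated_convergence[where w="\<lambda>x. cmod (f x)"])
    have "torus_map N \<in> borel_measurable borel" by (rule borel_measurable_continuous_onI[OF continuous_torus_map])
    then have [measurable]: "torus_map N \<in> borel_measurable (lebesgue_on (cube N))" by (rule measurable_cube)
    have [measurable]: "U \<in> sets borel" using U by simp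
    have [measurable]: "h n \<in> borel_measurable borel" for n by (rule borel_measurable_continuous_onI[OF h(1)])
    show "(\<lambda>x. f x * complex_of_real (indicator U (torus_map N x))) \<in> borel_measurable (lebesgue_on (cube N))"
      using fi by measurable
    show "(\<lambda>x. f x * complex_of_real (h n (torus_map N x))) \<in> borel_measurable (lebesgue_on (cube N))" for n
      using fi by measurable
    show "AE x in lebesgue_on (cube N). cmod (f x * complex_of_real (h n (torus_map N x))) \<le> cmod (f x)" for n
    proof (rule AE_I2)
      fix x show "cmod (f x * complex_of_real (h n (torus_map N x))) \<le> cmod (f x)"
        using mult_left_mono[OF h(2)[of n "torus_map N x"], of "cmod (f x)"] by (simp add: norm_mult)
    qed
  qed (use fi in \<open>auto intro!: AE_I2 tendsto_intros hlim\<close>)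
  then show ?thesis
    using vanishing_coefs_continuous[OF f h] by (simp add: LIMSEQ_const_iff)
qed

text \<open>Dynkin's argument: the sets with vanishing integral contain the open sets, which are
  stable under intersection and generate the Borel sets, and they are closed under complements and
  countable disjoint unions.\<close>

lemma vanishing_coefs_borel:
  assumes f: "vanishing_coefs N f" and B: "B \<in> sets borel"
  shows "(LINT x|lebesgue_on (cube N). f x * complex_of_real (indicator B (torus_map N x))) = 0"
proof -
  have fi: "integrable (lebesgue_on (cube N)) f" using f by (simp add: vanishing_coefs_def)
  have "torus_map N \<in> borel_measurable borel" by (rule borel_measurable_continuous_onI[OF continuous_torus_map])
  then have E [measurable]: "torus_map N \<in> borel_measurable (lebesgue_on (cube N))" by (rule measurable_cube)
  have int: "integrable (lebesgue_on (cube N)) (\<lambda>x. f x * complex_of_real (indicator A (torus_map N x)))"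
    if [measurable]: "A \<in> sets borel" for A
    by (rule integrable_mult_bounded[OF fi, where B=1]) (auto simp: indicator_def)
  have "Int_stable {S :: (complex^3) set. open S}" by (auto simp: Int_stable_def)
  moreover have "{S :: (complex^3) set. open S} \<subseteq> Pow UNIV" by auto
  moreover have "B \<in> sigma_sets UNIV {S. open S}" using B by (simp add: borel_def)
  ultimately show ?thesis
  proof (induction rule: sigma_sets_induct_disjoint)
    case (basic A)
    then show ?case using vanishing_coefs_open[OF f] by simp
  next
    case empty
    then show ?case by simp
  next
    case (compl A)
    then have [measurable]: "A \<in> sets borel" by (simp add: borel_def)
    have "(\<lambda>x. f x * complex_of_real (indicator (UNIV - A) (torus_map N x)))
        = (\<lambda>x. f x - f x * complex_of_real (indicator A (torus_map N x)))"
      by (auto simp: indicator_def fun_eq_iff)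
    then show ?case using compl int[of A] fi vanishing_coefs_integral[OF f] by simp
  next
    case (union A)
    then have [measurable]: "A i \<in> sets borel" for i by (simp add: borel_def image_subset_iff)
    have "(\<lambda>n. LINT x|lebesgue_on (cube N). f x * complex_of_real (indicator (\<Union>i<n. A i) (torus_map N x)))
     \<longlonglongrightarrow> (LINT x|lebesgue_on (cube N). f x * complex_of_real (indicator (\<Union>i. A i) (torus_map N x)))"
    proof (rule integral_dominated_convergence[where w="\<lambda>x. cmod (f x)"])
      show "AE x in lebesgue_on (cube N). (\<lambda>n. f x * complex_of_real (indicator (\<Union>i<n. A i) (torus_map N x)))
          \<longlonglongrightarrow> f x * complex_of_real (indicator (\<Union>i. A i) (torus_map N x))"
        by (intro AE_I2 tendsto_intros LIMSEQ_indicator_UN)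
      show "AE x in lebesgue_on (cube N). cmod (f x * complex_of_real (indicator (\<Union>i<n. A i) (torus_map N x))) \<le> cmod (f x)" for n
        by (rule AE_I2) (auto simp: indicator_def)
    qed (use fi in \<open>auto intro!: borel_measurable_integrable int\<close>)
    moreover have "(LINT x|lebesgue_on (cube N). f x * complex_of_real (indicator (\<Union>i<n. A i) (torus_map N x))) = 0" for n
    proof -
      have "indicator (\<Union>i<n. A i) z = (\<Sum>i<n. indicator (A i) z :: real)" for z
        using union(1) by (intro indicator_UN_disjoint) (auto simp: disjoint_family_on_def)
      then have "(\<lambda>x. f x * complex_of_real (indicator (\<Union>i<n. A i) (torus_map N x)))
          = (\<lambda>x. \<Sum>i<n. f x * complex_of_real (indicator (A i) (torus_map N x)))"
        by (simp add: sum_distrib_left)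
      then show ?thesis using int union by simp
    qed
    ultimately show ?case by (simp add: LIMSEQ_const_iff)
  qed
qed

text \<open>A Borel left inverse of \<open>torus_map\<close> on the half-open cube: the angle is
  read off from its cosine, and the sign of the sine selects the half circle. Clamping to the
  interval from -1 to 1 makes the arccos term continuous everywhere. Through it every Borel subset
  of the cube becomes a preimage under \<open>torus_map\<close>.\<close>

definition torus_inv :: "nat \<Rightarrow> complex^3 \<Rightarrow> real^3" where
  "torus_inv N z = (\<chi> k. real N / (2 * pi) * (if 0 \<le> Im (z$k) then arccos (max (-1) (min 1 (Re (z$k))))
     else 2 * pi - arccos (max (-1) (min 1 (Re (z$k))))))"

lemma torus_inv_measurable: "torus_inv N \<in> borel_measurable borel"
proof -
  have m: "(\<lambda>z::complex^3. z$k) \<in> borel_measurable borel" for k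
    by (intro borel_measurable_continuous_onI continuous_intros)
  have "continuous_on UNIV (\<lambda>t. arccos (max (-1) (min 1 t)))"
    by (intro continuous_on_arccos continuous_intros) auto
  then have arc [measurable]: "(\<lambda>t. arccos (max (-1) (min 1 t))) \<in> borel_measurable borel"
    by (rule borel_measurable_continuous_onI)
  have "(\<lambda>z. torus_inv N z $ k) \<in> borel_measurable borel" for k
    using measurable_compose[OF measurable_compose[OF m borel_measurable_Re] arc] m[of k]
    unfolding torus_inv_def by (simp) measurable
  then have "(\<lambda>z. torus_inv N z \<bullet> b) \<in> borel_measurable borel" if "b \<in> Basis" for b
    using that by (auto simp: Basis_vec_def inner_axis)
  then show ?thesis by (subst borel_measurable_euclidean_space) auto
qed

lemma torus_inv_map:
  assumes "0 < N" "x \<in> cube N"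
  shows "torus_inv N (torus_map N x) = x"
proof -
  have "torus_inv N (torus_map N x) $ k = x$k" for k
  proof -
    define \<theta> where \<theta>: "\<theta> = 2 * pi / real N * x$k"
    have x: "0 \<le> x$k" "x$k < real N" using assms by (auto simp: cube_def)
    then have t: "0 \<le> \<theta>" "\<theta> < 2 * pi" using assms(1) by (auto simp: \<theta> field_simps)
    have "(if 0 \<le> sin \<theta> then arccos (cos \<theta>) else 2 * pi - arccos (cos \<theta>)) = \<theta>"
    proof (cases "\<theta> \<le> pi")
      case True
      then show ?thesis using t sin_ge_zero[of \<theta>] arccos_cos[of \<theta>] by simp
    next
      case False
      then have "sin \<theta> < 0" using sin_lt_zero t by simp
      moreover have "arccos (cos \<theta>) = 2 * pi - \<theta>"
        using arccos_cos[of "2 * pi - \<theta>"] False t by (simp add: cos_diff)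
      ultimately show ?thesis by simp
    qed
    moreover have "torus_inv N (torus_map N x) $ k
        = real N / (2 * pi) * (if 0 \<le> sin \<theta> then arccos (cos \<theta>) else 2 * pi - arccos (cos \<theta>))"
      unfolding \<theta> by (simp add: torus_inv_def torus_map_def)
    ultimately have "torus_inv N (torus_map N x) $ k = real N / (2 * pi) * \<theta>" by simp
    then show ?thesis using assms(1) by (simp add: \<theta>)
  qed
  then show ?thesis by (simp add: vec_eq_iff)
qed

text \<open>The function is only Lebesgue measurable while the test sets are Borel. A Borel function
  \<open>w\<close> that agrees almost everywhere has Borel sets of positivity and negativity, and
  testing on these two sets shows that it vanishes.\<close>

lemma vanishing_set_integrals_AE_0:
  fixes u :: "'a::euclidean_space \<Rightarrow> real"
  assumes u: "integrable (lebesgue_on S) u" and S: "S \<in> sets lebesgue"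
    and 0: "\<And>A. A \<in> sets borel \<Longrightarrow> (LINT x|lebesgue_on S. u x * indicator A x) = 0"
  shows "AE x in lebesgue_on S. u x = 0"
proof -
  define v where "v x = indicator S x *\<^sub>R u x" for x
  have v: "integrable lebesgue v"
    using u S unfolding v_def by (subst (asm) integrable_restrict_space) auto
  obtain w where w [measurable]: "w \<in> borel_measurable borel" and vw: "AE x in lborel. v x = w x"
    using completion_ex_borel_measurable_real[OF borel_measurable_integrable[OF v]] by auto
  have vw': "AE x in lebesgue. v x = w x" using vw by (simp add: AE_completion_iff)
  have iv: "(LINT x|lebesgue. v x * indicator A x) = 0" if "A \<in> sets borel" for A
    using 0[OF that] S by (simp add: integral_restrict_space v_def mult.assoc)
  have wi: "integrable lebesgue w"
    by (rule integrable_cong_AE_imp[OF v]) (use w vw' in \<open>auto intro: measurable_completion\<close>)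
  have zero: "AE x in lebesgue. w x * indicator A x = 0" if A: "A \<in> sets borel" "\<And>x. 0 \<le> c * (w x * indicator A x)" and c: "c \<noteq> 0" for A c
  proof -
    have m: "(\<lambda>x. w x * indicator A x) \<in> borel_measurable lebesgue" using A(1) by (intro measurable_completion) simp
    have "(LINT x|lebesgue. w x * indicator A x) = (LINT x|lebesgue. v x * indicator A x)"
      using vw' m v A(1) by (intro integral_cong_AE) (auto intro!: borel_measurable_integrable integrable_real_mult_indicator)
    then have "(LINT x|lebesgue. c * (w x * indicator A x)) = 0" using iv[OF A(1)] by simp
    moreover have "integrable lebesgue (\<lambda>x. c * (w x * indicator A x))"
      using wi A(1) by (intro integrable_mult_right integrable_real_mult_indicator) auto
    ultimately have "AE x in lebesgue. c * (w x * indicator A x) = 0"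
      using A(2) by (subst (asm) integral_nonneg_eq_0_iff_AE) auto
    then show ?thesis using c by auto
  qed
  have "AE x in lebesgue. w x * indicator {x. 0 < w x} x = 0"
    by (rule zero[where c=1]) (auto simp: indicator_def)
  moreover have "AE x in lebesgue. w x * indicator {x. w x < 0} x = 0"
    by (rule zero[where c="-1"]) (auto simp: indicator_def)
  ultimately have "AE x in lebesgue. x \<in> S \<longrightarrow> u x = 0"
    using vw' by eventually_elim (auto simp: indicator_def v_def not_less split: if_splits)
  then show ?thesis using S by (subst AE_restrict_space_iff) auto
qed

lemma vanishing_coefs_AE_0:
  assumes N: "0 < N" and f: "vanishing_coefs N f"
  shows "AE x in lebesgue_on (cube N). f x = 0"
proof -
  have fi: "integrable (lebesgue_on (cube N)) f" using f by (simp add: vanishing_coefs_def)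
  have z: "(LINT x|lebesgue_on (cube N). f x * complex_of_real (indicator A x)) = 0" if "A \<in> sets borel" for A
  proof -
    have "torus_inv N -` A \<in> sets borel" using measurable_sets[OF torus_inv_measurable that] by simp
    then have "(LINT x|lebesgue_on (cube N). f x * complex_of_real (indicator (torus_inv N -` A) (torus_map N x))) = 0"
      by (rule vanishing_coefs_borel[OF f])
    moreover have "(LINT x|lebesgue_on (cube N). f x * complex_of_real (indicator (torus_inv N -` A) (torus_map N x)))
        = (LINT x|lebesgue_on (cube N). f x * complex_of_real (indicator A x))"
      using N by (intro Bochner_Integration.integral_cong) (auto simp: torus_inv_map indicator_def)
    ultimately show ?thesis by simp
  qed
  have int: "integrable (lebesgue_on (cube N)) (\<lambda>x. f x * complex_of_real (indicator A x))" if "A \<in> sets borel" for A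
  proof (rule integrable_mult_bounded[OF fi, where B=1])
    show "(\<lambda>x. complex_of_real (indicator A x)) \<in> borel_measurable (lebesgue_on (cube N))"
    proof (rule measurable_cube)
      have [measurable]: "A \<in> sets borel" by (rule that)
      show "(\<lambda>x. complex_of_real (indicator A x)) \<in> borel_measurable borel" by measurable
    qed
  qed (auto simp: indicator_def)
  have "AE x in lebesgue_on (cube N). Re (f x) = 0"
  proof (rule vanishing_set_integrals_AE_0)
    fix A :: "(real^3) set" assume A: "A \<in> sets borel"
    have "(LINT x|lebesgue_on (cube N). Re (f x * complex_of_real (indicator A x))) = 0"
      using integral_Re[OF int[OF A]] z[OF A] by simp
    then show "(LINT x|lebesgue_on (cube N). Re (f x) * indicator A x) = 0" by simp
  qed (use fi in auto)
  moreover have "AE x in lebesgue_on (cube N). Im (f x) = 0"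
  proof (rule vanishing_set_integrals_AE_0)
    fix A :: "(real^3) set" assume A: "A \<in> sets borel"
    have "(LINT x|lebesgue_on (cube N). Im (f x * complex_of_real (indicator A x))) = 0"
      using integral_Im[OF int[OF A]] z[OF A] by simp
    then show "(LINT x|lebesgue_on (cube N). Im (f x) * indicator A x) = 0" by simp
  qed (use fi in auto)
  ultimately show ?thesis by eventually_elim (simp add: complex_eq_iff)
qed

lemma fourier_basis_cube:
  assumes "0 < N"
  shows "fourier_basis (lebesgue_on (cube N)) (Xi N) (\<lambda>\<xi> x. cis (\<xi> \<bullet> x)) (real N ^ 3)"
proof -
  interpret finite_measure "lebesgue_on (cube N)" by (rule finite_measure_cube[OF assms])
  show ?thesis
  proof
    fix \<xi> \<eta> assume "\<xi> \<in> Xi N" "\<eta> \<in> Xi N"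
    then show "(LINT x|lebesgue_on (cube N). cis (\<xi> \<bullet> x) * cnj (cis (\<eta> \<bullet> x)))
        = (if \<xi> = \<eta> then complex_of_real (real N ^ 3) else 0)"
      using integral_cis_cube[OF assms Xi_diff, of \<xi> \<eta>] by (simp add: cis_cnj cis_mult inner_diff_left)
  next
    fix f assume "integrable (lebesgue_on (cube N)) f"
      "\<And>\<xi>. \<xi> \<in> Xi N \<Longrightarrow> (LINT x|lebesgue_on (cube N). f x * cnj (cis (\<xi> \<bullet> x))) = 0"
    then show "AE x in lebesgue_on (cube N). f x = 0"
      by (intro vanishing_coefs_AE_0 assms) (auto simp: vanishing_coefs_def)
  qed (use assms in auto)
qed

section \<open>Characters of the configuration space\<close>

text \<open>With the enlarged product as an image of a binary product, integrability and Fubini's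
  theorem transfer to complex integrands, whichever of the two variables is integrated
  first.\<close>

lemma (in product_sigma_finite) distr_PiM_insert:
  assumes J: "finite J" "i \<notin> J"
  shows "distr (PiM J M \<Otimes>\<^sub>M M i) (PiM (insert i J) M) (\<lambda>(x, y). x(i := y)) = PiM (insert i J) M"
proof (rule measure_eqI)
  fix A assume "A \<in> sets (distr (PiM J M \<Otimes>\<^sub>M M i) (PiM (insert i J) M) (\<lambda>(x, y). x(i := y)))"
  then have A [measurable]: "A \<in> sets (PiM (insert i J) M)" by simp
  interpret J: finite_product_sigma_finite M J by standard fact
  interpret pair_sigma_finite "PiM J M" "M i" ..
  have "emeasure (distr (PiM J M \<Otimes>\<^sub>M M i) (PiM (insert i J) M) (\<lambda>(x, y). x(i := y))) A
      = (\<integral>\<^sup>+z. indicator A z \<partial>distr (PiM J M \<Otimes>\<^sub>M M i) (PiM (insert i J) M) (\<lambda>(x, y). x(i := y)))"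
    by simp
  also have "\<dots> = (\<integral>\<^sup>+z. indicator A (case z of (x, y) \<Rightarrow> x(i := y)) \<partial>(PiM J M \<Otimes>\<^sub>M M i))"
    by (rule nn_integral_distr) measurable
  also have "\<dots> = (\<integral>\<^sup>+x. \<integral>\<^sup>+y. indicator A (x(i := y)) \<partial>M i \<partial>PiM J M)"
    by (subst sigma_finite_measure.nn_integral_fst[OF sigma_finite_measures, symmetric]) auto
  also have "\<dots> = (\<integral>\<^sup>+z. indicator A z \<partial>PiM (insert i J) M)"
    by (rule product_nn_integral_insert[symmetric, OF J]) measurable
  finally show "emeasure (distr (PiM J M \<Otimes>\<^sub>M M i) (PiM (insert i J) M) (\<lambda>(x, y). x(i := y))) A
      = emeasure (PiM (insert i J) M) A" by simp
qed simp

lemma (in product_sigma_finite) integrable_PiM_insert: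
  fixes f :: "('i \<Rightarrow> 'a) \<Rightarrow> complex"
  assumes J: "finite J" "i \<notin> J" and f: "integrable (PiM (insert i J) M) f"
  shows "integrable (PiM J M \<Otimes>\<^sub>M M i) (\<lambda>(x, y). f (x(i := y)))"
    and "integral\<^sup>L (PiM (insert i J) M) f = (\<integral>z. (case z of (x, y) \<Rightarrow> f (x(i := y))) \<partial>(PiM J M \<Otimes>\<^sub>M M i))"
proof -
  have f': "integrable (distr (PiM J M \<Otimes>\<^sub>M M i) (PiM (insert i J) M) (\<lambda>(x, y). x(i := y))) f"
    using f by (simp add: distr_PiM_insert[OF J])
  show "integrable (PiM J M \<Otimes>\<^sub>M M i) (\<lambda>(x, y). f (x(i := y)))"
    using integrable_distr[OF measurable_add_dim f'] by (simp add: case_prod_unfold)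
  have "integral\<^sup>L (PiM (insert i J) M) f = integral\<^sup>L (distr (PiM J M \<Otimes>\<^sub>M M i) (PiM (insert i J) M) (\<lambda>(x, y). x(i := y))) f"
    by (simp add: distr_PiM_insert[OF J])
  also have "\<dots> = (\<integral>z. (case z of (x, y) \<Rightarrow> f (x(i := y))) \<partial>(PiM J M \<Otimes>\<^sub>M M i))"
    using f by (subst integral_distr[OF measurable_add_dim]) (auto simp: case_prod_unfold)
  finally show "integral\<^sup>L (PiM (insert i J) M) f = (\<integral>z. (case z of (x, y) \<Rightarrow> f (x(i := y))) \<partial>(PiM J M \<Otimes>\<^sub>M M i))" .
qed

lemma countable_Xi: "countable (Xi N)"
proof -
  define S where "S = range (\<lambda>m::int. 2 * pi / real N * of_int m)"
  have "Xi N \<subseteq> (\<lambda>(a, b, c). vector [a, b, c]) ` (S \<times> S \<times> S)"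
  proof
    fix \<xi> assume "\<xi> \<in> Xi N"
    then have "\<xi>$k \<in> S" for k by (auto simp: Xi_def S_def)
    moreover have "\<xi> = vector [\<xi>$1, \<xi>$2, \<xi>$3]" by (simp add: vec_eq_iff forall_3)
    ultimately show "\<xi> \<in> (\<lambda>(a, b, c). vector [a, b, c]) ` (S \<times> S \<times> S)"
      by (intro image_eqI[of _ _ "(\<xi>$1, \<xi>$2, \<xi>$3)"]) auto
  qed
  moreover have "countable S" by (simp add: S_def)
  ultimately show ?thesis by (meson countable_SIGMA countable_image countable_subset)
qed

lemma product_sigma_finite_cube: "0 < N \<Longrightarrow> product_sigma_finite (\<lambda>_. lebesgue_on (cube N))"
  using finite_measure_cube[of N] by (simp add: product_sigma_finite_def finite_measure.axioms(1))

lemma measurable_PiM_inner [measurable]: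
  assumes "j \<in> J"
  shows "(\<lambda>x. v \<bullet> x j) \<in> borel_measurable (PiM J (\<lambda>_. lebesgue_on (cube N)))"
proof -
  have m: "(\<lambda>y. v \<bullet> y) \<in> borel_measurable (lebesgue_on (cube N))" by (rule measurable_cube) measurable
  show ?thesis by (rule measurable_compose[OF measurable_component_singleton[OF assms] m])
qed

text \<open>Completeness passes to products: by Fubini all partial Fourier coefficients in one variable
  vanish almost everywhere, hence so does almost every section.\<close>

lemma PiM_complete:
  fixes f :: "('i \<Rightarrow> real^3) \<Rightarrow> complex"
  assumes N: "0 < N" and "finite J" and "integrable (PiM J (\<lambda>_. lebesgue_on (cube N))) f"
    and "\<And>\<xi>. \<xi> \<in> PiE J (\<lambda>_. Xi N) \<Longrightarrow>
      (\<integral>x. f x * cnj (cis (\<Sum>j\<in>J. \<xi> j \<bullet> x j)) \<partial>PiM J (\<lambda>_. lebesgue_on (cube N))) = 0"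
  shows "AE x in PiM J (\<lambda>_. lebesgue_on (cube N)). f x = 0"
  using assms(2-)
proof (induction J arbitrary: f rule: finite_induct)
  case empty
  from empty(2)[of "\<lambda>_. undefined"] have "f (\<lambda>_. undefined) = 0"
    by (simp add: PiM_empty lebesgue_integral_count_space_finite)
  then show ?case by (intro AE_I2) (auto simp: space_PiM_empty)
next
  case (insert i J)
  let ?M = "\<lambda>_::'i. lebesgue_on (cube N)"
  interpret product_sigma_finite ?M by (rule product_sigma_finite_cube[OF N])
  interpret J: finite_product_sigma_finite ?M J by standard fact
  interpret pair_sigma_finite "PiM J ?M" "lebesgue_on (cube N)" ..
  have pair: "integrable (PiM J ?M \<Otimes>\<^sub>M lebesgue_on (cube N)) (\<lambda>(x, y). f (x(i := y)))"
    by (rule integrable_PiM_insert(1)[OF insert(1,2,4)])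
  have AE_int: "AE x in PiM J ?M. integrable (lebesgue_on (cube N)) (\<lambda>y. f (x(i := y)))"
    by (rule AE_integrable_fst[OF pair])
  have AE0: "AE x in PiM J ?M. (LINT y|lebesgue_on (cube N). f (x(i := y)) * cnj (cis (\<eta> \<bullet> y))) = 0"
    if \<eta>: "\<eta> \<in> Xi N" for \<eta>
  proof (rule insert.IH)
    have m: "(\<lambda>x. cnj (cis (\<eta> \<bullet> x i))) \<in> borel_measurable (PiM (insert i J) ?M)"
      by (intro borel_measurable_cnj borel_measurable_cis measurable_PiM_inner) simp
    have int: "integrable (PiM (insert i J) ?M) (\<lambda>x. f x * cnj (cis (\<eta> \<bullet> x i)))"
      by (rule integrable_mult_bounded[OF insert(4) m, where B=1]) simp
    show "integrable (PiM J ?M) (\<lambda>x. LINT y|lebesgue_on (cube N). f (x(i := y)) * cnj (cis (\<eta> \<bullet> y)))"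
      using integrable_fst[OF integrable_PiM_insert(1)[OF insert(1,2) int]] by simp
    fix \<xi> assume \<xi>: "\<xi> \<in> PiE J (\<lambda>_. Xi N)"
    define \<xi>' where "\<xi>' = \<xi>(i := \<eta>)"
    have "\<xi>' \<in> PiE (insert i J) (\<lambda>_. Xi N)" using \<xi> \<eta> by (auto simp: \<xi>'_def PiE_iff extensional_def)
    then have "0 = (\<integral>x. f x * cnj (cis (\<Sum>j\<in>insert i J. \<xi>' j \<bullet> x j)) \<partial>PiM (insert i J) ?M)"
      using insert(5) by simp
    also have "\<dots> = (\<integral>x. (LINT y|lebesgue_on (cube N). f (x(i := y)) * cnj (cis (\<Sum>j\<in>insert i J. \<xi>' j \<bullet> (x(i := y)) j))) \<partial>PiM J ?M)"
      by (intro product_integral_insert[OF insert(1,2)] integrable_mult_bounded[OF insert(4), where B=1]) auto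
    also have "\<dots> = (\<integral>x. (LINT y|lebesgue_on (cube N). f (x(i := y)) * cnj (cis (\<eta> \<bullet> y))) * cnj (cis (\<Sum>j\<in>J. \<xi> j \<bullet> x j)) \<partial>PiM J ?M)"
    proof (rule Bochner_Integration.integral_cong[OF refl])
      fix x
      have "(\<Sum>j\<in>insert i J. \<xi>' j \<bullet> (x(i := y)) j) = \<eta> \<bullet> y + (\<Sum>j\<in>J. \<xi> j \<bullet> x j)" for y
        using insert(1,2) by (auto simp: \<xi>'_def intro!: sum.cong)
      then have "(\<lambda>y. f (x(i := y)) * cnj (cis (\<Sum>j\<in>insert i J. \<xi>' j \<bullet> (x(i := y)) j)))
          = (\<lambda>y. (f (x(i := y)) * cnj (cis (\<eta> \<bullet> y))) * cnj (cis (\<Sum>j\<in>J. \<xi> j \<bullet> x j)))"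
        by (simp add: cis_mult[symmetric] mult.assoc)
      then show "(LINT y|lebesgue_on (cube N). f (x(i := y)) * cnj (cis (\<Sum>j\<in>insert i J. \<xi>' j \<bullet> (x(i := y)) j)))
          = (LINT y|lebesgue_on (cube N). f (x(i := y)) * cnj (cis (\<eta> \<bullet> y))) * cnj (cis (\<Sum>j\<in>J. \<xi> j \<bullet> x j))"
        by simp
    qed
    finally show "(\<integral>x. (LINT y|lebesgue_on (cube N). f (x(i := y)) * cnj (cis (\<eta> \<bullet> y))) * cnj (cis (\<Sum>j\<in>J. \<xi> j \<bullet> x j)) \<partial>PiM J ?M) = 0"
      by simp
  qed
  \<comment> \<open>There are countably many frequencies, so a single null set of \<open>x\<close>
    serves for all of them, and completeness on the cube applies to each remaining section.\<close>
  have "AE x in PiM J ?M. \<forall>\<eta>\<in>Xi N. (LINT y|lebesgue_on (cube N). f (x(i := y)) * cnj (cis (\<eta> \<bullet> y))) = 0"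
    by (subst AE_ball_countable[OF countable_Xi]) (use AE0 in auto)
  then have AE2: "AE x in PiM J ?M. AE y in lebesgue_on (cube N). f (x(i := y)) = 0"
    using AE_int by eventually_elim (auto intro!: vanishing_coefs_AE_0[OF N] simp: vanishing_coefs_def)
  have [measurable]: "f \<in> borel_measurable (PiM (insert i J) ?M)" using insert(4) by auto
  have "(\<integral>\<^sup>+x. ennreal (cmod (f x)) \<partial>PiM (insert i J) ?M) = (\<integral>\<^sup>+x. \<integral>\<^sup>+y. ennreal (cmod (f (x(i := y)))) \<partial>lebesgue_on (cube N) \<partial>PiM J ?M)"
    by (rule product_nn_integral_insert[OF insert(1,2)]) measurable
  also have "\<dots> = (\<integral>\<^sup>+x. 0 \<partial>PiM J ?M)"
  proof (rule nn_integral_cong_AE, use AE2 in eventually_elim)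
    case (elim x)
    then have "(\<integral>\<^sup>+y. ennreal (cmod (f (x(i := y)))) \<partial>lebesgue_on (cube N)) = (\<integral>\<^sup>+y. 0 \<partial>lebesgue_on (cube N))"
      by (intro nn_integral_cong_AE) auto
    then show ?case by simp
  qed
  finally have "(\<integral>\<^sup>+x. ennreal (cmod (f x)) \<partial>PiM (insert i J) ?M) = 0" by simp
  then show ?case by (subst (asm) nn_integral_0_iff_AE) auto
qed

lemma cdot_cis_measurable [measurable]: "(\<lambda>x. cis (cdot N \<eta> x)) \<in> borel_measurable (cfgM N)"
  unfolding cdot_def cfgM_def by measurable

lemma finite_measure_cfgM:
  assumes "0 < N" shows "finite_measure (cfgM N)"
proof (rule finite_measureI)
  interpret product_sigma_finite "\<lambda>_::nat. lebesgue_on (cube N)" by (rule product_sigma_finite_cube[OF assms])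
  have "emeasure (cfgM N) (space (cfgM N)) = (\<Prod>i<N^3. emeasure (lebesgue_on (cube N)) (cube N))"
    unfolding cfgM_def space_PiM by (subst emeasure_PiM) (auto intro: sets.top[of "lebesgue_on (cube N)", simplified])
  also have "\<dots> < \<infinity>" using emeasure_cube[OF assms] by (simp add: power_less_top_ennreal)
  finally show "emeasure (cfgM N) (space (cfgM N)) \<noteq> \<infinity>" by simp
qed

lemma fourier_basis_cfg:
  assumes N: "0 < N"
  shows "fourier_basis (cfgM N) (XiC N) (\<lambda>\<eta> x. cis (cdot N \<eta> x)) (real N ^ (3 * N^3))"
proof -
  interpret finite_measure "cfgM N" by (rule finite_measure_cfgM[OF N])
  interpret T: fourier_basis "lebesgue_on (cube N)" "Xi N" "\<lambda>\<xi> x. cis (\<xi> \<bullet> x)" "real N ^ 3"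
    by (rule fourier_basis_cube[OF N])
  interpret P: product_sigma_finite "\<lambda>_::nat. lebesgue_on (cube N)" by (rule product_sigma_finite_cube[OF N])
  show ?thesis
  proof
    fix \<eta> \<zeta> assume \<eta>: "\<eta> \<in> XiC N" and \<zeta>: "\<zeta> \<in> XiC N"
    have "(\<integral>x. cis (cdot N \<eta> x) * cnj (cis (cdot N \<zeta> x)) \<partial>cfgM N)
        = (\<integral>x. (\<Prod>j<N^3. cis (\<eta> j \<bullet> x j) * cnj (cis (\<zeta> j \<bullet> x j))) \<partial>cfgM N)"
      by (simp add: cdot_def cis_sum prod.distrib)
    also have "\<dots> = (\<Prod>j<N^3. (LINT x|lebesgue_on (cube N). cis (\<eta> j \<bullet> x) * cnj (cis (\<zeta> j \<bullet> x))))"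
      unfolding cfgM_def
      by (rule P.product_integral_prod) (auto intro!: T.sqint_mult_cnj T.sqint_c)
    also have "\<dots> = (\<Prod>j<N^3. if \<eta> j = \<zeta> j then complex_of_real (real N ^ 3) else 0)"
      using \<eta> \<zeta> by (intro prod.cong T.orthogonal) (auto simp: XiC_def PiE_iff)
    also have "\<dots> = (if \<eta> = \<zeta> then complex_of_real (real N ^ (3 * N^3)) else 0)"
    proof (cases "\<eta> = \<zeta>")
      case True
      then show ?thesis by (simp add: power_mult)
    next
      case False
      then obtain j where "j < N^3" "\<eta> j \<noteq> \<zeta> j"
        using \<eta> \<zeta> PiE_ext[of \<eta> "{..<N^3}" _ \<zeta>] unfolding XiC_def by blast
      then show ?thesis using False by (auto intro!: bexI[of _ j])
    qed
    finally show "(\<integral>x. cis (cdot N \<eta> x) * cnj (cis (cdot N \<zeta> x)) \<partial>cfgM N)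
        = (if \<eta> = \<zeta> then complex_of_real (real N ^ (3 * N^3)) else 0)" .
  next
    fix f assume "integrable (cfgM N) f"
      "\<And>\<eta>. \<eta> \<in> XiC N \<Longrightarrow> (\<integral>x. f x * cnj (cis (cdot N \<eta> x)) \<partial>cfgM N) = 0"
    then show "AE x in cfgM N. f x = 0"
      unfolding cfgM_def cdot_def XiC_def by (intro PiM_complete[OF N]) auto
  qed (use N in auto)
qed

text \<open>All factors carry the same measure, so on boxes a permutation merely reorders the
  factors of a finite product. It fixes every index outside \<open>{..<N^3}\<close>, so the default
  value \<open>undefined\<close> there is preserved.\<close>

lemma distr_permute_cfgM:
  assumes N: "0 < N" and \<pi>: "\<pi> permutes {..<N^3}"
  shows "(\<lambda>x. x \<circ> \<pi>) \<in> measurable (cfgM N) (cfgM N)"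
    and "distr (cfgM N) (cfgM N) (\<lambda>x. x \<circ> \<pi>) = cfgM N"
proof -
  interpret product_sigma_finite "\<lambda>_::nat. lebesgue_on (cube N)" by (rule product_sigma_finite_cube[OF N])
  have ext: "x \<circ> \<pi> = (\<lambda>j\<in>{..<N^3}. x (\<pi> j))" if "x \<in> space (cfgM N)" for x
    using that permutes_not_in[OF \<pi>] by (auto simp: cfgM_def space_PiM PiE_iff extensional_def fun_eq_iff restrict_def)
  have "(\<lambda>x. \<lambda>j\<in>{..<N^3}. x (\<pi> j)) \<in> measurable (cfgM N) (cfgM N)"
    unfolding cfgM_def using permutes_in_image[OF \<pi>]
    by (intro measurable_restrict measurable_component_singleton) auto
  then show m: "(\<lambda>x. x \<circ> \<pi>) \<in> measurable (cfgM N) (cfgM N)"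
    by (subst measurable_cong[OF ext])
  have "distr (cfgM N) (cfgM N) (\<lambda>x. x \<circ> \<pi>) = PiM {..<N^3} (\<lambda>_. lebesgue_on (cube N))"
  proof (rule PiM_eqI)
    fix A assume A: "\<And>i. i \<in> {..<N^3} \<Longrightarrow> A i \<in> sets (lebesgue_on (cube N))"
    have bij: "bij \<pi>" by (rule permutes_bij[OF \<pi>])
    have vim: "(\<lambda>x. x \<circ> \<pi>) -` PiE {..<N^3} A \<inter> space (cfgM N) = PiE {..<N^3} (\<lambda>j. A (inv \<pi> j))"
    proof -
      have sub: "A i \<subseteq> cube N" if "i < N^3" for i using sets.sets_into_space[OF A[of i]] that by simp
      have inv: "inv \<pi> j < N^3" if "j < N^3" for j using permutes_in_image[OF permutes_inv[OF \<pi>], of j] that by simp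
      have \<pi>i: "\<pi> j < N^3 \<longleftrightarrow> j < N^3" for j using permutes_in_image[OF \<pi>, of j] by simp
      show ?thesis
      proof (intro set_eqI iffI)
        fix x assume x: "x \<in> (\<lambda>x. x \<circ> \<pi>) -` PiE {..<N^3} A \<inter> space (cfgM N)"
        show "x \<in> PiE {..<N^3} (\<lambda>j. A (inv \<pi> j))"
        proof (rule PiE_I)
          fix j assume "j \<in> {..<N^3}"
          then have "(x \<circ> \<pi>) (inv \<pi> j) \<in> A (inv \<pi> j)" using x inv by (auto simp: PiE_iff)
          then show "x j \<in> A (inv \<pi> j)" by (simp add: permutes_inverses[OF \<pi>])
        qed (use x in \<open>auto simp: cfgM_def space_PiM PiE_iff extensional_def\<close>)
      next
        fix x assume x: "x \<in> PiE {..<N^3} (\<lambda>j. A (inv \<pi> j))"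
        have "(x \<circ> \<pi>) j \<in> A j" if "j < N^3" for j
        proof -
          have "x (\<pi> j) \<in> A (inv \<pi> (\<pi> j))" using x \<pi>i that by (auto simp: PiE_iff)
          then show ?thesis by (simp add: permutes_inverses[OF \<pi>])
        qed
        moreover have "(x \<circ> \<pi>) j = undefined" if "\<not> j < N^3" for j
          using x that \<pi>i by (auto simp: PiE_iff extensional_def)
        moreover have "x j \<in> cube N" if "j < N^3" for j
          using x sub[OF inv[OF that]] that by (auto simp: PiE_iff)
        ultimately show "x \<in> (\<lambda>x. x \<circ> \<pi>) -` PiE {..<N^3} A \<inter> space (cfgM N)"
          using x by (auto simp: cfgM_def space_PiM PiE_iff extensional_def)
      qed
    qed
    have "emeasure (distr (cfgM N) (cfgM N) (\<lambda>x. x \<circ> \<pi>)) (PiE {..<N^3} A)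
        = emeasure (cfgM N) (PiE {..<N^3} (\<lambda>j. A (inv \<pi> j)))"
    proof -
      have "PiE {..<N^3} A \<in> sets (cfgM N)"
        unfolding cfgM_def using A by (intro sets_PiM_I_finite) auto
      then show ?thesis by (simp add: emeasure_distr[OF m] vim)
    qed
    also have "\<dots> = (\<Prod>j<N^3. emeasure (lebesgue_on (cube N)) (A (inv \<pi> j)))"
      unfolding cfgM_def using A permutes_in_image[OF permutes_inv[OF \<pi>]] by (intro emeasure_PiM) auto
    also have "\<dots> = (\<Prod>j<N^3. emeasure (lebesgue_on (cube N)) (A j))"
      using prod.permute[OF permutes_inv[OF \<pi>], of "\<lambda>j. emeasure (lebesgue_on (cube N)) (A j)"]
      by (simp add: comp_def)
    finally show "emeasure (distr (cfgM N) (cfgM N) (\<lambda>x. x \<circ> \<pi>)) (PiE {..<N^3} A)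
        = (\<Prod>i<N^3. emeasure (lebesgue_on (cube N)) (A i))" .
  qed (auto simp: cfgM_def)
  then show "distr (cfgM N) (cfgM N) (\<lambda>x. x \<circ> \<pi>) = cfgM N" by (simp add: cfgM_def)
qed

lemma cdot_permute:
  assumes "\<pi> permutes {..<N^3}" shows "cdot N (\<eta> \<circ> \<pi>) (x \<circ> \<pi>) = cdot N \<eta> x"
  unfolding cdot_def using sum.permute[OF assms, of "\<lambda>j. \<eta> j \<bullet> x j"] by (simp add: comp_def)

lemma csq_permute:
  assumes "\<pi> permutes {..<N^3}" shows "csq N (\<eta> \<circ> \<pi>) = csq N \<eta>"
  unfolding csq_def using sum.permute[OF assms, of "\<lambda>j. (norm (\<eta> j))^2"] by (simp add: comp_def)

lemma XiC_permute:
  assumes "\<pi> permutes {..<N^3}" "\<eta> \<in> XiC N" shows "\<eta> \<circ> \<pi> \<in> XiC N"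
  using assms permutes_in_image[OF assms(1)] permutes_not_in[OF assms(1)]
  by (auto simp: XiC_def PiE_iff extensional_def)

lemma fcoef_permute:
  assumes N: "0 < N" and \<pi>: "\<pi> permutes {..<N^3}" and f: "f \<in> borel_measurable (cfgM N)"
  shows "fcoef N (\<lambda>x. f (x \<circ> \<pi>)) \<eta> = fcoef N f (\<eta> \<circ> \<pi>)"
proof -
  have m: "(\<lambda>x. f x * cis (- cdot N (\<eta> \<circ> \<pi>) x)) \<in> borel_measurable (cfgM N)"
    using f borel_measurable_cnj[OF cdot_cis_measurable[of N "\<eta> \<circ> \<pi>"]] by (simp add: cis_cnj)
  have "(\<integral>x. f x * cis (- cdot N (\<eta> \<circ> \<pi>) x) \<partial>cfgM N)
      = (\<integral>x. f x * cis (- cdot N (\<eta> \<circ> \<pi>) x) \<partial>distr (cfgM N) (cfgM N) (\<lambda>x. x \<circ> \<pi>))"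
    by (simp add: distr_permute_cfgM[OF N \<pi>])
  also have "\<dots> = (\<integral>x. f (x \<circ> \<pi>) * cis (- cdot N (\<eta> \<circ> \<pi>) (x \<circ> \<pi>)) \<partial>cfgM N)"
    by (rule integral_distr[OF distr_permute_cfgM(1)[OF N \<pi>] m])
  finally show ?thesis by (simp add: fcoef_def cdot_permute[OF \<pi>])
qed

section \<open>Convolution estimates\<close>

definition wt :: "nat \<Rightarrow> cfg \<Rightarrow> real" where "wt N \<eta> = 1 + csq N \<eta>"

text \<open>The effect of a one-particle character on frequencies: a factor
  \<open>cis (\<xi> \<bullet> x j)\<close> moves only the \<open>j\<close>-th component.\<close>

definition sh :: "nat \<Rightarrow> real^3 \<Rightarrow> cfg \<Rightarrow> cfg" where "sh j \<xi> \<eta> = \<eta>(j := \<eta> j + \<xi>)"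

lemma wt_ge_1: "1 \<le> wt N \<eta>"
  by (simp add: wt_def csq_def sum_nonneg)

lemma wt_pos [simp]: "0 < wt N \<eta>" "0 \<le> wt N \<eta>" "wt N \<eta> \<noteq> 0"
  using wt_ge_1[of N \<eta>] by auto

lemma wt_component: "j < N^3 \<Longrightarrow> 1 + (norm (\<eta> j))\<^sup>2 \<le> wt N \<eta>"
  unfolding wt_def csq_def using member_le_sum[of j "{..<N^3}" "\<lambda>j. (norm (\<eta> j))\<^sup>2"] by simp

lemma csq_sh: "j < N^3 \<Longrightarrow> csq N (sh j \<xi> \<eta>) + (norm (\<eta> j))\<^sup>2 = csq N \<eta> + (norm (\<eta> j + \<xi>))\<^sup>2"
proof -
  assume j: "j < N^3"
  have split: "csq N \<zeta> = (norm (\<zeta> j))\<^sup>2 + (\<Sum>i\<in>{..<N^3} - {j}. (norm (\<zeta> i))\<^sup>2)" for \<zeta>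
    unfolding csq_def using j by (intro sum.remove) auto
  have "(\<Sum>i\<in>{..<N^3} - {j}. (norm (sh j \<xi> \<eta> i))\<^sup>2) = (\<Sum>i\<in>{..<N^3} - {j}. (norm (\<eta> i))\<^sup>2)"
    by (intro sum.cong) (auto simp: sh_def)
  then show ?thesis by (simp add: split[of "sh j \<xi> \<eta>"] split[of \<eta>]) (simp add: sh_def)
qed

lemma sh_XiC: "j < N^3 \<Longrightarrow> \<xi> \<in> Xi N \<Longrightarrow> \<eta> \<in> XiC N \<Longrightarrow> sh j \<xi> \<eta> \<in> XiC N"
  by (auto simp: XiC_def sh_def PiE_iff extensional_def Xi_add)

lemma inj_sh: "inj (sh j \<xi>)"
proof (rule injI, rule ext)
  fix x y i assume "sh j \<xi> x = sh j \<xi> y"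
  from fun_cong[OF this, of i] show "x i = y i" by (cases "i = j") (auto simp: sh_def)
qed

lemma norm_Xi_ge:
  assumes "0 < N" "\<xi> \<in> Xi N" "\<xi> \<noteq> 0"
  shows "2 * pi / real N \<le> norm \<xi>"
proof -
  obtain k where k: "\<xi>$k \<noteq> 0" using assms(3) by (auto simp: vec_eq_iff)
  obtain m :: int where m: "\<xi>$k = 2 * pi / real N * of_int m" using assms(2) by (auto simp: Xi_def)
  have "m \<noteq> 0" using k m by auto
  then have "1 \<le> \<bar>real_of_int m\<bar>" by linarith
  then have "2 * pi / real N * 1 \<le> 2 * pi / real N * \<bar>real_of_int m\<bar>"
    using assms(1) by (intro mult_left_mono) auto
  also have "\<dots> = \<bar>\<xi>$k\<bar>" by (simp add: m abs_mult)
  also have "\<dots> \<le> norm \<xi>" by (rule component_le_norm_cart)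
  finally show ?thesis by simp
qed

section \<open>A convergent sum over the dual lattice\<close>

definition dec :: "real^3 \<Rightarrow> real" where "dec \<xi> = 1 / (1 + (norm \<xi>)\<^sup>2)\<^sup>2"

text \<open>Each factor \<open>1 + (\<xi>$k)\<^sup>2\<close> is at most
  \<open>1 + (norm \<xi>)\<^sup>2\<close>, so \<open>dec\<close> is dominated by the product over
  the three coordinates of these factors to the power -2/3. The sum then splits into three
  one-dimensional series with decay exponent 4/3, which is greater than 1.\<close>

lemma lattice_sum_bounded:
  assumes N: "0 < N"
  shows "\<exists>S. 0 \<le> S \<and> (\<forall>F. finite F \<and> F \<subseteq> Xi N \<longrightarrow> (\<Sum>\<xi>\<in>F. dec \<xi>) \<le> S)"
proof -
  define c where "c = 2 * pi / real N"
  have c: "0 < c" using N by (simp add: c_def)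
  define g where "g t = (1 + t\<^sup>2) powr (-2/3)" for t :: real
  have g0: "0 \<le> g t" for t by (simp add: g_def)
  have one: "0 < 1 + t\<^sup>2" for t :: real by (simp add: add_pos_nonneg)
  have "summable (\<lambda>k::nat. g (c * real k))"
  proof (rule summable_comparison_test')
    show "summable (\<lambda>k. c powr (-4/3) * real k powr (-4/3))"
      by (intro summable_mult) (simp add: summable_real_powr_iff)
    fix k :: nat assume k: "1 \<le> k"
    have "g (c * real k) \<le> ((c * real k)\<^sup>2) powr (-2/3)"
      unfolding g_def using c k by (intro powr_mono2') auto
    also have "\<dots> = ((c * real k) powr 2) powr (-2/3)" using c k by (simp add: powr_numeral)
    also have "\<dots> = (c * real k) powr (-4/3)" by (simp add: powr_powr)
    also have "\<dots> = c powr (-4/3) * real k powr (-4/3)" using c by (simp add: powr_mult)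
    finally show "norm (g (c * real k)) \<le> c powr (-4/3) * real k powr (-4/3)" using g0 by simp
  qed
  then obtain A where A: "\<And>n. (\<Sum>k<n. g (c * real k)) \<le> A"
    using sum_le_suminf[of "\<lambda>k. g (c * real k)"] g0 by blast
  have int_sum: "(\<Sum>m\<in>{- int n..int n}. g (c * of_int m)) \<le> 2 * A" for n
  proof -
    have "{- int n..int n} \<subseteq> (int ` {..<Suc n}) \<union> ((\<lambda>k. - int k) ` {..<Suc n})"
    proof
      fix m assume "m \<in> {- int n..int n}"
      then show "m \<in> (int ` {..<Suc n}) \<union> ((\<lambda>k. - int k) ` {..<Suc n})"
        by (cases "0 \<le> m") (auto simp: image_iff intro!: bexI[of _ "nat \<bar>m\<bar>"])
    qed
    then have "(\<Sum>m\<in>{- int n..int n}. g (c * of_int m)) \<le> (\<Sum>m\<in>(int ` {..<Suc n}) \<union> ((\<lambda>k. - int k) ` {..<Suc n}). g (c * of_int m))"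
      by (intro sum_mono2) (auto simp: g0)
    also have "\<dots> \<le> (\<Sum>m\<in>int ` {..<Suc n}. g (c * of_int m)) + (\<Sum>m\<in>(\<lambda>k. - int k) ` {..<Suc n}. g (c * of_int m))"
      by (subst sum_Un) (auto intro!: sum_nonneg g0)
    also have "(\<Sum>m\<in>int ` {..<Suc n}. g (c * of_int m)) = (\<Sum>k<Suc n. g (c * real k))"
      by (subst sum.reindex) (auto simp: inj_on_def)
    also have "(\<Sum>m\<in>(\<lambda>k. - int k) ` {..<Suc n}. g (c * of_int m)) = (\<Sum>k<Suc n. g (c * real k))"
      by (subst sum.reindex) (auto simp: inj_on_def g_def)
    finally show ?thesis using A[of "Suc n"] by simp
  qed
  have A0: "0 \<le> A" using A[of 0] by simp
  have dec_le: "dec \<xi> \<le> (\<Prod>k\<in>UNIV. g (\<xi>$k))" for \<xi>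
  proof -
    define n where "n = 1 + (norm \<xi>)\<^sup>2"
    have n: "0 < n" by (simp add: n_def add_pos_nonneg)
    have "(\<Prod>k\<in>UNIV. 1 + (\<xi>$k)\<^sup>2) \<le> (\<Prod>k\<in>(UNIV::3 set). n)"
    proof (rule prod_mono)
      fix k
      have "\<bar>\<xi>$k\<bar>\<^sup>2 \<le> (norm \<xi>)\<^sup>2" by (rule power_mono[OF component_le_norm_cart]) simp
      then show "0 \<le> 1 + (\<xi>$k)\<^sup>2 \<and> 1 + (\<xi>$k)\<^sup>2 \<le> n" by (simp add: n_def)
    qed
    then have le: "(\<Prod>k\<in>UNIV. 1 + (\<xi>$k)\<^sup>2) \<le> n ^ 3" by simp
    have "dec \<xi> = (n ^ 3) powr (-2/3)"
    proof -
      have "(n ^ 3) powr (-2/3) = (n powr 3) powr (-2/3)" using n by (simp add: powr_numeral)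
      also have "\<dots> = n powr (-2)" by (simp add: powr_powr)
      also have "\<dots> = inverse (n powr 2)" by (simp add: powr_minus)
      also have "\<dots> = inverse (n\<^sup>2)" using n by (simp add: powr_numeral)
      finally show ?thesis by (simp add: dec_def n_def field_simps)
    qed
    also have "\<dots> \<le> (\<Prod>k\<in>UNIV. 1 + (\<xi>$k)\<^sup>2) powr (-2/3)"
      using le one by (intro powr_mono2') (auto intro!: prod_pos)
    also have "\<dots> = (\<Prod>k\<in>UNIV. g (\<xi>$k))"
      unfolding g_def by (rule prod_powr_distrib)
    finally show ?thesis .
  qed
  show ?thesis
  proof (intro exI[of _ "(2 * A) ^ 3"] conjI allI impI)
    fix F assume F: "finite F \<and> F \<subseteq> Xi N"
    have "\<forall>\<xi>\<in>F. \<exists>h. \<forall>k. \<xi>$k = c * of_int (h k)"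
    proof
      fix \<xi> assume "\<xi> \<in> F"
      then have "\<forall>k. \<exists>m::int. \<xi>$k = c * of_int m" using F by (auto simp: Xi_def c_def)
      then show "\<exists>h. \<forall>k. \<xi>$k = c * of_int (h k)" by (rule choice)
    qed
    then obtain h where h: "\<And>\<xi> k. \<xi> \<in> F \<Longrightarrow> \<xi>$k = c * of_int (h \<xi> k)" by metis
    \<comment> \<open>All indices occurring in \<open>F\<close> lie in one box, so the sum over
      \<open>F\<close> is dominated by a sum over a product set, which factorizes.\<close>
    define B where "B = (\<Union>\<xi>\<in>F. range (\<lambda>k. \<bar>h \<xi> k\<bar>))"
    have "finite B" using F by (simp add: B_def)
    then obtain b where b: "\<And>m. m \<in> B \<Longrightarrow> m \<le> b" by (meson Max_ge)
    define n where "n = nat b"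
    have hn: "h \<xi> k \<in> {- int n..int n}" if "\<xi> \<in> F" for \<xi> k
    proof -
      have "\<bar>h \<xi> k\<bar> \<in> B" using that by (auto simp: B_def)
      then show ?thesis using b[of "\<bar>h \<xi> k\<bar>"] by (auto simp: n_def)
    qed
    have inj: "inj_on h F"
      by (rule inj_onI) (metis h vec_eq_iff)
    have "(\<Sum>\<xi>\<in>F. dec \<xi>) \<le> (\<Sum>\<xi>\<in>F. \<Prod>k\<in>UNIV. g (\<xi>$k))" by (intro sum_mono dec_le)
    also have "\<dots> = (\<Sum>\<xi>\<in>F. \<Prod>k\<in>UNIV. g (c * of_int (h \<xi> k)))"
      by (intro sum.cong prod.cong refl) (simp add: h)
    also have "\<dots> = (\<Sum>f\<in>h ` F. \<Prod>k\<in>UNIV. g (c * of_int (f k)))"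
      by (subst sum.reindex[OF inj]) simp
    also have "\<dots> \<le> (\<Sum>f\<in>PiE (UNIV::3 set) (\<lambda>_. {- int n..int n}). \<Prod>k\<in>UNIV. g (c * of_int (f k)))"
    proof (rule sum_mono2)
      show "h ` F \<subseteq> PiE UNIV (\<lambda>_. {- int n..int n})" using hn by (auto simp: PiE_iff)
    qed (auto intro!: finite_PiE prod_nonneg g0)
    also have "\<dots> = (\<Prod>k\<in>(UNIV::3 set). \<Sum>m\<in>{- int n..int n}. g (c * of_int m))"
      by (rule prod_sum_PiE[symmetric]) auto
    also have "\<dots> \<le> (\<Prod>k\<in>(UNIV::3 set). 2 * A)"
      using int_sum by (intro prod_mono) (auto intro!: sum_nonneg g0)
    finally show "(\<Sum>\<xi>\<in>F. dec \<xi>) \<le> (2 * A) ^ 3" by simp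
  qed (use A0 in simp)
qed

lemma sum_dec_inj_le:
  assumes S: "\<And>F. finite F \<Longrightarrow> F \<subseteq> Xi N \<Longrightarrow> (\<Sum>\<xi>\<in>F. dec \<xi>) \<le> S"
    and "finite G" "inj_on f G" "f ` G \<subseteq> Xi N"
  shows "(\<Sum>x\<in>G. dec (f x)) \<le> S"
  using S[of "f ` G"] assms by (simp add: sum.reindex)

lemma l2_sum_inj_le:
  assumes "finite G" "inj_on f G"
  shows "(\<Sum>x\<in>G. (norm (l2_apply u (f x)))\<^sup>2) \<le> (norm u)\<^sup>2"
  using l2_sum_le[of "f ` G" u] assms by (simp add: sum.reindex)

text \<open>The weight of the output frequency over that of the input frequency, times the symbol of
  \<open>G\<close>: the kernel of multiplication by the potential when wave functions are given by
  weighted coefficients.\<close>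

definition mul_kernel :: "nat \<Rightarrow> nat \<Rightarrow> cfg \<Rightarrow> real^3 \<Rightarrow> real" where
  "mul_kernel N j \<eta> \<xi> = sqrt (wt N \<eta>) / ((norm \<xi>)\<^sup>2 * sqrt (wt N (sh j (- \<xi>) \<eta>)))"

definition mul_term :: "nat \<Rightarrow> nat \<Rightarrow> cfg \<Rightarrow> real^3 \<Rightarrow> (real^3, complex) l2 \<Rightarrow> (cfg, complex) l2 \<Rightarrow> complex" where
  "mul_term N j \<eta> \<xi> r u = (if \<eta> \<in> XiC N then
     complex_of_real (mul_kernel N j \<eta> \<xi>) * (l2_apply r \<xi> * l2_apply u (sh j (- \<xi>) \<eta>)) else 0)"

definition mul_op :: "nat \<Rightarrow> nat \<Rightarrow> (real^3, complex) l2 \<Rightarrow> (cfg, complex) l2 \<Rightarrow> (cfg, complex) l2" where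
  "mul_op N j = l2_bilinear_series.series (mul_term N j) (Xi N - {0})"

text \<open>\<open>wt N \<eta> \<le> 2 * w + 2 * x\<close>, with
  \<open>x = (norm \<xi>)\<^sup>2\<close> and \<open>w\<close> the input weight, decides on which
  factor the derivative falls. The squared kernel is then at most
  \<open>2 / x\<^sup>2 + 2 / (x * w)\<close>, and the mixed term is split into squares, giving the
  constants 3 and 1. Nonzero frequencies have norm at least \<open>2 * pi / real N\<close>, so
  \<open>1 / x\<close> is comparable to \<open>1 / (1 + x)\<close>.\<close>

lemma mul_kernel_sq_le:
  assumes N: "0 < N" and j: "j < N^3" and \<xi>: "\<xi> \<in> Xi N" "\<xi> \<noteq> 0"
  shows "(mul_kernel N j \<eta> \<xi>)\<^sup>2 \<le> 3 * (1 + (real N / (2 * pi))\<^sup>2)\<^sup>2 * dec \<xi> + dec (\<eta> j - \<xi>)"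
proof -
  define c where "c = 2 * pi / real N"
  have c: "0 < c" using N by (simp add: c_def)
  define w where "w = wt N (sh j (- \<xi>) \<eta>)"
  define x where "x = (norm \<xi>)\<^sup>2"
  have x: "0 < x" using \<xi> by (simp add: x_def)
  have w: "1 + (norm (\<eta> j - \<xi>))\<^sup>2 \<le> w" "0 < w"
    using wt_component[OF j, of "sh j (- \<xi>) \<eta>"] by (simp_all add: w_def sh_def)
  have "(norm (\<eta> j))\<^sup>2 \<le> 2 * (norm (\<eta> j - \<xi>))\<^sup>2 + 2 * x"
  proof -
    have "norm (\<eta> j) \<le> norm (\<eta> j - \<xi>) + norm \<xi>" using norm_triangle_ineq[of "\<eta> j - \<xi>" \<xi>] by simp
    then have "(norm (\<eta> j))\<^sup>2 \<le> (norm (\<eta> j - \<xi>) + norm \<xi>)\<^sup>2" by (intro power_mono) auto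
    also have "\<dots> \<le> 2 * (norm (\<eta> j - \<xi>))\<^sup>2 + 2 * (norm \<xi>)\<^sup>2"
      using sum_squares_bound[of "norm (\<eta> j - \<xi>)" "norm \<xi>"] by (simp add: power2_sum)
    finally show ?thesis by (simp add: x_def)
  qed
  then have wt: "wt N \<eta> \<le> 2 * w + 2 * x"
    using csq_sh[OF j, of "- \<xi>" \<eta>] w by (simp add: w_def wt_def)
  have "(mul_kernel N j \<eta> \<xi>)\<^sup>2 = wt N \<eta> / (x\<^sup>2 * w)"
    using w(2) by (simp add: mul_kernel_def power_divide power_mult_distrib x_def w_def)
  also have "\<dots> \<le> (2 * w + 2 * x) / (x\<^sup>2 * w)"
    using wt w x by (intro divide_right_mono) auto
  also have "\<dots> = 2 * (1 / x)\<^sup>2 + 2 * (1 / x) * (1 / w)"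
    using w x by (simp add: field_simps power2_eq_square)
  also have "\<dots> \<le> 3 * (1 / x)\<^sup>2 + (1 / w)\<^sup>2"
    using sum_squares_bound[of "1 / x" "1 / w"] by simp
  also have "(1 / w)\<^sup>2 \<le> dec (\<eta> j - \<xi>)"
  proof -
    have "0 < 1 + (norm (\<eta> j - \<xi>))\<^sup>2" by (simp add: add_pos_nonneg)
    then show ?thesis using w by (simp add: dec_def power_divide frac_le power_mono)
  qed
  also have "(1 / x)\<^sup>2 \<le> (1 + (1 / c)\<^sup>2)\<^sup>2 * dec \<xi>"
  proof -
    have "c\<^sup>2 \<le> x" unfolding x_def c_def using norm_Xi_ge[OF N \<xi>] by (intro power_mono) auto
    then have "1 \<le> (1 / c)\<^sup>2 * x" using c by (simp add: power_divide field_simps)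
    then have "1 + x \<le> (1 + (1 / c)\<^sup>2) * x" by (simp add: algebra_simps)
    then have "1 / x \<le> (1 + (1 / c)\<^sup>2) / (1 + x)" using x by (simp add: field_simps)
    then have "(1 / x)\<^sup>2 \<le> ((1 + (1 / c)\<^sup>2) / (1 + x))\<^sup>2" using x by (intro power_mono) auto
    then show ?thesis by (simp add: dec_def x_def power_divide)
  qed
  finally show ?thesis by (simp add: c_def)
qed

text \<open>Cauchy-Schwarz in \<open>\<xi>\<close> separates the kernel, whose squares sum to at
  most \<open>Q\<close> for every output frequency, from the products of coefficients. Summing those
  over the output frequency first leaves at most the squared norm of \<open>u\<close> for each
  \<open>\<xi>\<close>, because the shift is injective.\<close>

lemma mul_series:
  assumes N: "0 < N" and j: "j < N^3"
  shows "\<exists>C. l2_bilinear_series (mul_term N j) (Xi N - {0}) C"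
proof -
  obtain S where S: "0 \<le> S" "\<And>F. finite F \<Longrightarrow> F \<subseteq> Xi N \<Longrightarrow> (\<Sum>\<xi>\<in>F. dec \<xi>) \<le> S"
    using lattice_sum_bounded[OF N] by blast
  define Q where "Q = 3 * (1 + (real N / (2 * pi))\<^sup>2)\<^sup>2 * S + S"
  have Q: "0 \<le> Q" using S by (simp add: Q_def)
  have "l2_bilinear_series (mul_term N j) (Xi N - {0}) (sqrt Q)"
  proof
    fix F :: "cfg set" and G and r :: "(real^3, complex) l2" and u :: "(cfg, complex) l2"
    assume F: "finite F" and G: "finite G" "G \<subseteq> Xi N - {0}"
    define T where "T \<eta> = (\<Sum>\<xi>\<in>G. (cmod (l2_apply r \<xi>))\<^sup>2 * (cmod (l2_apply u (sh j (- \<xi>) \<eta>)))\<^sup>2)" for \<eta>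
    have T0: "0 \<le> T \<eta>" for \<eta> unfolding T_def by (intro sum_nonneg) auto
    have "(\<Sum>\<xi>\<in>G. norm (mul_term N j \<eta> \<xi> r u))\<^sup>2 \<le> Q * T \<eta>" for \<eta>
    proof (cases "\<eta> \<in> XiC N")
      case True
      have "(\<Sum>\<xi>\<in>G. (mul_kernel N j \<eta> \<xi>)\<^sup>2) \<le> (\<Sum>\<xi>\<in>G. 3 * (1 + (real N / (2 * pi))\<^sup>2)\<^sup>2 * dec \<xi> + dec (\<eta> j - \<xi>))"
        using G by (intro sum_mono mul_kernel_sq_le[OF N j]) auto
      also have "\<dots> = 3 * (1 + (real N / (2 * pi))\<^sup>2)\<^sup>2 * (\<Sum>\<xi>\<in>G. dec \<xi>) + (\<Sum>\<xi>\<in>G. dec (\<eta> j - \<xi>))"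
        by (simp add: sum.distrib sum_distrib_left)
      also have "\<dots> \<le> Q" unfolding Q_def
      proof (intro add_mono mult_left_mono)
        show "(\<Sum>\<xi>\<in>G. dec \<xi>) \<le> S" using G by (intro S) auto
        have "\<eta> j \<in> Xi N" using True j by (auto simp: XiC_def PiE_iff)
        then show "(\<Sum>\<xi>\<in>G. dec (\<eta> j - \<xi>)) \<le> S"
          using G by (intro sum_dec_inj_le[OF S(2)]) (auto simp: inj_on_def Xi_diff)
      qed simp
      finally have k: "(\<Sum>\<xi>\<in>G. (mul_kernel N j \<eta> \<xi>)\<^sup>2) \<le> Q" .
      have "(\<Sum>\<xi>\<in>G. norm (mul_term N j \<eta> \<xi> r u))\<^sup>2
          = (\<Sum>\<xi>\<in>G. \<bar>mul_kernel N j \<eta> \<xi>\<bar> * (cmod (l2_apply r \<xi>) * cmod (l2_apply u (sh j (- \<xi>) \<eta>))))\<^sup>2"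
        using True by (simp add: mul_term_def norm_mult)
      also have "\<dots> \<le> (\<Sum>\<xi>\<in>G. \<bar>mul_kernel N j \<eta> \<xi>\<bar>\<^sup>2) * (\<Sum>\<xi>\<in>G. (cmod (l2_apply r \<xi>) * cmod (l2_apply u (sh j (- \<xi>) \<eta>)))\<^sup>2)"
        by (rule Cauchy_Schwarz_ineq_sum)
      also have "\<dots> \<le> Q * T \<eta>"
        using k T0[of \<eta>] by (simp add: T_def power_mult_distrib mult_right_mono)
      finally show ?thesis .
    next
      case False
      then show ?thesis using Q T0 by (simp add: mul_term_def)
    qed
    then have "(\<Sum>\<eta>\<in>F. (\<Sum>\<xi>\<in>G. norm (mul_term N j \<eta> \<xi> r u))\<^sup>2) \<le> (\<Sum>\<eta>\<in>F. Q * T \<eta>)"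
      by (intro sum_mono)
    also have "\<dots> = Q * (\<Sum>\<xi>\<in>G. (cmod (l2_apply r \<xi>))\<^sup>2 * (\<Sum>\<eta>\<in>F. (cmod (l2_apply u (sh j (- \<xi>) \<eta>)))\<^sup>2))"
      unfolding T_def by (simp add: sum_distrib_left[symmetric]) (subst sum.swap, simp add: sum_distrib_left)
    also have "\<dots> \<le> Q * (\<Sum>\<xi>\<in>G. (cmod (l2_apply r \<xi>))\<^sup>2 * (norm u)\<^sup>2)"
      using Q F by (intro mult_left_mono sum_mono l2_sum_inj_le) (auto intro: inj_on_subset[OF inj_sh])
    also have "\<dots> = Q * ((\<Sum>\<xi>\<in>G. (cmod (l2_apply r \<xi>))\<^sup>2) * (norm u)\<^sup>2)"
      by (simp add: sum_distrib_right)
    also have "\<dots> \<le> Q * ((norm r)\<^sup>2 * (norm u)\<^sup>2)"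
      using Q G by (intro mult_left_mono mult_right_mono l2_sum_le) auto
    finally show "(\<Sum>\<eta>\<in>F. (\<Sum>\<xi>\<in>G. norm (mul_term N j \<eta> \<xi> r u))\<^sup>2) \<le> (sqrt Q * norm r * norm u)\<^sup>2"
      using Q by (simp add: power_mult_distrib)
  qed (use Q in \<open>auto simp: mul_term_def algebra_simps\<close>)
  then show ?thesis by blast
qed

lemma bounded_bilinear_mul_op: "0 < N \<Longrightarrow> j < N^3 \<Longrightarrow> bounded_bilinear (mul_op N j)"
  unfolding mul_op_def by (metis mul_series l2_bilinear_series.bounded_bilinear_series)

lemma l2_apply_mul_op:
  "0 < N \<Longrightarrow> j < N^3 \<Longrightarrow> l2_apply (mul_op N j r u) \<eta> = (\<Sum>\<^sub>\<infinity>\<xi>\<in>Xi N - {0}. mul_term N j \<eta> \<xi> r u)"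
  unfolding mul_op_def by (metis mul_series l2_bilinear_series.l2_apply_series)

text \<open>A term of the correlation series that gives, up to normalization, the Fourier
  coefficients of the \<open>j\<close>-th one-particle marginal. The square roots undo the weights
  carried by \<open>u\<close> and \<open>v\<close>.\<close>

definition den_term :: "nat \<Rightarrow> nat \<Rightarrow> real^3 \<Rightarrow> cfg \<Rightarrow> (cfg, complex) l2 \<Rightarrow> (cfg, complex) l2 \<Rightarrow> complex" where
  "den_term N j \<xi> \<eta> u v = (if \<xi> \<in> Xi N then
     complex_of_real (1 / (sqrt (wt N (sh j \<xi> \<eta>)) * sqrt (wt N \<eta>))) * (l2_apply u (sh j \<xi> \<eta>) * cnj (l2_apply v \<eta>)) else 0)"

definition den_op :: "nat \<Rightarrow> nat \<Rightarrow> (cfg, complex) l2 \<Rightarrow> (cfg, complex) l2 \<Rightarrow> (real^3, complex) l2" where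
  "den_op N j = l2_bilinear_series.series (den_term N j) (XiC N)"

text \<open>Cauchy-Schwarz is applied first in the variables other than the j-th one, then in the j-th one.\<close>

lemma den_series:
  assumes N: "0 < N" and j: "j < N^3"
  shows "\<exists>C. l2_bilinear_series (den_term N j) (XiC N) C"
proof -
  obtain S where S: "0 \<le> S" "\<And>F. finite F \<Longrightarrow> F \<subseteq> Xi N \<Longrightarrow> (\<Sum>\<xi>\<in>F. dec \<xi>) \<le> S"
    using lattice_sum_bounded[OF N] by blast
  have "l2_bilinear_series (den_term N j) (XiC N) (sqrt S)"
  proof
    fix F :: "(real^3) set" and G and u v :: "(cfg, complex) l2"
    assume F: "finite F" and G: "finite G" "G \<subseteq> XiC N"
    define Z where "Z = (\<lambda>\<eta>. \<eta> j) ` G"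
    define H where "H \<zeta> = {\<eta> \<in> G. \<eta> j = \<zeta>}" for \<zeta>
    have Z: "finite Z" "Z \<subseteq> Xi N" using G j by (auto simp: Z_def XiC_def PiE_iff subset_eq)
    have H: "finite (H \<zeta>)" for \<zeta> using G by (simp add: H_def)
    \<comment> \<open>Only the \<open>j\<close>-th component of each weight is kept; it alone pays
      for the sum over \<open>\<zeta>\<close>.\<close>
    define b where "b \<zeta> = 1 / sqrt (1 + (norm \<zeta>)\<^sup>2)" for \<zeta> :: "real^3"
    have b: "0 \<le> b \<zeta>" "(b \<zeta>)\<^sup>2 * (b \<zeta>)\<^sup>2 = dec \<zeta>" for \<zeta>
      by (auto simp: b_def dec_def power_divide power2_eq_square)
    have group: "(\<Sum>\<eta>\<in>G. f \<eta>) = (\<Sum>\<zeta>\<in>Z. \<Sum>\<eta>\<in>H \<zeta>. f \<eta>)" for f :: "cfg \<Rightarrow> real"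
      unfolding Z_def H_def by (rule sum.image_gen[OF G(1)])
    define A where "A \<xi> \<zeta> = (\<Sum>\<eta>\<in>H \<zeta>. cmod (l2_apply u (sh j \<xi> \<eta>)) * cmod (l2_apply v \<eta>))" for \<xi> \<zeta>
    have A0: "0 \<le> A \<xi> \<zeta>" for \<xi> \<zeta> unfolding A_def by (intro sum_nonneg) auto
    have A_le: "(A \<xi> \<zeta>)\<^sup>2 \<le> (\<Sum>\<eta>\<in>H \<zeta>. (cmod (l2_apply u (sh j \<xi> \<eta>)))\<^sup>2) * (\<Sum>\<eta>\<in>H \<zeta>. (cmod (l2_apply v \<eta>))\<^sup>2)" for \<xi> \<zeta>
      unfolding A_def by (rule Cauchy_Schwarz_ineq_sum)
    have est: "(\<Sum>\<eta>\<in>G. norm (den_term N j \<xi> \<eta> u v))\<^sup>2 \<le> S * (\<Sum>\<zeta>\<in>Z. (A \<xi> \<zeta>)\<^sup>2)" for \<xi>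
    proof (cases "\<xi> \<in> Xi N")
      case True
      have "(\<Sum>\<eta>\<in>G. norm (den_term N j \<xi> \<eta> u v)) \<le> (\<Sum>\<eta>\<in>G. b (\<eta> j + \<xi>) * b (\<eta> j) * (cmod (l2_apply u (sh j \<xi> \<eta>)) * cmod (l2_apply v \<eta>)))"
      proof (rule sum_mono)
        fix \<eta> assume "\<eta> \<in> G"
        have w: "1 / sqrt (wt N \<eta>') \<le> b (\<eta>' j)" for \<eta>'
          unfolding b_def using wt_component[OF j, of \<eta>']
          by (intro divide_left_mono real_sqrt_le_mono mult_pos_pos) (auto simp: add_pos_nonneg)
        have "1 / (sqrt (wt N (sh j \<xi> \<eta>)) * sqrt (wt N \<eta>)) = (1 / sqrt (wt N (sh j \<xi> \<eta>))) * (1 / sqrt (wt N \<eta>))" by simp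
        also have "\<dots> \<le> b (\<eta> j + \<xi>) * b (\<eta> j)"
          using w[of "sh j \<xi> \<eta>"] w[of \<eta>] b by (intro mult_mono) (auto simp: sh_def)
        finally have "1 / (sqrt (wt N (sh j \<xi> \<eta>)) * sqrt (wt N \<eta>)) \<le> b (\<eta> j + \<xi>) * b (\<eta> j)" .
        then have "1 / (sqrt (wt N (sh j \<xi> \<eta>)) * sqrt (wt N \<eta>)) * (cmod (l2_apply u (sh j \<xi> \<eta>)) * cmod (l2_apply v \<eta>))
            \<le> b (\<eta> j + \<xi>) * b (\<eta> j) * (cmod (l2_apply u (sh j \<xi> \<eta>)) * cmod (l2_apply v \<eta>))"
          by (rule mult_right_mono) simp
        then show "norm (den_term N j \<xi> \<eta> u v) \<le> b (\<eta> j + \<xi>) * b (\<eta> j) * (cmod (l2_apply u (sh j \<xi> \<eta>)) * cmod (l2_apply v \<eta>))"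
          using True by (simp add: den_term_def norm_mult norm_divide)
      qed
      also have "\<dots> = (\<Sum>\<zeta>\<in>Z. b (\<zeta> + \<xi>) * b \<zeta> * A \<xi> \<zeta>)"
        unfolding group A_def sum_distrib_left by (intro sum.cong refl) (auto simp: H_def)
      finally have "(\<Sum>\<eta>\<in>G. norm (den_term N j \<xi> \<eta> u v))\<^sup>2 \<le> (\<Sum>\<zeta>\<in>Z. b (\<zeta> + \<xi>) * b \<zeta> * A \<xi> \<zeta>)\<^sup>2"
        by (intro power_mono sum_nonneg) auto
      also have "\<dots> \<le> (\<Sum>\<zeta>\<in>Z. (b (\<zeta> + \<xi>) * b \<zeta>)\<^sup>2) * (\<Sum>\<zeta>\<in>Z. (A \<xi> \<zeta>)\<^sup>2)"
        by (rule Cauchy_Schwarz_ineq_sum)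
      also have "\<dots> \<le> S * (\<Sum>\<zeta>\<in>Z. (A \<xi> \<zeta>)\<^sup>2)"
      proof (intro mult_right_mono sum_nonneg)
        \<comment> \<open>Neither weight alone is summable in its square, but the product of the two
          is split into fourth powers, and these are values of \<open>dec\<close>.\<close>
        have "(\<Sum>\<zeta>\<in>Z. (b (\<zeta> + \<xi>) * b \<zeta>)\<^sup>2) \<le> (\<Sum>\<zeta>\<in>Z. (dec (\<zeta> + \<xi>) + dec \<zeta>) / 2)"
        proof (rule sum_mono)
          fix \<zeta>
          show "(b (\<zeta> + \<xi>) * b \<zeta>)\<^sup>2 \<le> (dec (\<zeta> + \<xi>) + dec \<zeta>) / 2"
            using sum_squares_bound[of "(b (\<zeta> + \<xi>))\<^sup>2" "(b \<zeta>)\<^sup>2"] b(2)[of "\<zeta> + \<xi>"] b(2)[of \<zeta>]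
            by (simp add: power_mult_distrib power2_eq_square mult_ac)
        qed
        also have "\<dots> = ((\<Sum>\<zeta>\<in>Z. dec (\<zeta> + \<xi>)) + (\<Sum>\<zeta>\<in>Z. dec \<zeta>)) / 2"
          by (simp add: sum.distrib add_divide_distrib sum_divide_distrib)
        also have "\<dots> \<le> (S + S) / 2"
          using Z True
          by (intro divide_right_mono add_mono S sum_dec_inj_le[OF S(2)]) (auto simp: inj_on_def intro!: Xi_add)
        finally show "(\<Sum>\<zeta>\<in>Z. (b (\<zeta> + \<xi>) * b \<zeta>)\<^sup>2) \<le> S" by simp
      qed simp
      finally show ?thesis .
    next
      case False
      then show ?thesis using S by (simp add: den_term_def sum_nonneg)
    qed
    have "(\<Sum>\<xi>\<in>F. (\<Sum>\<eta>\<in>G. norm (den_term N j \<xi> \<eta> u v))\<^sup>2) \<le> (\<Sum>\<xi>\<in>F. S * (\<Sum>\<zeta>\<in>Z. (A \<xi> \<zeta>)\<^sup>2))"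
      by (intro sum_mono est)
    also have "\<dots> \<le> (\<Sum>\<xi>\<in>F. S * (\<Sum>\<zeta>\<in>Z. (\<Sum>\<eta>\<in>H \<zeta>. (cmod (l2_apply u (sh j \<xi> \<eta>)))\<^sup>2) * (\<Sum>\<eta>\<in>H \<zeta>. (cmod (l2_apply v \<eta>))\<^sup>2)))"
      by (intro sum_mono mult_left_mono A_le S)
    also have "\<dots> = S * (\<Sum>\<zeta>\<in>Z. (\<Sum>\<xi>\<in>F. \<Sum>\<eta>\<in>H \<zeta>. (cmod (l2_apply u (sh j \<xi> \<eta>)))\<^sup>2) * (\<Sum>\<eta>\<in>H \<zeta>. (cmod (l2_apply v \<eta>))\<^sup>2))"
      unfolding sum_distrib_left[symmetric] by (subst sum.swap) (simp add: sum_distrib_right)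
    also have "\<dots> \<le> S * (\<Sum>\<zeta>\<in>Z. (norm u)\<^sup>2 * (\<Sum>\<eta>\<in>H \<zeta>. (cmod (l2_apply v \<eta>))\<^sup>2))"
    proof (intro mult_left_mono sum_mono mult_right_mono sum_nonneg)
      fix \<zeta> assume "\<zeta> \<in> Z"
      \<comment> \<open>On a fibre where the \<open>j\<close>-th component is fixed to
        \<open>\<zeta>\<close>, the shifted point determines both the shift and the original point.
        The double sum therefore meets each coefficient of \<open>u\<close> at most once.\<close>
      have "inj_on (\<lambda>(\<xi>, \<eta>). sh j \<xi> \<eta>) (F \<times> H \<zeta>)"
      proof (rule inj_onI, clarify)
        fix \<xi> \<eta> \<xi>' \<eta>' assume "\<eta> \<in> H \<zeta>" "\<eta>' \<in> H \<zeta>" and eq: "sh j \<xi> \<eta> = sh j \<xi>' \<eta>'"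
        then have e: "\<eta> j = \<zeta>" "\<eta>' j = \<zeta>" by (auto simp: H_def)
        have "\<xi> = \<xi>'" using fun_cong[OF eq, of j] e by (simp add: sh_def)
        moreover have "\<eta> i = \<eta>' i" for i using fun_cong[OF eq, of i] e by (cases "i = j") (auto simp: sh_def)
        ultimately show "\<xi> = \<xi>' \<and> \<eta> = \<eta>'" by auto
      qed
      then have "(\<Sum>p\<in>F \<times> H \<zeta>. (cmod (l2_apply u ((\<lambda>(\<xi>, \<eta>). sh j \<xi> \<eta>) p)))\<^sup>2) \<le> (norm u)\<^sup>2"
        using F H by (intro l2_sum_inj_le) auto
      then show "(\<Sum>\<xi>\<in>F. \<Sum>\<eta>\<in>H \<zeta>. (cmod (l2_apply u (sh j \<xi> \<eta>)))\<^sup>2) \<le> (norm u)\<^sup>2"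
        by (simp add: sum.cartesian_product case_prod_unfold)
    qed (use S in auto)
    also have "\<dots> = S * ((norm u)\<^sup>2 * (\<Sum>\<eta>\<in>G. (cmod (l2_apply v \<eta>))\<^sup>2))"
      by (simp add: group sum_distrib_left)
    also have "\<dots> \<le> S * ((norm u)\<^sup>2 * (norm v)\<^sup>2)"
      using S G by (intro mult_left_mono l2_sum_le) auto
    finally show "(\<Sum>\<xi>\<in>F. (\<Sum>\<eta>\<in>G. norm (den_term N j \<xi> \<eta> u v))\<^sup>2) \<le> (sqrt S * norm u * norm v)\<^sup>2"
      using S by (simp add: power_mult_distrib)
  qed (use S in \<open>auto simp: den_term_def scaleR_conv_of_real algebra_simps add_divide_distrib\<close>)
  then show ?thesis by blast
qed

lemma bounded_bilinear_den_op: "0 < N \<Longrightarrow> j < N^3 \<Longrightarrow> bounded_bilinear (den_op N j)"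
  unfolding den_op_def by (metis den_series l2_bilinear_series.bounded_bilinear_series)

lemma l2_apply_den_op:
  "0 < N \<Longrightarrow> j < N^3 \<Longrightarrow> l2_apply (den_op N j u v) \<xi> = (\<Sum>\<^sub>\<infinity>\<eta>\<in>XiC N. den_term N j \<xi> \<eta> u v)"
  unfolding den_op_def by (metis den_series l2_bilinear_series.l2_apply_series)

text \<open>A term of the Parseval series pairing the \<open>k\<close>-th derivative of
  \<open>G r\<close> with \<open>s\<close>. The three components form one sequence indexed by the
  type \<open>3\<close>, so that the general bilinear series applies.\<close>

definition grad_term :: "nat \<Rightarrow> 3 \<Rightarrow> real^3 \<Rightarrow> (real^3, complex) l2 \<Rightarrow> (real^3, complex) l2 \<Rightarrow> complex" where
  "grad_term N k \<xi> r s = \<i> * complex_of_real (\<xi>$k / (norm \<xi>)\<^sup>2) * (l2_apply r \<xi> * cnj (l2_apply s \<xi>))"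

definition grad_op :: "nat \<Rightarrow> (real^3, complex) l2 \<Rightarrow> (real^3, complex) l2 \<Rightarrow> (3, complex) l2" where
  "grad_op N = l2_bilinear_series.series (grad_term N) (Xi N - {0})"

lemma grad_series:
  assumes N: "0 < N"
  shows "\<exists>C. l2_bilinear_series (grad_term N) (Xi N - {0}) C"
proof -
  define c where "c = real N / (2 * pi)"
  have c: "0 < c" using N by (simp add: c_def)
  \<comment> \<open>Each of the three components has bound \<open>c\<close>; the factor 2 accounts
    for them since 3 is at most the square of 2.\<close>
  have "l2_bilinear_series (grad_term N) (Xi N - {0}) (2 * c)"
  proof
    fix F :: "3 set" and G and r s :: "(real^3, complex) l2"
    assume F: "finite F" and G: "finite G" "G \<subseteq> Xi N - {0}"
    have est: "(\<Sum>\<xi>\<in>G. norm (grad_term N k \<xi> r s))\<^sup>2 \<le> (c * norm r * norm s)\<^sup>2" for k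
    proof -
      have "norm (grad_term N k \<xi> r s) \<le> c * (cmod (l2_apply r \<xi>) * cmod (l2_apply s \<xi>))" if "\<xi> \<in> G" for \<xi>
      proof -
        have \<xi>: "\<xi> \<in> Xi N" "\<xi> \<noteq> 0" using that G by auto
        have "\<bar>\<xi>$k\<bar> / (norm \<xi>)\<^sup>2 \<le> norm \<xi> / (norm \<xi>)\<^sup>2"
          by (intro divide_right_mono component_le_norm_cart) auto
        also have "\<dots> = 1 / norm \<xi>" using \<xi> by (simp add: power2_eq_square)
        also have "\<dots> \<le> 1 / (2 * pi / real N)"
          using norm_Xi_ge[OF N \<xi>] \<xi> N by (intro divide_left_mono) auto
        finally have "\<bar>\<xi>$k\<bar> / (norm \<xi>)\<^sup>2 \<le> c" by (simp add: c_def)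
        then have "\<bar>\<xi>$k\<bar> / (norm \<xi>)\<^sup>2 * (cmod (l2_apply r \<xi>) * cmod (l2_apply s \<xi>)) \<le> c * (cmod (l2_apply r \<xi>) * cmod (l2_apply s \<xi>))"
          by (rule mult_right_mono) simp
        then show ?thesis by (simp add: grad_term_def norm_mult norm_divide norm_power)
      qed
      then have "(\<Sum>\<xi>\<in>G. norm (grad_term N k \<xi> r s)) \<le> (\<Sum>\<xi>\<in>G. c * (cmod (l2_apply r \<xi>) * cmod (l2_apply s \<xi>)))"
        by (rule sum_mono)
      then have "(\<Sum>\<xi>\<in>G. norm (grad_term N k \<xi> r s))\<^sup>2 \<le> (\<Sum>\<xi>\<in>G. c * (cmod (l2_apply r \<xi>) * cmod (l2_apply s \<xi>)))\<^sup>2"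
        by (intro power_mono sum_nonneg) auto
      also have "\<dots> = c\<^sup>2 * (\<Sum>\<xi>\<in>G. cmod (l2_apply r \<xi>) * cmod (l2_apply s \<xi>))\<^sup>2"
        by (simp add: sum_distrib_left[symmetric] power_mult_distrib)
      also have "\<dots> \<le> c\<^sup>2 * ((\<Sum>\<xi>\<in>G. (cmod (l2_apply r \<xi>))\<^sup>2) * (\<Sum>\<xi>\<in>G. (cmod (l2_apply s \<xi>))\<^sup>2))"
        by (intro mult_left_mono Cauchy_Schwarz_ineq_sum) auto
      also have "\<dots> \<le> c\<^sup>2 * ((norm r)\<^sup>2 * (norm s)\<^sup>2)"
        using G by (intro mult_left_mono mult_mono l2_sum_le sum_nonneg) auto
      finally show ?thesis by (simp add: power_mult_distrib)
    qed
    have "(\<Sum>k\<in>F. (\<Sum>\<xi>\<in>G. norm (grad_term N k \<xi> r s))\<^sup>2) \<le> (\<Sum>k\<in>F. (c * norm r * norm s)\<^sup>2)"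
      by (intro sum_mono est)
    also have "\<dots> \<le> 3 * (c * norm r * norm s)\<^sup>2"
      using card_mono[of "UNIV::3 set" F] by (simp add: mult_right_mono)
    also have "\<dots> \<le> 4 * (c * norm r * norm s)\<^sup>2" by (rule mult_right_mono) auto
    finally show "(\<Sum>k\<in>F. (\<Sum>\<xi>\<in>G. norm (grad_term N k \<xi> r s))\<^sup>2) \<le> (2 * c * norm r * norm s)\<^sup>2"
      by (simp add: power_mult_distrib)
  qed (use c in \<open>auto simp: grad_term_def scaleR_conv_of_real algebra_simps add_divide_distrib\<close>)
  then show ?thesis by blast
qed

lemma bounded_bilinear_grad_op: "0 < N \<Longrightarrow> bounded_bilinear (grad_op N)"
  unfolding grad_op_def by (metis grad_series l2_bilinear_series.bounded_bilinear_series)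

lemma l2_apply_grad_op:
  "0 < N \<Longrightarrow> l2_apply (grad_op N r s) k = (\<Sum>\<^sub>\<infinity>\<xi>\<in>Xi N - {0}. grad_term N k \<xi> r s)"
  unfolding grad_op_def by (metis grad_series l2_bilinear_series.l2_apply_series)

section \<open>Charge density and wave function in Fourier space\<close>

lemma periodic_integer_shift:
  fixes \<sigma> :: "real^3 \<Rightarrow> real"
  assumes per: "\<forall>x k. \<sigma> (x + real N *\<^sub>R axis k 1) = \<sigma> x" and z: "\<forall>i. z$i \<in> \<int>"
  shows "\<sigma> (x + real N *\<^sub>R z) = \<sigma> x"
proof -
  have nat: "\<sigma> (x + (real N * real m) *\<^sub>R axis k 1) = \<sigma> x" for x k m
  proof (induction m)
    case (Suc m)
    have "x + (real N * real (Suc m)) *\<^sub>R axis k 1 = (x + (real N * real m) *\<^sub>R axis k 1) + real N *\<^sub>R axis k 1"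
      by (simp add: algebra_simps)
    then show ?case using Suc per by metis
  qed simp
  have int: "\<sigma> (x + (real N * of_int m) *\<^sub>R axis k 1) = \<sigma> x" for x k and m :: int
  proof (cases "0 \<le> m")
    case True
    then show ?thesis using nat[of x "nat m" k] by simp
  next
    case False
    then have "\<sigma> ((x + (real N * of_int m) *\<^sub>R axis k 1) + (real N * real (nat (- m))) *\<^sub>R axis k 1) = \<sigma> (x + (real N * of_int m) *\<^sub>R axis k 1)"
      by (intro nat)
    then show ?thesis using False by (simp add: algebra_simps)
  qed
  obtain a b c :: int where abc: "z$1 = of_int a" "z$2 = of_int b" "z$3 = of_int c"
    using z by (metis Ints_cases)
  have "real N *\<^sub>R z = (real N * of_int a) *\<^sub>R axis 1 1 + (real N * of_int b) *\<^sub>R axis 2 1 + (real N * of_int c) *\<^sub>R axis 3 1"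
    by (simp add: vec_eq_iff forall_3 axis_def abc)
  then have "\<sigma> (x + real N *\<^sub>R z) = \<sigma> (((x + (real N * of_int a) *\<^sub>R axis 1 1) + (real N * of_int b) *\<^sub>R axis 2 1) + (real N * of_int c) *\<^sub>R axis 3 1)"
    by (simp add: add.assoc)
  then show ?thesis by (simp only: int)
qed

lemma shift_into_cube:
  assumes "0 < N"
  obtains z :: "real^3" where "\<forall>i. z$i \<in> \<int>" "x + real N *\<^sub>R z \<in> cube N"
proof
  define z :: "real^3" where "z = (\<chi> i. - of_int \<lfloor>x$i / real N\<rfloor>)"
  show "\<forall>i. z$i \<in> \<int>" by (simp add: z_def)
  have "0 \<le> x$i + real N * z$i \<and> x$i + real N * z$i < real N" for i
  proof -
    define f where "f = real_of_int \<lfloor>x$i / real N\<rfloor>"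
    have "f \<le> x$i / real N" "x$i / real N < f + 1" unfolding f_def by linarith+
    then have "real N * f \<le> x$i" "x$i < real N * f + real N"
      using assms by (simp_all add: field_simps)
    then show ?thesis by (simp add: z_def f_def)
  qed
  then show "x + real N *\<^sub>R z \<in> cube N" by (simp add: cube_def)
qed

text \<open>This extracts the constant through which the ion density enters the dynamics.
  Compactness controls the density and its derivative near the cube. Points at distance at most 1
  are moved there by a common lattice shift, and for distant points the supremum bound is
  enough.\<close>

lemma periodic_C2_bounded_lipschitz:
  assumes N: "0 < N" and C2: "C2 \<sigma>" and per: "\<forall>x k. \<sigma> (x + real N *\<^sub>R axis k 1) = \<sigma> x"
  shows "\<exists>B. (\<forall>x. \<bar>\<sigma> x\<bar> \<le> B) \<and> (\<forall>x y. \<bar>\<sigma> x - \<sigma> y\<bar> \<le> B * norm (x - y))"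
proof -
  obtain D1 D2 where D: "\<And>x. (\<sigma> has_derivative blinfun_apply (D1 x)) (at x)"
    "\<And>x. (D1 has_derivative blinfun_apply (D2 x)) (at x)"
    using C2 unfolding C2_def by blast
  have cs: "continuous_on UNIV \<sigma>"
    by (intro continuous_at_imp_continuous_on ballI has_derivative_continuous[OF D(1)])
  have cD: "continuous_on UNIV D1"
    by (intro continuous_at_imp_continuous_on ballI has_derivative_continuous[OF D(2)])
  \<comment> \<open>The cube lies within radius \<open>3 * real N\<close> by the sum norm; the extra
    1 makes room for a second point at distance at most 1.\<close>
  define K where "K = cball (0::real^3) (3 * real N + 1)"
  have K: "compact K" "convex K" by (auto simp: K_def)
  have cube: "norm x \<le> 3 * real N" if "x \<in> cube N" for x
  proof -
    have "norm x \<le> (\<Sum>k\<in>UNIV. \<bar>x$k\<bar>)" by (rule norm_le_l1_cart)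
    also have "\<dots> \<le> (\<Sum>k\<in>(UNIV::3 set). real N)" using that by (intro sum_mono) (auto simp: cube_def less_imp_le)
    finally show ?thesis by simp
  qed
  have "bounded (\<sigma> ` K)" "bounded (D1 ` K)"
    by (intro compact_imp_bounded compact_continuous_image K continuous_on_subset[OF cs] continuous_on_subset[OF cD] subset_UNIV)+
  then obtain B1 B2 where B: "\<And>x. x \<in> K \<Longrightarrow> norm (\<sigma> x) \<le> B1" "\<And>x. x \<in> K \<Longrightarrow> norm (D1 x) \<le> B2"
    by (auto simp: bounded_iff)
  have bnd: "\<bar>\<sigma> x\<bar> \<le> B1" for x
  proof -
    obtain z where z: "\<forall>i. z$i \<in> \<int>" "x + real N *\<^sub>R z \<in> cube N" using shift_into_cube[OF N] .
    then show ?thesis using B(1)[of "x + real N *\<^sub>R z"] cube[OF z(2)] periodic_integer_shift[OF per z(1), of x]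
      by (simp add: K_def)
  qed
  have near: "\<bar>\<sigma> x - \<sigma> y\<bar> \<le> B2 * norm (x - y)" if "norm (x - y) \<le> 1" for x y
  proof -
    obtain z where z: "\<forall>i. z$i \<in> \<int>" "x + real N *\<^sub>R z \<in> cube N" using shift_into_cube[OF N] .
    define x' where "x' = x + real N *\<^sub>R z"
    define y' where "y' = y + real N *\<^sub>R z"
    have x': "x' \<in> K" using cube[OF z(2)] by (simp add: K_def x'_def)
    have "norm y' \<le> norm x' + norm (x' - y')" using norm_triangle_ineq4[of x' "x' - y'"] by simp
    then have y': "y' \<in> K" using that cube[OF z(2)] by (simp add: K_def x'_def y'_def)
    have "norm (\<sigma> x' - \<sigma> y') \<le> B2 * norm (x' - y')"
      using K(2) D(1) B(2) x' y'
      by (intro differentiable_bound[of K \<sigma> "\<lambda>x. blinfun_apply (D1 x)"])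
        (auto intro: has_derivative_at_withinI simp flip: norm_blinfun.rep_eq)
    then show ?thesis
      using periodic_integer_shift[OF per z(1)] by (simp add: x'_def y'_def)
  qed
  have B1: "0 \<le> B1" using bnd[of 0] by linarith
  have B2: "0 \<le> B2" using B(2)[of 0] by (simp add: K_def) (smt (verit) norm_ge_zero)
  show ?thesis
  proof (intro exI[of _ "2 * B1 + B2"] conjI allI)
    show "\<bar>\<sigma> x\<bar> \<le> 2 * B1 + B2" for x using bnd[of x] B1 B2 by linarith
    show "\<bar>\<sigma> x - \<sigma> y\<bar> \<le> (2 * B1 + B2) * norm (x - y)" for x y
    proof (cases "norm (x - y) \<le> 1")
      case True
      have "0 \<le> 2 * B1 * norm (x - y)" using B1 by simp
      then show ?thesis using near[OF True] unfolding distrib_right by linarith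
    next
      case False
      have "\<bar>\<sigma> x - \<sigma> y\<bar> \<le> 2 * B1" using bnd[of x] bnd[of y] by linarith
      also have "\<dots> \<le> (2 * B1 + B2) * 1" using B2 by simp
      also have "\<dots> \<le> (2 * B1 + B2) * norm (x - y)" using False B1 B2 by (intro mult_left_mono) auto
      finally show ?thesis .
    qed
  qed
qed

lemma finite_Gam: "finite (Gam N)"
proof -
  have "Gam N \<subseteq> (\<lambda>f. \<chi> k. real (f k)) ` PiE (UNIV::3 set) (\<lambda>_. {..<N})"
  proof
    fix n assume n: "n \<in> Gam N"
    then have "\<forall>k. \<exists>m\<in>{..<N}. n$k = real m" by (simp add: Gam_def)
    then obtain f where f: "\<And>k. f k \<in> {..<N}" "\<And>k. n$k = real (f k)" by metis
    then show "n \<in> (\<lambda>f. \<chi> k. real (f k)) ` PiE (UNIV::3 set) (\<lambda>_. {..<N})"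
      by (intro image_eqI[of _ _ f]) (auto simp: vec_eq_iff)
  qed
  then show ?thesis by (rule finite_subset) (auto intro!: finite_PiE)
qed

locale spn =
  fixes N :: nat and e :: real and \<sigma> :: "real^3 \<Rightarrow> real" and B :: real
  assumes N: "0 < N"
    and periodic: "\<forall>x k. \<sigma> (x + real N *\<^sub>R axis k 1) = \<sigma> x"
    and sigma_bound: "\<bar>\<sigma> x\<bar> \<le> B"
    and sigma_lipschitz: "\<bar>\<sigma> x - \<sigma> y\<bar> \<le> B * norm (x - y)"
begin

sublocale T: fourier_basis "lebesgue_on (cube N)" "Xi N" "\<lambda>\<xi> x. cis (\<xi> \<bullet> x)" "real N ^ 3"
  by (rule fourier_basis_cube[OF N])

sublocale C: fourier_basis "cfgM N" "XiC N" "\<lambda>\<eta> x. cis (cdot N \<eta> x)" "real N ^ (3 * N^3)"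
  by (rule fourier_basis_cfg[OF N])

lemma fcoef1_eq: "fcoef1 N f \<xi> = T.coef f \<xi>"
  by (simp add: fcoef1_def T.coef_def cis_cnj)

lemma fcoef_eq: "fcoef N f \<eta> = C.coef f \<eta>"
  by (simp add: fcoef_def C.coef_def cis_cnj)

lemma L2T_eq: "L2T N f \<longleftrightarrow> T.sqint f"
  by (simp add: L2T_def T.sqint_def)

lemma B: "0 \<le> B"
  using sigma_bound[of 0] by linarith

lemma sigma_continuous: "continuous_on A \<sigma>"
proof (rule lipschitz_on_continuous_on)
  show "B-lipschitz_on A \<sigma>"
    by (rule lipschitz_onI) (auto simp: dist_norm sigma_lipschitz B)
qed

definition four :: "(real^3 \<Rightarrow> complex) \<Rightarrow> (real^3, complex) l2" where
  "four f = Abs_l2 (\<lambda>\<xi>. if \<xi> \<in> Xi N then fcoef1 N f \<xi> else 0)"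

lemma four_sum_le:
  assumes f: "T.sqint f" and F: "finite F"
  shows "(\<Sum>\<xi>\<in>F. (cmod (if \<xi> \<in> Xi N then fcoef1 N f \<xi> else 0))\<^sup>2) \<le> (LINT x|lebesgue_on (cube N). (cmod (f x))\<^sup>2) / real N ^ 3"
proof -
  have "(\<Sum>\<xi>\<in>F. (cmod (if \<xi> \<in> Xi N then fcoef1 N f \<xi> else 0))\<^sup>2) = (\<Sum>\<xi>\<in>F \<inter> Xi N. (cmod (T.coef f \<xi>))\<^sup>2)"
    using F by (intro sum.mono_neutral_cong_right) (auto simp: fcoef1_eq)
  also have "\<dots> \<le> (LINT x|lebesgue_on (cube N). (cmod (f x))\<^sup>2) / real N ^ 3"
    using T.bessel[OF f, of "F \<inter> Xi N"] F N by (simp add: field_simps)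
  finally show ?thesis .
qed

lemma l2_apply_four: "T.sqint f \<Longrightarrow> l2_apply (four f) \<xi> = (if \<xi> \<in> Xi N then fcoef1 N f \<xi> else 0)"
  unfolding four_def by (subst l2_apply_Abs[OF four_sum_le]) auto

lemma measure_cube: "measure (lebesgue_on (cube N)) (cube N) = real N ^ 3"
proof -
  have "(LINT x|lebesgue_on (cube N). cis (0 \<bullet> x)) = complex_of_real (real N ^ 3)"
    using integral_cis_cube[OF N Xi_0] by simp
  then have "complex_of_real (measure (lebesgue_on (cube N)) (cube N)) = complex_of_real (real N ^ 3)"
    by (simp add: scaleR_conv_of_real)
  then show ?thesis using of_real_eq_iff by blast
qed

text \<open>The coefficients are averages over the cube, so Bessel's inequality bounds the sequence
  by the root mean square of \<open>f\<close> and hence by its supremum, with no volume factor.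
  Applied to differences of translates this makes \<open>sg\<close> Lipschitz.\<close>

lemma norm_four_le:
  assumes f: "T.sqint f" and c: "0 \<le> c" "\<And>x. cmod (f x) \<le> c"
  shows "norm (four f) \<le> c"
proof (rule norm_l2_le[OF c(1)])
  fix F :: "(real^3) set" assume F: "finite F"
  have "(LINT x|lebesgue_on (cube N). (cmod (f x))\<^sup>2) \<le> (LINT x|lebesgue_on (cube N). c\<^sup>2)"
    using f c by (intro integral_mono) (auto simp: T.sqint_def intro!: power_mono)
  also have "\<dots> = real N ^ 3 * c\<^sup>2" by (simp add: measure_cube)
  finally have "(LINT x|lebesgue_on (cube N). (cmod (f x))\<^sup>2) / real N ^ 3 \<le> c\<^sup>2"
    using N by (simp add: field_simps)
  with four_sum_le[OF f F] show "(\<Sum>\<xi>\<in>F. (norm (l2_apply (four f) \<xi>))\<^sup>2) \<le> c\<^sup>2"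
    by (simp add: l2_apply_four[OF f])
qed

lemma four_diff:
  assumes "T.sqint f" "T.sqint g" shows "four (\<lambda>x. f x - g x) = four f - four g"
  using assms by (intro l2_eqI)
    (auto simp: l2_apply_four T.sqint_diff fcoef1_eq T.coef_diff T.sqint_integrable)

definition sg :: "real^3 \<Rightarrow> (real^3, complex) l2" where
  "sg a = four (\<lambda>x. complex_of_real (\<sigma> (x - a)))"

lemma sqint_sigma: "T.sqint (\<lambda>x. complex_of_real (\<sigma> (x - a)))"
proof (rule T.sqint_bounded[where B=B])
  show "(\<lambda>x. complex_of_real (\<sigma> (x - a))) \<in> borel_measurable (lebesgue_on (cube N))"
    by (intro measurable_cube borel_measurable_continuous_onI continuous_intros continuous_on_compose2[OF sigma_continuous]) auto
qed (simp add: sigma_bound)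

lemma norm_sg: "norm (sg a) \<le> B"
  unfolding sg_def by (rule norm_four_le[OF sqint_sigma B]) (simp add: sigma_bound)

lemma sg_lipschitz: "norm (sg a - sg b) \<le> B * norm (a - b)"
proof -
  have "sg a - sg b = four (\<lambda>x. complex_of_real (\<sigma> (x - a)) - complex_of_real (\<sigma> (x - b)))"
    unfolding sg_def by (rule four_diff[symmetric, OF sqint_sigma sqint_sigma])
  moreover have "norm \<dots> \<le> B * norm (a - b)"
  proof (rule norm_four_le)
    fix x
    have "cmod (complex_of_real (\<sigma> (x - a)) - complex_of_real (\<sigma> (x - b))) = \<bar>\<sigma> (x - a) - \<sigma> (x - b)\<bar>"
      by (simp flip: of_real_diff)
    also have "\<dots> \<le> B * norm ((x - a) - (x - b))" by (rule sigma_lipschitz)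
    finally show "cmod (complex_of_real (\<sigma> (x - a)) - complex_of_real (\<sigma> (x - b))) \<le> B * norm (a - b)"
      by (simp add: norm_minus_commute)
  qed (auto intro!: T.sqint_diff sqint_sigma simp: B)
  ultimately show ?thesis by simp
qed

lemma sg_periodic: "\<forall>i. z$i \<in> \<int> \<Longrightarrow> sg (a + real N *\<^sub>R z) = sg a"
proof -
  assume z: "\<forall>i. z$i \<in> \<int>"
  then have "\<sigma> (x - (a + real N *\<^sub>R z)) = \<sigma> (x - a)" for x
    using periodic_integer_shift[OF periodic, of "- z" "x - a"] by (simp add: algebra_simps)
  then show ?thesis by (simp add: sg_def)
qed

section \<open>Wave functions as sequences\<close>

definition H1 :: "wf \<Rightarrow> bool" where
  "H1 \<psi> \<longleftrightarrow> C.sqint \<psi> \<and> (\<lambda>\<eta>. csq N \<eta> * (cmod (fcoef N \<psi> \<eta>))\<^sup>2) summable_on XiC N"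

lemma inF_H1: "inF N \<psi> \<longleftrightarrow> H1 \<psi> \<and> antisym_wf N \<psi>"
  by (auto simp: inF_def H1_def C.sqint_def)

text \<open>With the weight moved into the coordinates, the unweighted sequence space carries the
  norm of F up to the constant factor in \<open>normF_emb\<close>.\<close>

definition emb :: "wf \<Rightarrow> (cfg, complex) l2" where
  "emb \<psi> = Abs_l2 (\<lambda>\<eta>. if \<eta> \<in> XiC N then complex_of_real (sqrt (wt N \<eta>)) * fcoef N \<psi> \<eta> else 0)"

lemma H1_summable:
  assumes "H1 \<psi>"
  shows "(\<lambda>\<eta>. wt N \<eta> * (cmod (fcoef N \<psi> \<eta>))\<^sup>2) summable_on XiC N"
    and "(\<Sum>\<^sub>\<infinity>\<eta>\<in>XiC N. wt N \<eta> * (cmod (fcoef N \<psi> \<eta>))\<^sup>2)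
      = (\<Sum>\<^sub>\<infinity>\<eta>\<in>XiC N. (cmod (fcoef N \<psi> \<eta>))\<^sup>2) + (\<Sum>\<^sub>\<infinity>\<eta>\<in>XiC N. csq N \<eta> * (cmod (fcoef N \<psi> \<eta>))\<^sup>2)"
proof -
  have 1: "(\<lambda>\<eta>. (cmod (fcoef N \<psi> \<eta>))\<^sup>2) summable_on XiC N"
    using assms C.coef_summable unfolding H1_def fcoef_eq by blast
  have 2: "(\<lambda>\<eta>. csq N \<eta> * (cmod (fcoef N \<psi> \<eta>))\<^sup>2) summable_on XiC N"
    using assms by (simp add: H1_def)
  show "(\<lambda>\<eta>. wt N \<eta> * (cmod (fcoef N \<psi> \<eta>))\<^sup>2) summable_on XiC N"
    using summable_on_add[OF 1 2] by (simp add: wt_def algebra_simps)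
  show "(\<Sum>\<^sub>\<infinity>\<eta>\<in>XiC N. wt N \<eta> * (cmod (fcoef N \<psi> \<eta>))\<^sup>2)
      = (\<Sum>\<^sub>\<infinity>\<eta>\<in>XiC N. (cmod (fcoef N \<psi> \<eta>))\<^sup>2) + (\<Sum>\<^sub>\<infinity>\<eta>\<in>XiC N. csq N \<eta> * (cmod (fcoef N \<psi> \<eta>))\<^sup>2)"
    using infsum_add[OF 1 2] by (simp add: wt_def algebra_simps)
qed

lemma l2_apply_emb:
  assumes "H1 \<psi>"
  shows "l2_apply (emb \<psi>) \<eta> = (if \<eta> \<in> XiC N then complex_of_real (sqrt (wt N \<eta>)) * fcoef N \<psi> \<eta> else 0)"
  unfolding emb_def
proof (subst l2_apply_Abs)
  fix F :: "cfg set" assume F: "finite F"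
  have "(\<Sum>\<eta>\<in>F. (cmod (if \<eta> \<in> XiC N then complex_of_real (sqrt (wt N \<eta>)) * fcoef N \<psi> \<eta> else 0))\<^sup>2)
      = (\<Sum>\<eta>\<in>F \<inter> XiC N. wt N \<eta> * (cmod (fcoef N \<psi> \<eta>))\<^sup>2)"
    using F by (intro sum.mono_neutral_cong_right) (auto simp: norm_mult power_mult_distrib)
  also have "\<dots> \<le> (\<Sum>\<^sub>\<infinity>\<eta>\<in>XiC N. wt N \<eta> * (cmod (fcoef N \<psi> \<eta>))\<^sup>2)"
    using F by (intro finite_sum_le_infsum H1_summable assms) auto
  finally show "(\<Sum>\<eta>\<in>F. (cmod (if \<eta> \<in> XiC N then complex_of_real (sqrt (wt N \<eta>)) * fcoef N \<psi> \<eta> else 0))\<^sup>2)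
      \<le> (\<Sum>\<^sub>\<infinity>\<eta>\<in>XiC N. wt N \<eta> * (cmod (fcoef N \<psi> \<eta>))\<^sup>2)" .
qed auto

lemma normF_emb:
  assumes "H1 \<psi>"
  shows "normF N \<psi> = sqrt (real N ^ (3 * N^3)) * norm (emb \<psi>)"
proof -
  have "(norm (emb \<psi>))\<^sup>2 = (\<Sum>\<^sub>\<infinity>\<eta>\<in>XiC N. wt N \<eta> * (cmod (fcoef N \<psi> \<eta>))\<^sup>2)"
    unfolding norm_l2_sq by (intro infsum_cong_neutral) (auto simp: l2_apply_emb[OF assms] norm_mult power_mult_distrib)
  also have "\<dots> = (\<Sum>\<^sub>\<infinity>\<eta>\<in>XiC N. (cmod (fcoef N \<psi> \<eta>))\<^sup>2) + (\<Sum>\<^sub>\<infinity>\<eta>\<in>XiC N. csq N \<eta> * (cmod (fcoef N \<psi> \<eta>))\<^sup>2)"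
    by (rule H1_summable[OF assms])
  finally have "real N ^ (3 * N^3) * (norm (emb \<psi>))\<^sup>2 = L2norm2 N \<psi> + gradnorm2 N \<psi>"
    using C.parseval[of \<psi>] assms by (simp add: L2norm2_def gradnorm2_def fcoef_eq H1_def algebra_simps)
  then have "normF N \<psi> = sqrt (real N ^ (3 * N^3) * (norm (emb \<psi>))\<^sup>2)" by (simp add: normF_def)
  then show ?thesis by (simp add: real_sqrt_mult)
qed

lemma H1I:
  assumes "C.sqint \<psi>" "\<And>\<eta>. \<eta> \<in> XiC N \<Longrightarrow> complex_of_real (sqrt (wt N \<eta>)) * fcoef N \<psi> \<eta> = l2_apply u \<eta>"
  shows "H1 \<psi>"
  unfolding H1_def
proof
  have "csq N \<eta> * (cmod (fcoef N \<psi> \<eta>))\<^sup>2 \<le> (cmod (l2_apply u \<eta>))\<^sup>2" if "\<eta> \<in> XiC N" for \<eta>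
  proof -
    have "(cmod (l2_apply u \<eta>))\<^sup>2 = wt N \<eta> * (cmod (fcoef N \<psi> \<eta>))\<^sup>2"
      using assms(2)[OF that, symmetric] by (simp add: norm_mult power_mult_distrib)
    then show ?thesis by (simp add: wt_def distrib_right)
  qed
  then show "(\<lambda>\<eta>. csq N \<eta> * (cmod (fcoef N \<psi> \<eta>))\<^sup>2) summable_on XiC N"
    by (intro summable_on_comparison_test[OF l2_summable[of u "XiC N"]]) (auto simp: csq_def sum_nonneg)
qed (rule assms(1))

lemma H1_diff:
  assumes "H1 \<psi>" "H1 \<phi>"
  shows "H1 (\<lambda>x. \<psi> x - \<phi> x)" "emb (\<lambda>x. \<psi> x - \<phi> x) = emb \<psi> - emb \<phi>"
proof -
  have s: "C.sqint \<psi>" "C.sqint \<phi>" using assms by (auto simp: H1_def)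
  have c: "fcoef N (\<lambda>x. \<psi> x - \<phi> x) \<eta> = fcoef N \<psi> \<eta> - fcoef N \<phi> \<eta>" for \<eta>
    using s by (simp add: fcoef_eq C.coef_diff C.sqint_integrable)
  show h: "H1 (\<lambda>x. \<psi> x - \<phi> x)"
    by (rule H1I[where u="emb \<psi> - emb \<phi>"])
      (auto simp: C.sqint_diff s c l2_apply_emb[OF assms(1)] l2_apply_emb[OF assms(2)] right_diff_distrib)
  show "emb (\<lambda>x. \<psi> x - \<phi> x) = emb \<psi> - emb \<phi>"
    by (rule l2_eqI) (auto simp: l2_apply_emb[OF h] l2_apply_emb[OF assms(1)] l2_apply_emb[OF assms(2)] c right_diff_distrib)
qed

text \<open>A permutation of the particles preserves the measure and permutes frequencies, and
  coefficients determine a function almost everywhere. Antisymmetry thus becomes a family of linear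
  equations between coefficients.\<close>

lemma antisym_wf_iff:
  assumes "C.sqint \<psi>"
  shows "antisym_wf N \<psi> \<longleftrightarrow> (\<forall>\<pi>. \<pi> permutes {..<N^3} \<longrightarrow> (\<forall>\<eta>\<in>XiC N. fcoef N \<psi> (\<eta> \<circ> \<pi>) = of_int (sign \<pi>) * fcoef N \<psi> \<eta>))"
  unfolding antisym_wf_def
proof (intro all_cong1 imp_cong refl)
  fix \<pi> assume \<pi>: "\<pi> permutes {..<N^3}"
  have m: "\<psi> \<in> borel_measurable (cfgM N)" using assms by (simp add: C.sqint_def)
  have m': "(\<lambda>x. \<psi> (x \<circ> \<pi>)) \<in> borel_measurable (cfgM N)"
    by (rule measurable_compose[OF distr_permute_cfgM(1)[OF N \<pi>] m])
  have i: "integrable (cfgM N) (\<lambda>x. \<psi> (x \<circ> \<pi>))"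
    using C.sqint_integrable[OF assms] integrable_distr[OF distr_permute_cfgM(1)[OF N \<pi>], of \<psi>]
    by (simp add: distr_permute_cfgM(2)[OF N \<pi>])
  show "(AE x in cfgM N. \<psi> (x \<circ> \<pi>) = of_int (sign \<pi>) * \<psi> x) \<longleftrightarrow>
      (\<forall>\<eta>\<in>XiC N. fcoef N \<psi> (\<eta> \<circ> \<pi>) = of_int (sign \<pi>) * fcoef N \<psi> \<eta>)"
  proof
    assume "AE x in cfgM N. \<psi> (x \<circ> \<pi>) = of_int (sign \<pi>) * \<psi> x"
    then have "fcoef N (\<lambda>x. \<psi> (x \<circ> \<pi>)) \<eta> = fcoef N (\<lambda>x. of_int (sign \<pi>) * \<psi> x) \<eta>" for \<eta>
      unfolding fcoef_eq using m m' by (intro C.coef_cong_AE) auto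
    then show "\<forall>\<eta>\<in>XiC N. fcoef N \<psi> (\<eta> \<circ> \<pi>) = of_int (sign \<pi>) * fcoef N \<psi> \<eta>"
      by (simp add: fcoef_permute[OF N \<pi> m] fcoef_eq C.coef_scale)
  next
    assume "\<forall>\<eta>\<in>XiC N. fcoef N \<psi> (\<eta> \<circ> \<pi>) = of_int (sign \<pi>) * fcoef N \<psi> \<eta>"
    then have "C.coef (\<lambda>x. \<psi> (x \<circ> \<pi>)) \<eta> = C.coef (\<lambda>x. of_int (sign \<pi>) * \<psi> x) \<eta>" if "\<eta> \<in> XiC N" for \<eta>
      using that fcoef_permute[OF N \<pi> m, of \<eta>] by (simp add: fcoef_eq C.coef_scale)
    then show "AE x in cfgM N. \<psi> (x \<circ> \<pi>) = of_int (sign \<pi>) * \<psi> x"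
      by (intro C.coef_inject i) (auto intro!: C.sqint_integrable C.sqint_scale assms)
  qed
qed

text \<open>The image of F under \<open>emb\<close>, by \<open>admissible_emb\<close> and
  \<open>admissible_obtain\<close>. The index type contains more than the dual lattice, hence the
  requirement on the support.\<close>

definition admissible :: "(cfg, complex) l2 \<Rightarrow> bool" where
  "admissible u \<longleftrightarrow> (\<forall>\<eta>. \<eta> \<notin> XiC N \<longrightarrow> l2_apply u \<eta> = 0) \<and>
     (\<forall>\<pi> \<eta>. \<pi> permutes {..<N^3} \<longrightarrow> \<eta> \<in> XiC N \<longrightarrow> l2_apply u (\<eta> \<circ> \<pi>) = of_int (sign \<pi>) * l2_apply u \<eta>)"

lemma admissible_emb: "inF N \<psi> \<Longrightarrow> admissible (emb \<psi>)"
  using antisym_wf_iff[of \<psi>]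
  by (auto simp: admissible_def inF_H1 l2_apply_emb XiC_permute wt_def csq_permute H1_def)

lemma admissible_obtain:
  assumes u: "admissible u"
  obtains \<psi> where "inF N \<psi>" "emb \<psi> = u"
proof -
  define a where "a \<eta> = l2_apply u \<eta> / complex_of_real (sqrt (wt N \<eta>))" for \<eta>
  have au: "complex_of_real (sqrt (wt N \<eta>)) * a \<eta> = l2_apply u \<eta>" for \<eta> by (simp add: a_def)
  have "(\<lambda>\<eta>. (cmod (a \<eta>))\<^sup>2) summable_on XiC N"
  proof (rule summable_on_comparison_test[OF l2_summable[of u "XiC N"]])
    fix \<eta> show "(cmod (a \<eta>))\<^sup>2 \<le> (cmod (l2_apply u \<eta>))\<^sup>2"
      using wt_ge_1[of N \<eta>] mult_left_mono[OF wt_ge_1[of N \<eta>], of "(cmod (l2_apply u \<eta>))\<^sup>2"]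
      by (simp add: a_def norm_divide power_divide divide_le_eq)
  qed auto
  then obtain \<psi> where \<psi>: "C.sqint \<psi>" "\<And>\<eta>. \<eta> \<in> XiC N \<Longrightarrow> C.coef \<psi> \<eta> = a \<eta>"
    using C.riesz_fischer by metis
  have h: "H1 \<psi>" by (rule H1I[OF \<psi>(1), where u=u]) (simp add: fcoef_eq \<psi> au)
  have "emb \<psi> = u"
    using u by (intro l2_eqI) (auto simp: l2_apply_emb[OF h] fcoef_eq \<psi> au admissible_def)
  moreover have "antisym_wf N \<psi>"
    unfolding antisym_wf_iff[OF \<psi>(1)] using u
    by (auto simp: fcoef_eq \<psi> XiC_permute a_def admissible_def wt_def csq_permute)
  ultimately show ?thesis using that h by (simp add: inF_H1)
qed

end

section \<open>Potential and force in Fourier space\<close>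

lemma cdot_sh: "j < N^3 \<Longrightarrow> cdot N (sh j \<xi> \<eta>) x = cdot N \<eta> x + \<xi> \<bullet> x j"
proof -
  assume j: "j < N^3"
  have split: "cdot N \<zeta> x = \<zeta> j \<bullet> x j + (\<Sum>i\<in>{..<N^3} - {j}. \<zeta> i \<bullet> x i)" for \<zeta>
    unfolding cdot_def using j by (intro sum.remove) auto
  have "(\<Sum>i\<in>{..<N^3} - {j}. sh j \<xi> \<eta> i \<bullet> x i) = (\<Sum>i\<in>{..<N^3} - {j}. \<eta> i \<bullet> x i)"
    by (intro sum.cong) (auto simp: sh_def)
  then show ?thesis by (simp add: split[of "sh j \<xi> \<eta>"] split[of \<eta>]) (simp add: sh_def inner_add_left)
qed

context spn
begin

abbreviation V :: real where "V \<equiv> real N ^ (3 * N^3)"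

lemma component_cis_measurable: "j < N^3 \<Longrightarrow> (\<lambda>x. cis (\<xi> \<bullet> x j)) \<in> borel_measurable (cfgM N)"
  unfolding cfgM_def by (intro borel_measurable_cis measurable_PiM_inner) simp

lemma coef_sh:
  assumes "j < N^3"
  shows "C.coef (\<lambda>x. cis ((- \<xi>) \<bullet> x j) * \<psi> x) \<eta> = C.coef \<psi> (sh j \<xi> \<eta>)"
proof -
  have "(\<lambda>x. cis ((- \<xi>) \<bullet> x j) * \<psi> x * cnj (cis (cdot N \<eta> x))) = (\<lambda>x. \<psi> x * cnj (cis (cdot N (sh j \<xi> \<eta>) x)))"
    by (auto simp: cdot_sh[OF assms] cis_cnj cis_mult[symmetric] mult_ac)
  then show ?thesis by (simp add: C.coef_def)
qed

definition density :: "wf \<Rightarrow> nat \<Rightarrow> real^3 \<Rightarrow> real" where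
  "density \<psi> j x = (\<integral>y. (cmod (\<psi> (y(j := x))))\<^sup>2 \<partial>PiM ({..<N^3} - {j}) (\<lambda>_. lebesgue_on (cube N)))"

text \<open>By Fubini a coefficient of the marginal is the inner product of \<open>\<psi>\<close>,
  multiplied by a one-particle character, with \<open>\<psi>\<close> itself. Parseval's identity on
  the configuration space expands this into the correlation series. The factor
  \<open>V / real N ^ 3\<close> is the ratio of the two normalizations.\<close>

lemma density:
  assumes \<psi>: "H1 \<psi>" and j: "j < N^3"
  shows "integrable (lebesgue_on (cube N)) (\<lambda>x. complex_of_real (density \<psi> j x))"
    and "\<xi> \<in> Xi N \<Longrightarrow> T.coef (\<lambda>x. complex_of_real (density \<psi> j x)) \<xi>
      = complex_of_real (V / real N ^ 3) * l2_apply (den_op N j (emb \<psi>) (emb \<psi>)) \<xi>"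
proof -
  define J where "J = {..<N^3} - {j}"
  let ?M = "\<lambda>_::nat. lebesgue_on (cube N)"
  have J: "finite J" "j \<notin> J" and ins: "insert j J = {..<N^3}" using j by (auto simp: J_def)
  interpret P: product_sigma_finite ?M by (rule product_sigma_finite_cube[OF N])
  interpret PJ: finite_product_sigma_finite ?M J by standard (rule J)
  interpret pair_sigma_finite "PiM J ?M" "lebesgue_on (cube N)" ..
  have s: "C.sqint \<psi>" using \<psi> by (simp add: H1_def)
  define F where "F z = complex_of_real ((cmod (\<psi> z))\<^sup>2)" for z
  have F: "integrable (PiM (insert j J) ?M) F"
  proof -
    have "integrable (cfgM N) F" unfolding F_def using s by (intro integrable_of_real) (simp add: C.sqint_def)
    then show ?thesis by (simp add: ins cfgM_def)
  qed
  have dF: "complex_of_real (density \<psi> j x) = (\<integral>y. F (y(j := x)) \<partial>PiM J ?M)" for x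
    unfolding density_def F_def J_def by (rule integral_complex_of_real[symmetric])
  show "integrable (lebesgue_on (cube N)) (\<lambda>x. complex_of_real (density \<psi> j x))"
    unfolding dF using integrable_snd[OF P.integrable_PiM_insert(1)[OF J F]] by simp
  assume \<xi>: "\<xi> \<in> Xi N"
  define G where "G z = F z * cis ((- \<xi>) \<bullet> z j)" for z
  have G: "integrable (PiM (insert j J) ?M) G"
    unfolding G_def
  proof (rule integrable_mult_bounded[OF F, where B=1])
    show "(\<lambda>z. cis ((- \<xi>) \<bullet> z j)) \<in> borel_measurable (PiM (insert j J) ?M)"
      using component_cis_measurable[OF j, of "- \<xi>"] unfolding ins cfgM_def .
  qed simp
  have "(LINT x|lebesgue_on (cube N). complex_of_real (density \<psi> j x) * cnj (cis (\<xi> \<bullet> x)))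
      = (LINT x|lebesgue_on (cube N). (\<integral>y. G (y(j := x)) \<partial>PiM J ?M))"
    unfolding dF G_def by (intro Bochner_Integration.integral_cong refl) (simp add: cis_cnj)
  also have "\<dots> = (\<integral>z. (case z of (y, x) \<Rightarrow> G (y(j := x))) \<partial>(PiM J ?M \<Otimes>\<^sub>M lebesgue_on (cube N)))"
    using integral_snd[OF P.integrable_PiM_insert(1)[OF J G]] by simp
  also have "\<dots> = integral\<^sup>L (cfgM N) G"
    using P.integrable_PiM_insert(2)[OF J G] by (simp add: ins cfgM_def)
  also have "\<dots> = (\<integral>x. (cis ((- \<xi>) \<bullet> x j) * \<psi> x) * cnj (\<psi> x) \<partial>cfgM N)"
    unfolding G_def F_def complex_norm_square by (simp add: mult_ac)
  finally have eq: "(LINT x|lebesgue_on (cube N). complex_of_real (density \<psi> j x) * cnj (cis (\<xi> \<bullet> x)))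
      = (\<integral>x. (cis ((- \<xi>) \<bullet> x j) * \<psi> x) * cnj (\<psi> x) \<partial>cfgM N)" .
  have "C.sqint (\<lambda>x. cis ((- \<xi>) \<bullet> x j) * \<psi> x)"
    by (rule C.sqint_unit_mult[OF s component_cis_measurable[OF j]]) simp
  from C.parseval_inner[OF this s]
  have "((\<lambda>\<eta>. C.coef \<psi> (sh j \<xi> \<eta>) * cnj (C.coef \<psi> \<eta>)) has_sum
      (\<integral>x. (cis ((- \<xi>) \<bullet> x j) * \<psi> x) * cnj (\<psi> x) \<partial>cfgM N) / V) (XiC N)"
    by (simp only: coef_sh[OF j])
  also have "((\<lambda>\<eta>. C.coef \<psi> (sh j \<xi> \<eta>) * cnj (C.coef \<psi> \<eta>)) has_sum
      (\<integral>x. (cis ((- \<xi>) \<bullet> x j) * \<psi> x) * cnj (\<psi> x) \<partial>cfgM N) / V) (XiC N)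
    \<longleftrightarrow> ((\<lambda>\<eta>. den_term N j \<xi> \<eta> (emb \<psi>) (emb \<psi>)) has_sum
      (\<integral>x. (cis ((- \<xi>) \<bullet> x j) * \<psi> x) * cnj (\<psi> x) \<partial>cfgM N) / V) (XiC N)"
    by (rule has_sum_cong) (simp add: den_term_def \<xi> l2_apply_emb[OF \<psi>] sh_XiC[OF j \<xi>] fcoef_eq)
  finally have "l2_apply (den_op N j (emb \<psi>) (emb \<psi>)) \<xi>
      = (\<integral>x. (cis ((- \<xi>) \<bullet> x j) * \<psi> x) * cnj (\<psi> x) \<partial>cfgM N) / V"
    unfolding l2_apply_den_op[OF N j] by (rule infsumI)
  then show "T.coef (\<lambda>x. complex_of_real (density \<psi> j x)) \<xi>
      = complex_of_real (V / real N ^ 3) * l2_apply (den_op N j (emb \<psi>) (emb \<psi>)) \<xi>"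
    using N by (simp add: T.coef_def eq)
qed

definition rhat :: "(cfg, complex) l2 \<Rightarrow> (real^3 \<Rightarrow> real^3) \<Rightarrow> (real^3, complex) l2" where
  "rhat u q = (\<Sum>n\<in>Gam N. sg (n + q n)) - (e * (V / real N ^ 3)) *\<^sub>R (\<Sum>j<N^3. den_op N j u u)"

lemma coef_rho:
  assumes \<psi>: "H1 (psi X)" and \<xi>: "\<xi> \<in> Xi N"
  shows "T.coef (\<lambda>x. complex_of_real (rho N e \<sigma> X x)) \<xi> = l2_apply (rhat (emb (psi X)) (qq X)) \<xi>"
proof -
  have i1: "integrable (lebesgue_on (cube N)) (\<lambda>x. \<Sum>n\<in>Gam N. complex_of_real (\<sigma> (x - (n + qq X n))))"
    by (intro Bochner_Integration.integrable_sum T.sqint_integrable sqint_sigma)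
  have i2: "integrable (lebesgue_on (cube N)) (\<lambda>x. \<Sum>j<N^3. complex_of_real (density (psi X) j x))"
    by (intro Bochner_Integration.integrable_sum density(1)[OF \<psi>]) auto
  have "(\<lambda>x. complex_of_real (rho N e \<sigma> X x)) = (\<lambda>x. (\<Sum>n\<in>Gam N. complex_of_real (\<sigma> (x - (n + qq X n))))
     - complex_of_real e * (\<Sum>j<N^3. complex_of_real (density (psi X) j x)))"
    by (simp add: rho_def rho_i_def rho_e_def density_def diff_diff_eq)
  then have "T.coef (\<lambda>x. complex_of_real (rho N e \<sigma> X x)) \<xi>
      = T.coef (\<lambda>x. \<Sum>n\<in>Gam N. complex_of_real (\<sigma> (x - (n + qq X n)))) \<xi>
       - complex_of_real e * T.coef (\<lambda>x. \<Sum>j<N^3. complex_of_real (density (psi X) j x)) \<xi>"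
    using i1 i2 by (simp add: T.coef_diff T.coef_scale)
  also have "T.coef (\<lambda>x. \<Sum>n\<in>Gam N. complex_of_real (\<sigma> (x - (n + qq X n)))) \<xi> = (\<Sum>n\<in>Gam N. l2_apply (sg (n + qq X n)) \<xi>)"
    by (subst T.coef_sum) (auto simp: T.sqint_integrable sqint_sigma sg_def l2_apply_four \<xi> fcoef1_eq)
  also have "T.coef (\<lambda>x. \<Sum>j<N^3. complex_of_real (density (psi X) j x)) \<xi>
      = (\<Sum>j<N^3. complex_of_real (V / real N ^ 3) * l2_apply (den_op N j (emb (psi X)) (emb (psi X))) \<xi>)"
    by (subst T.coef_sum) (auto simp: density[OF \<psi>] \<xi>)
  finally show ?thesis
    by (simp add: rhat_def scaleR_conv_of_real sum_distrib_left mult.assoc)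
qed

text \<open>The choice made by \<open>Gop\<close> obeys its specification once some
  square-integrable function has the required coefficients. Those of the charge are square summable,
  and the nonzero frequencies stay away from 0, so Riesz-Fischer supplies one.\<close>

lemma Phi_props:
  assumes \<psi>: "H1 (psi X)"
  shows "T.sqint (Phi N e \<sigma> X)"
    and "\<xi> \<in> Xi N \<Longrightarrow> T.coef (Phi N e \<sigma> X) \<xi> =
      (if \<xi> = 0 then 0 else l2_apply (rhat (emb (psi X)) (qq X)) \<xi> / complex_of_real ((norm \<xi>)\<^sup>2))"
proof -
  define r where "r = rhat (emb (psi X)) (qq X)"
  define a where "a \<xi> = (if \<xi> = 0 then 0 else l2_apply r \<xi> / complex_of_real ((norm \<xi>)\<^sup>2))" for \<xi>
  define c where "c = 2 * pi / real N"
  have c: "0 < c" using N by (simp add: c_def)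
  have "(\<lambda>\<xi>. (cmod (a \<xi>))\<^sup>2) summable_on Xi N"
  proof (rule summable_on_comparison_test)
    show "(\<lambda>\<xi>. (1 / c ^ 4) * (cmod (l2_apply r \<xi>))\<^sup>2) summable_on Xi N"
      by (intro summable_on_cmult_right l2_summable)
    fix \<xi> assume \<xi>: "\<xi> \<in> Xi N"
    show "(cmod (a \<xi>))\<^sup>2 \<le> (1 / c ^ 4) * (cmod (l2_apply r \<xi>))\<^sup>2"
    proof (cases "\<xi> = 0")
      case False
      have "c ^ 4 \<le> norm \<xi> ^ 4" using norm_Xi_ge[OF N \<xi> False] c by (intro power_mono) (auto simp: c_def)
      then have "(cmod (l2_apply r \<xi>))\<^sup>2 / norm \<xi> ^ 4 \<le> (cmod (l2_apply r \<xi>))\<^sup>2 / c ^ 4"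
        using c False by (intro divide_left_mono mult_pos_pos) auto
      then show ?thesis using False by (simp add: a_def norm_divide power_divide norm_power)
    qed (use c in \<open>simp add: a_def\<close>)
  qed auto
  then obtain f where f: "T.sqint f" "\<And>\<xi>. \<xi> \<in> Xi N \<Longrightarrow> T.coef f \<xi> = a \<xi>"
    using T.riesz_fischer by metis
  have "\<exists>\<Phi>. L2T N \<Phi> \<and> (\<forall>\<xi>\<in>Xi N. fcoef1 N \<Phi> \<xi> =
       (if \<xi> = 0 then 0 else fcoef1 N (\<lambda>x. complex_of_real (rho N e \<sigma> X x)) \<xi> / complex_of_real ((norm \<xi>)^2)))"
    by (rule exI[of _ f]) (use f in \<open>auto simp: L2T_eq fcoef1_eq coef_rho[OF \<psi>] a_def r_def\<close>)
  from someI_ex[OF this] show "T.sqint (Phi N e \<sigma> X)"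
    and "\<xi> \<in> Xi N \<Longrightarrow> T.coef (Phi N e \<sigma> X) \<xi> =
      (if \<xi> = 0 then 0 else l2_apply (rhat (emb (psi X)) (qq X)) \<xi> / complex_of_real ((norm \<xi>)\<^sup>2))"
    unfolding Phi_def Gop_def by (auto simp: L2T_eq fcoef1_eq coef_rho[OF \<psi>])
qed

text \<open>As for the potential, Riesz-Fischer first shows that the weak derivative chosen by
  \<open>dpart\<close> exists: its symbol composed with that of \<open>G\<close> is bounded by
  \<open>real N / (2 * pi)\<close>. Parseval's identity on the cube then evaluates the pairing, with
  the volume \<open>real N ^ 3\<close> as normalization.\<close>

lemma force_eq:
  assumes \<psi>: "H1 (psi X)"
  shows "force N e \<sigma> X n = (\<chi> k. real N ^ 3 * Re (l2_apply (grad_op N (rhat (emb (psi X)) (qq X)) (sg (n + qq X n))) k))"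
proof -
  define r where "r = rhat (emb (psi X)) (qq X)"
  define c where "c = 2 * pi / real N"
  have c: "0 < c" using N by (simp add: c_def)
  have "Re (LINT x|lebesgue_on (cube N). dpart N (Phi N e \<sigma> X) k x * cnj (complex_of_real (\<sigma> (x - n - qq X n))))
      = real N ^ 3 * Re (l2_apply (grad_op N r (sg (n + qq X n))) k)" for k
  proof -
    define a where "a \<xi> = \<i> * complex_of_real (\<xi>$k) * T.coef (Phi N e \<sigma> X) \<xi>" for \<xi>
    have a: "a \<xi> = (if \<xi> = 0 then 0 else \<i> * complex_of_real (\<xi>$k / (norm \<xi>)\<^sup>2) * l2_apply r \<xi>)" if "\<xi> \<in> Xi N" for \<xi>
      using that by (simp add: a_def Phi_props[OF \<psi>] r_def)
    have "(\<lambda>\<xi>. (cmod (a \<xi>))\<^sup>2) summable_on Xi N"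
    proof (rule summable_on_comparison_test)
      show "(\<lambda>\<xi>. (1 / c)\<^sup>2 * (cmod (l2_apply r \<xi>))\<^sup>2) summable_on Xi N"
        by (intro summable_on_cmult_right l2_summable)
      fix \<xi> assume \<xi>: "\<xi> \<in> Xi N"
      show "(cmod (a \<xi>))\<^sup>2 \<le> (1 / c)\<^sup>2 * (cmod (l2_apply r \<xi>))\<^sup>2"
      proof (cases "\<xi> = 0")
        case False
        have "\<bar>\<xi>$k\<bar> / (norm \<xi>)\<^sup>2 \<le> norm \<xi> / (norm \<xi>)\<^sup>2"
          by (intro divide_right_mono component_le_norm_cart) auto
        also have "\<dots> = 1 / norm \<xi>" using False by (simp add: power2_eq_square)
        also have "\<dots> \<le> 1 / c"
        proof -
          have "c \<le> norm \<xi>" unfolding c_def by (rule norm_Xi_ge[OF N \<xi> False])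
          then show ?thesis using c False by (intro divide_left_mono mult_pos_pos) auto
        qed
        finally have "\<bar>\<xi>$k\<bar> / (norm \<xi>)\<^sup>2 * cmod (l2_apply r \<xi>) \<le> 1 / c * cmod (l2_apply r \<xi>)"
          by (intro mult_right_mono) auto
        then have "(\<bar>\<xi>$k\<bar> / (norm \<xi>)\<^sup>2 * cmod (l2_apply r \<xi>))\<^sup>2 \<le> (1 / c * cmod (l2_apply r \<xi>))\<^sup>2"
          by (intro power_mono) auto
        moreover have "cmod (a \<xi>) = \<bar>\<xi>$k\<bar> / (norm \<xi>)\<^sup>2 * cmod (l2_apply r \<xi>)"
          using False by (simp add: a[OF \<xi>] norm_mult norm_divide norm_power)
        ultimately show ?thesis by (simp only: power_mult_distrib)
      qed (use c in \<open>simp add: a[OF Xi_0]\<close>)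
    qed auto
    then obtain f where f: "T.sqint f" "\<And>\<xi>. \<xi> \<in> Xi N \<Longrightarrow> T.coef f \<xi> = a \<xi>"
      using T.riesz_fischer by metis
    have ex: "\<exists>g. L2T N g \<and> (\<forall>\<xi>\<in>Xi N. fcoef1 N g \<xi> = \<i> * complex_of_real (\<xi>$k) * fcoef1 N (Phi N e \<sigma> X) \<xi>)"
      by (rule exI[of _ f]) (use f in \<open>auto simp: L2T_eq fcoef1_eq a_def\<close>)
    define g where "g = dpart N (Phi N e \<sigma> X) k"
    have g: "T.sqint g" "\<And>\<xi>. \<xi> \<in> Xi N \<Longrightarrow> T.coef g \<xi> = a \<xi>"
      using someI_ex[OF ex] unfolding g_def dpart_def by (auto simp: L2T_eq fcoef1_eq a_def)
    have "((\<lambda>\<xi>. T.coef g \<xi> * cnj (T.coef (\<lambda>x. complex_of_real (\<sigma> (x - (n + qq X n)))) \<xi>)) has_sum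
      (LINT x|lebesgue_on (cube N). g x * cnj (complex_of_real (\<sigma> (x - (n + qq X n))))) / complex_of_real (real N ^ 3)) (Xi N)"
      by (rule T.parseval_inner[OF g(1) sqint_sigma])
    also have "((\<lambda>\<xi>. T.coef g \<xi> * cnj (T.coef (\<lambda>x. complex_of_real (\<sigma> (x - (n + qq X n)))) \<xi>)) has_sum
      (LINT x|lebesgue_on (cube N). g x * cnj (complex_of_real (\<sigma> (x - (n + qq X n))))) / complex_of_real (real N ^ 3)) (Xi N)
      \<longleftrightarrow> ((\<lambda>\<xi>. grad_term N k \<xi> r (sg (n + qq X n))) has_sum
      (LINT x|lebesgue_on (cube N). g x * cnj (complex_of_real (\<sigma> (x - (n + qq X n))))) / complex_of_real (real N ^ 3)) (Xi N - {0})"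
      by (rule has_sum_cong_neutral)
        (auto simp: g a grad_term_def sg_def l2_apply_four[OF sqint_sigma] fcoef1_eq)
    finally have "l2_apply (grad_op N r (sg (n + qq X n))) k
        = (LINT x|lebesgue_on (cube N). g x * cnj (complex_of_real (\<sigma> (x - (n + qq X n))))) / complex_of_real (real N ^ 3)"
      unfolding l2_apply_grad_op[OF N] by (rule infsumI)
    then have "(LINT x|lebesgue_on (cube N). g x * cnj (complex_of_real (\<sigma> (x - (n + qq X n)))))
        = complex_of_real (real N ^ 3) * l2_apply (grad_op N r (sg (n + qq X n))) k"
      using N by simp
    then show ?thesis unfolding g_def[symmetric] diff_diff_eq by simp
  qed
  then show ?thesis by (simp add: force_def r_def)
qed

section \<open>Coefficients of a potential times a wave function\<close>

definition lift1 :: "nat \<Rightarrow> real^3 \<Rightarrow> cfg" where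
  "lift1 j \<xi> = (\<lambda>i\<in>{..<N^3}. if i = j then \<xi> else 0)"

lemma lift1_XiC: "\<xi> \<in> Xi N \<Longrightarrow> lift1 j \<xi> \<in> XiC N"
  unfolding lift1_def XiC_def by (auto simp: PiE_iff)

lemma cdot_lift1: "j < N^3 \<Longrightarrow> cdot N (lift1 j \<xi>) x = \<xi> \<bullet> x j"
  unfolding cdot_def lift1_def by (subst sum.remove[of _ j]) auto

lemma measurable_component_fun:
  assumes j: "j < N^3" and f: "f \<in> borel_measurable (lebesgue_on (cube N))"
  shows "(\<lambda>x. f (x j)) \<in> borel_measurable (cfgM N)"
proof -
  have "(\<lambda>x. x j) \<in> measurable (cfgM N) (lebesgue_on (cube N))"
    unfolding cfgM_def using j by (intro measurable_component_singleton) simp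
  from measurable_compose[OF this f] show ?thesis .
qed

lemma integrable_component_fun:
  fixes f :: "real^3 \<Rightarrow> complex"
  assumes j: "j < N^3" and f: "integrable (lebesgue_on (cube N)) f"
  shows "integrable (cfgM N) (\<lambda>x. f (x j))"
proof -
  interpret P: product_sigma_finite "\<lambda>_::nat. lebesgue_on (cube N)" by (rule product_sigma_finite_cube[OF N])
  have "integrable (cfgM N) (\<lambda>x. \<Prod>i<N^3. (if i = j then f else (\<lambda>_. 1)) (x i))"
    unfolding cfgM_def using f by (intro P.product_integrable_prod) auto
  also have "(\<lambda>x. \<Prod>i<N^3. (if i = j then f else (\<lambda>_. 1)) (x i)) = (\<lambda>x::cfg. f (x j))"
    using j by (intro ext, subst prod.remove[of _ j]) auto
  finally show ?thesis .
qed

lemma sqint_component_fun: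
  assumes j: "j < N^3" and f: "T.sqint f"
  shows "C.sqint (\<lambda>x. f (x j))"
proof -
  have "integrable (lebesgue_on (cube N)) (\<lambda>x. complex_of_real ((cmod (f x))\<^sup>2))"
    using f unfolding T.sqint_def by (intro integrable_of_real) auto
  from integrable_Re[OF integrable_component_fun[OF j this]]
  show ?thesis
    using measurable_component_fun[OF j T.sqint_measurable[OF f]] by (simp add: C.sqint_def)
qed

text \<open>The integral factorizes over the particles. Each factor other than the
  \<open>j\<close>-th is the integral of a character and vanishes unless its frequency is 0.\<close>

lemma coef_component_fun:
  assumes j: "j < N^3" and f: "T.sqint f" and \<zeta>: "\<zeta> \<in> XiC N"
  shows "C.coef (\<lambda>x. f (x j)) \<zeta> = (if \<zeta> = lift1 j (\<zeta> j) then T.coef f (\<zeta> j) else 0)"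
proof -
  interpret P: product_sigma_finite "\<lambda>_::nat. lebesgue_on (cube N)" by (rule product_sigma_finite_cube[OF N])
  define h where "h i y = (if i = j then f y else 1) * cnj (cis (\<zeta> i \<bullet> y))" for i and y :: "real^3"
  have hi: "integrable (lebesgue_on (cube N)) (h i)" for i
    unfolding h_def using T.sqint_integrable[OF f]
    by (cases "i = j") (auto intro!: T.integrable_mult_c T.sqint_integrable[OF T.sqint_c])
  have "(\<integral>x. f (x j) * cnj (cis (cdot N \<zeta> x)) \<partial>cfgM N) = (\<integral>x. (\<Prod>i<N^3. h i (x i)) \<partial>cfgM N)"
  proof (rule Bochner_Integration.integral_cong[OF refl])
    fix x :: cfg
    have "(\<Prod>i<N^3. h i (x i)) = (\<Prod>i<N^3. if i = j then f (x i) else 1) * (\<Prod>i<N^3. cnj (cis (\<zeta> i \<bullet> x i)))"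
      unfolding h_def by (rule prod.distrib)
    also have "(\<Prod>i<N^3. if i = j then f (x i) else 1) = f (x j)"
      using j by (subst prod.remove[of _ j]) auto
    also have "(\<Prod>i<N^3. cnj (cis (\<zeta> i \<bullet> x i))) = cnj (cis (cdot N \<zeta> x))"
      by (simp add: cdot_def cis_sum)
    finally show "f (x j) * cnj (cis (cdot N \<zeta> x)) = (\<Prod>i<N^3. h i (x i))" by simp
  qed
  also have "\<dots> = (\<Prod>i<N^3. LINT y|lebesgue_on (cube N). h i y)"
    unfolding cfgM_def by (rule P.product_integral_prod) (auto intro: hi)
  also have "\<dots> = (LINT y|lebesgue_on (cube N). h j y) * (\<Prod>i\<in>{..<N^3} - {j}. LINT y|lebesgue_on (cube N). h i y)"
    using j by (intro prod.remove) auto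
  also have "(LINT y|lebesgue_on (cube N). h j y) = complex_of_real (real N ^ 3) * T.coef f (\<zeta> j)"
    using N by (simp add: h_def T.coef_def)
  also have "(\<Prod>i\<in>{..<N^3} - {j}. LINT y|lebesgue_on (cube N). h i y)
      = (\<Prod>i\<in>{..<N^3} - {j}. if \<zeta> i = 0 then complex_of_real (real N ^ 3) else 0)"
  proof (intro prod.cong refl)
    fix i assume i: "i \<in> {..<N^3} - {j}"
    then have "- \<zeta> i \<in> Xi N" using \<zeta> by (intro Xi_uminus) (auto simp: XiC_def PiE_iff)
    from integral_cis_cube[OF N this] show "(LINT y|lebesgue_on (cube N). h i y) = (if \<zeta> i = 0 then complex_of_real (real N ^ 3) else 0)"
      using i by (simp add: h_def cis_cnj)
  qed
  also have "\<dots> = (if \<zeta> = lift1 j (\<zeta> j) then complex_of_real (real N ^ 3) ^ (N^3 - 1) else 0)"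
  proof (cases "\<zeta> = lift1 j (\<zeta> j)")
    case True
    have "\<zeta> i = 0" if "i \<in> {..<N^3} - {j}" for i
    proof -
      have "\<zeta> i = lift1 j (\<zeta> j) i" by (rule fun_cong[OF True])
      also have "\<dots> = 0" using that by (simp add: lift1_def)
      finally show ?thesis .
    qed
    then have "(\<Prod>i\<in>{..<N^3} - {j}. if \<zeta> i = 0 then complex_of_real (real N ^ 3) else 0) = (\<Prod>i\<in>{..<N^3} - {j}. complex_of_real (real N ^ 3))"
      by (intro prod.cong) auto
    also have "\<dots> = complex_of_real (real N ^ 3) ^ (N^3 - 1)" using j by simp
    finally show ?thesis using True by simp
  next
    case False
    have "\<exists>i\<in>{..<N^3} - {j}. \<zeta> i \<noteq> 0"
    proof (rule ccontr)
      assume "\<not> (\<exists>i\<in>{..<N^3} - {j}. \<zeta> i \<noteq> 0)"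
      then have "\<zeta> = lift1 j (\<zeta> j)" using \<zeta> by (auto simp: fun_eq_iff lift1_def XiC_def PiE_iff extensional_def)
      then show False using False by simp
    qed
    then have "(\<Prod>i\<in>{..<N^3} - {j}. if \<zeta> i = 0 then complex_of_real (real N ^ 3) else 0) = 0"
      by (intro prod_zero) auto
    then show ?thesis using False by simp
  qed
  finally have eq: "(\<integral>x. f (x j) * cnj (cis (cdot N \<zeta> x)) \<partial>cfgM N)
    = complex_of_real (real N ^ 3) * T.coef f (\<zeta> j) * (if \<zeta> = lift1 j (\<zeta> j) then complex_of_real (real N ^ 3) ^ (N^3 - 1) else 0)" .
  have "N^3 = Suc (N^3 - 1)" using j by simp
  then have "complex_of_real V = complex_of_real (real N ^ 3) * complex_of_real (real N ^ 3) ^ (N^3 - 1)"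
    by (metis of_real_power power_Suc power_mult)
  then show ?thesis using N unfolding C.coef_def eq by simp
qed

text \<open>A product of two square-integrable functions is merely integrable, so Parseval's
  identity is not applied to it directly. Its coefficient is read instead as the inner product of
  the one-particle factor with a modulated conjugate of \<open>\<psi>\<close>, and the sum collapses
  to the frequencies of the \<open>j\<close>-th variable.\<close>

lemma coef_product:
  assumes j: "j < N^3" and f: "T.sqint f" and \<psi>: "C.sqint \<psi>" and \<eta>: "\<eta> \<in> XiC N"
  shows "integrable (cfgM N) (\<lambda>x. f (x j) * \<psi> x)"
    and "((\<lambda>\<xi>. T.coef f \<xi> * C.coef \<psi> (sh j (- \<xi>) \<eta>)) has_sum C.coef (\<lambda>x. f (x j) * \<psi> x) \<eta>) (Xi N)"
proof -
  have fj: "C.sqint (\<lambda>x. f (x j))" by (rule sqint_component_fun[OF j f])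
  have cpsi: "C.sqint (\<lambda>x. cnj (\<psi> x))" using \<psi> by (auto simp: C.sqint_def)
  show "integrable (cfgM N) (\<lambda>x. f (x j) * \<psi> x)"
    using C.sqint_mult_cnj[OF fj cpsi] by simp
  \<comment> \<open>The conjugate is built in because the inner product conjugates its second
    argument; the character of \<open>\<eta>\<close> turns the inner product into a coefficient of
    the product.\<close>
  define g where "g x = cis (cdot N \<eta> x) * cnj (\<psi> x)" for x
  have g: "C.sqint g" unfolding g_def by (rule C.sqint_unit_mult[OF cpsi]) auto
  have cg: "cnj (C.coef g (lift1 j \<xi>)) = C.coef \<psi> (sh j (- \<xi>) \<eta>)" for \<xi>
  proof -
    have "cnj (C.coef g (lift1 j \<xi>)) = (\<integral>x. cnj (g x * cnj (cis (cdot N (lift1 j \<xi>) x))) \<partial>cfgM N) / complex_of_real V"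
      unfolding C.coef_def complex_cnj_divide 
      by (simp only: Bochner_Integration.integral_cnj[of "cfgM N" "\<lambda>x. g x * cnj (cis (cdot N (lift1 j \<xi>) x))"] complex_cnj_complex_of_real)
    also have "(\<lambda>x. cnj (g x * cnj (cis (cdot N (lift1 j \<xi>) x)))) = (\<lambda>x. \<psi> x * cnj (cis (cdot N (sh j (- \<xi>) \<eta>) x)))"
    proof
      fix x
      have "cnj (cis (cdot N (sh j (- \<xi>) \<eta>) x)) = cis (- cdot N \<eta> x) * cis (\<xi> \<bullet> x j)"
        by (simp add: cdot_sh[OF j] cis_cnj cis_mult)
      then show "cnj (g x * cnj (cis (cdot N (lift1 j \<xi>) x))) = \<psi> x * cnj (cis (cdot N (sh j (- \<xi>) \<eta>) x))"
        by (simp add: g_def cdot_lift1[OF j] cis_cnj mult_ac)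
    qed
    finally show ?thesis by (simp add: C.coef_def)
  qed
  have "C.coef (\<lambda>x. f (x j) * \<psi> x) \<eta> = (\<integral>x. f (x j) * cnj (g x) \<partial>cfgM N) / V"
    unfolding C.coef_def g_def by (simp add: mult_ac)
  then have "((\<lambda>\<zeta>. C.coef (\<lambda>x. f (x j)) \<zeta> * cnj (C.coef g \<zeta>)) has_sum C.coef (\<lambda>x. f (x j) * \<psi> x) \<eta>) (XiC N)"
    using C.parseval_inner[OF fj g] by simp
  also have "((\<lambda>\<zeta>. C.coef (\<lambda>x. f (x j)) \<zeta> * cnj (C.coef g \<zeta>)) has_sum C.coef (\<lambda>x. f (x j) * \<psi> x) \<eta>) (XiC N)
    \<longleftrightarrow> ((\<lambda>\<zeta>. C.coef (\<lambda>x. f (x j)) \<zeta> * cnj (C.coef g \<zeta>)) has_sum C.coef (\<lambda>x. f (x j) * \<psi> x) \<eta>) (lift1 j ` Xi N)"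
  proof (rule has_sum_cong_neutral)
    show "C.coef (\<lambda>x. f (x j)) \<zeta> * cnj (C.coef g \<zeta>) = 0" if "\<zeta> \<in> lift1 j ` Xi N - XiC N" for \<zeta>
      using that lift1_XiC by blast
    show "C.coef (\<lambda>x. f (x j)) \<zeta> * cnj (C.coef g \<zeta>) = 0" if "\<zeta> \<in> XiC N - lift1 j ` Xi N" for \<zeta>
    proof -
      have "\<zeta> j \<in> Xi N" using that j by (auto simp: XiC_def PiE_iff)
      then have "\<zeta> \<noteq> lift1 j (\<zeta> j)" using that by blast
      then show ?thesis using coef_component_fun[OF j f, of \<zeta>] that by simp
    qed
  qed auto
  also have "\<dots> \<longleftrightarrow> (((\<lambda>\<zeta>. C.coef (\<lambda>x. f (x j)) \<zeta> * cnj (C.coef g \<zeta>)) \<circ> lift1 j) has_sum C.coef (\<lambda>x. f (x j) * \<psi> x) \<eta>) (Xi N)"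
  proof (rule has_sum_reindex)
    show "inj_on (lift1 j) (Xi N)"
    proof (rule inj_onI)
      fix x y assume "lift1 j x = lift1 j y"
      from fun_cong[OF this, of j] show "x = y" using j by (simp add: lift1_def)
    qed
  qed
  also have "\<dots> \<longleftrightarrow> ((\<lambda>\<xi>. T.coef f \<xi> * C.coef \<psi> (sh j (- \<xi>) \<eta>)) has_sum C.coef (\<lambda>x. f (x j) * \<psi> x) \<eta>) (Xi N)"
  proof (rule has_sum_cong)
    fix \<xi> assume \<xi>: "\<xi> \<in> Xi N"
    have "lift1 j \<xi> \<in> XiC N" by (rule lift1_XiC[OF \<xi>])
    moreover have "lift1 j \<xi> j = \<xi>" using j by (simp add: lift1_def)
    ultimately show "((\<lambda>\<zeta>. C.coef (\<lambda>x. f (x j)) \<zeta> * cnj (C.coef g \<zeta>)) \<circ> lift1 j) \<xi> = T.coef f \<xi> * C.coef \<psi> (sh j (- \<xi>) \<eta>)"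
      using coef_component_fun[OF j f, of "lift1 j \<xi>"] by (simp add: cg)
  qed
  finally show "((\<lambda>\<xi>. T.coef f \<xi> * C.coef \<psi> (sh j (- \<xi>) \<eta>)) has_sum C.coef (\<lambda>x. f (x j) * \<psi> x) \<eta>) (Xi N)" .
qed

text \<open>Parseval in each particle variable turns the potential term into a convolution. The zero
  frequency drops out since the potential has mean zero, and the weights of \<open>emb\<close>
  combine with the symbol of \<open>G\<close> to \<open>mul_kernel\<close>.\<close>

lemma fcoef_mulPhi:
  assumes \<psi>: "H1 (psi X)" and \<eta>: "\<eta> \<in> XiC N"
  shows "complex_of_real (sqrt (wt N \<eta>)) * fcoef N (mulPhi N (Phi N e \<sigma> X) (psi X)) \<eta>
    = l2_apply (\<Sum>j<N^3. mul_op N j (rhat (emb (psi X)) (qq X)) (emb (psi X))) \<eta>"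
proof -
  define r where "r = rhat (emb (psi X)) (qq X)"
  define \<Phi> where "\<Phi> = Phi N e \<sigma> X"
  have \<Phi>: "T.sqint \<Phi>" "\<And>\<xi>. \<xi> \<in> Xi N \<Longrightarrow> T.coef \<Phi> \<xi> = (if \<xi> = 0 then 0 else l2_apply r \<xi> / complex_of_real ((norm \<xi>)\<^sup>2))"
    unfolding \<Phi>_def r_def by (rule Phi_props[OF \<psi>])+
  have s: "C.sqint (psi X)" using \<psi> by (simp add: H1_def)
  have tm: "complex_of_real (sqrt (wt N \<eta>)) * C.coef (\<lambda>x. \<Phi> (x j) * psi X x) \<eta> = l2_apply (mul_op N j r (emb (psi X))) \<eta>" if j: "j < N^3" for j
  proof -
    have "((\<lambda>\<xi>. complex_of_real (sqrt (wt N \<eta>)) * (T.coef \<Phi> \<xi> * C.coef (psi X) (sh j (- \<xi>) \<eta>))) has_sum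
        complex_of_real (sqrt (wt N \<eta>)) * C.coef (\<lambda>x. \<Phi> (x j) * psi X x) \<eta>) (Xi N)"
      by (intro has_sum_cmult_right coef_product(2)[OF j \<Phi>(1) s \<eta>])
    also have "((\<lambda>\<xi>. complex_of_real (sqrt (wt N \<eta>)) * (T.coef \<Phi> \<xi> * C.coef (psi X) (sh j (- \<xi>) \<eta>))) has_sum
        complex_of_real (sqrt (wt N \<eta>)) * C.coef (\<lambda>x. \<Phi> (x j) * psi X x) \<eta>) (Xi N)
      \<longleftrightarrow> ((\<lambda>\<xi>. mul_term N j \<eta> \<xi> r (emb (psi X))) has_sum
        complex_of_real (sqrt (wt N \<eta>)) * C.coef (\<lambda>x. \<Phi> (x j) * psi X x) \<eta>) (Xi N - {0})"
      by (rule has_sum_cong_neutral)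
        (auto simp: \<Phi> mul_term_def mul_kernel_def \<eta> l2_apply_emb[OF \<psi>] sh_XiC[OF j Xi_uminus] fcoef_eq)
    finally show ?thesis unfolding l2_apply_mul_op[OF N j] by (rule infsumI[symmetric])
  qed
  have "mulPhi N \<Phi> (psi X) = (\<lambda>x. \<Sum>j<N^3. \<Phi> (x j) * psi X x)"
    by (auto simp: mulPhi_def sum_distrib_right)
  then have "fcoef N (mulPhi N \<Phi> (psi X)) \<eta> = (\<Sum>j<N^3. C.coef (\<lambda>x. \<Phi> (x j) * psi X x) \<eta>)"
    using coef_product(1)[OF _ \<Phi>(1) s \<eta>] unfolding fcoef_eq by (simp only:) (rule C.coef_sum, simp)
  then show ?thesis unfolding \<Phi>_def[symmetric] r_def[symmetric] by (simp add: sum_distrib_left tm)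
qed

end

section \<open>Evolution in the interaction picture\<close>

definition mult_l2 :: "('a \<Rightarrow> complex) \<Rightarrow> ('a, complex) l2 \<Rightarrow> ('a, complex) l2" where
  "mult_l2 m u = Abs_l2 (\<lambda>x. m x * l2_apply u x)"

lemma l2_apply_mult:
  assumes "\<And>x. cmod (m x) = 1"
  shows "l2_apply (mult_l2 m u) x = m x * l2_apply u x"
  unfolding mult_l2_def
  by (subst l2_apply_Abs[where c="(norm u)\<^sup>2"]) (auto simp: norm_mult assms l2_sum_le)

lemma norm_mult_l2:
  assumes "\<And>x. cmod (m x) = 1"
  shows "norm (mult_l2 m u) = norm u"
  unfolding norm_l2_def by (simp add: l2_apply_mult[OF assms] norm_mult assms)

lemma bounded_linear_mult_l2:
  assumes "\<And>x. cmod (m x) = 1"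
  shows "bounded_linear (mult_l2 m)"
  by (rule bounded_linear_intro[where K=1])
    (auto intro!: l2_eqI simp: l2_apply_mult[OF assms] norm_mult_l2[OF assms] distrib_left)

lemma l2_finite_approx:
  fixes u :: "('a, 'b::banach) l2"
  assumes "0 < \<epsilon>"
  obtains F where "finite F" "norm (u - (\<Sum>x\<in>F. single_l2 x (l2_apply u x))) \<le> \<epsilon>"
proof -
  obtain F where F: "finite F" "dist (\<Sum>x\<in>F. (norm (l2_apply u x))\<^sup>2) (\<Sum>\<^sub>\<infinity>x. (norm (l2_apply u x))\<^sup>2) \<le> \<epsilon>\<^sup>2"
    using infsum_finite_approximation[OF l2_summable[of u UNIV], of "\<epsilon>\<^sup>2"] assms by auto
  have coord: "l2_apply (u - (\<Sum>x\<in>F. single_l2 x (l2_apply u x))) y = (if y \<in> F then 0 else l2_apply u y)" for y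
    using F(1) by (auto simp: sum.delta)
  have "norm (u - (\<Sum>x\<in>F. single_l2 x (l2_apply u x))) \<le> \<epsilon>"
  proof (rule norm_l2_le)
    fix G :: "'a set" assume G: "finite G"
    have "(\<Sum>y\<in>G. (norm (l2_apply (u - (\<Sum>x\<in>F. single_l2 x (l2_apply u x))) y))\<^sup>2) = (\<Sum>y\<in>G - F. (norm (l2_apply u y))\<^sup>2)"
      unfolding coord using G by (intro sum.mono_neutral_cong_right) auto
    moreover have "(\<Sum>y\<in>G - F. (norm (l2_apply u y))\<^sup>2) + (\<Sum>y\<in>F. (norm (l2_apply u y))\<^sup>2) = (\<Sum>y\<in>(G - F) \<union> F. (norm (l2_apply u y))\<^sup>2)"
      using F G by (subst sum.union_disjoint) auto
    moreover have "\<dots> \<le> (\<Sum>\<^sub>\<infinity>x. (norm (l2_apply u x))\<^sup>2)"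
      using F G by (intro finite_sum_le_infsum l2_summable) auto
    ultimately show "(\<Sum>y\<in>G. (norm (l2_apply (u - (\<Sum>x\<in>F. single_l2 x (l2_apply u x))) y))\<^sup>2) \<le> \<epsilon>\<^sup>2"
      using F(2) by (auto simp: dist_real_def abs_le_iff)
  qed (use assms in simp)
  then show ?thesis using that F(1) by blast
qed

text \<open>The free Schroedinger group, with half the Laplacian as generator, in Fourier
  coordinates.\<close>

definition W :: "nat \<Rightarrow> real \<Rightarrow> (cfg, complex) l2 \<Rightarrow> (cfg, complex) l2" where
  "W N s = mult_l2 (\<lambda>\<eta>. cis (- (s * csq N \<eta> / 2)))"

lemma l2_apply_W [simp]: "l2_apply (W N s u) \<eta> = cis (- (s * csq N \<eta> / 2)) * l2_apply u \<eta>"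
  unfolding W_def by (rule l2_apply_mult) simp

lemma norm_W [simp]: "norm (W N s u) = norm u"
  unfolding W_def by (rule norm_mult_l2) simp

lemma W_W: "W N s (W N t u) = W N (s + t) u"
  by (rule l2_eqI) (simp add: cis_mult mult.assoc[symmetric] distrib_right add_divide_distrib)

lemma W_0 [simp]: "W N 0 u = u"
  by (rule l2_eqI) simp

lemma W_diff: "W N s u - W N s v = W N s (u - v)"
  by (rule l2_eqI) (simp add: right_diff_distrib)

text \<open>On a finitely supported sequence only finitely many phases vary, so continuity is clear
  there. A general sequence differs from such a one by a small error, whose norm is the same at all
  times because \<open>W\<close> is isometric.\<close>

lemma continuous_W_time: "continuous_on UNIV (\<lambda>s. W N s u)"
proof (rule continuous_at_imp_continuous_on, intro ballI, unfold continuous_at_eps_delta, intro allI impI)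
  fix s \<epsilon> :: real assume \<epsilon>: "0 < \<epsilon>"
  obtain F where F: "finite F" "norm (u - (\<Sum>x\<in>F. single_l2 x (l2_apply u x))) \<le> \<epsilon> / 4"
    using l2_finite_approx[of "\<epsilon> / 4" u] \<epsilon> by auto
  define v where "v = (\<Sum>x\<in>F. single_l2 x (l2_apply u x))"
  have Wv: "W N t v = (\<Sum>x\<in>F. single_l2 x (cis (- (t * csq N x / 2)) * l2_apply u x))" for t
    unfolding v_def using F(1) by (intro l2_eqI) (auto simp: if_distrib[of "\<lambda>z. _ * z"] sum_distrib_left cong: if_cong)
  have "continuous_on UNIV (\<lambda>t. W N t v)"
    unfolding Wv cis_conv_exp
    by (intro continuous_intros bounded_linear.continuous_on[OF bounded_linear_single_l2]) auto
  then have "continuous (at s) (\<lambda>t. W N t v)" by (simp add: continuous_on_eq_continuous_at)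
  then obtain \<delta> where \<delta>: "0 < \<delta>" "\<And>t. dist t s < \<delta> \<Longrightarrow> dist (W N t v) (W N s v) < \<epsilon> / 4"
    using \<epsilon> unfolding continuous_at_eps_delta by (metis divide_pos_pos zero_less_numeral)
  show "\<exists>d>0. \<forall>t. dist t s < d \<longrightarrow> dist (W N t u) (W N s u) < \<epsilon>"
  proof (intro exI[of _ \<delta>] conjI allI impI \<delta>(1))
    fix t assume "dist t s < \<delta>"
    then have "norm (W N t v - W N s v) < \<epsilon> / 4" using \<delta>(2) by (simp add: dist_norm)
    moreover have "W N t u - W N s u = W N t (u - v) + (W N t v - W N s v) - W N s (u - v)"
      by (simp flip: W_diff)
    moreover have "norm (W N t (u - v) + (W N t v - W N s v) - W N s (u - v)) \<le> norm (u - v) + norm (W N t v - W N s v) + norm (u - v)"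
      using norm_triangle_ineq4[of "W N t (u - v) + (W N t v - W N s v)" "W N s (u - v)"]
        norm_triangle_ineq[of "W N t (u - v)" "W N t v - W N s v"] unfolding norm_W by linarith
    ultimately show "dist (W N t u) (W N s u) < \<epsilon>" using F(2) \<epsilon> by (simp add: dist_norm v_def)
  qed
qed

text \<open>Isometry makes continuity in the second argument uniform in time, which upgrades strong
  continuity to joint continuity.\<close>

lemma continuous_W: "continuous_on UNIV (\<lambda>z. W N (fst z) (snd z))"
proof (rule continuous_at_imp_continuous_on, intro ballI)
  fix z :: "real \<times> (cfg, complex) l2"
  show "continuous (at z) (\<lambda>z. W N (fst z) (snd z))"
    unfolding isCont_def
  proof (rule tendstoI)
    fix \<epsilon> :: real assume \<epsilon>: "0 < \<epsilon>"
    have "((\<lambda>s. W N s (snd z)) \<longlongrightarrow> W N (fst z) (snd z)) (at (fst z))"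
      using continuous_W_time[of N "snd z"] by (simp add: continuous_on_eq_continuous_at isCont_def)
    then have "isCont (\<lambda>s. W N s (snd z)) (fst z)" by (simp add: isCont_def)
    then have "isCont (\<lambda>w. W N (fst w) (snd z)) z"
      by (rule isCont_o2[rotated]) (intro continuous_intros)
    then have "\<forall>\<^sub>F w in at z. dist (W N (fst w) (snd z)) (W N (fst z) (snd z)) < \<epsilon> / 2"
      using \<epsilon> by (auto simp: isCont_def dest!: tendstoD[where e="\<epsilon> / 2"])
    moreover have "\<forall>\<^sub>F w in at z. dist (snd w) (snd z) < \<epsilon> / 2"
      using \<epsilon> by (intro tendstoD tendsto_snd) (auto intro: tendsto_ident_at)
    ultimately show "\<forall>\<^sub>F w in at z. dist (W N (fst w) (snd w)) (W N (fst z) (snd z)) < \<epsilon>"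
    proof eventually_elim
      case (elim w)
      have "dist (W N (fst w) (snd w)) (W N (fst w) (snd z)) = dist (snd w) (snd z)"
        by (simp add: dist_norm W_diff)
      then show ?case using elim dist_triangle[of "W N (fst w) (snd w)" "W N (fst z) (snd z)" "W N (fst w) (snd z)"]
        by linarith
    qed
  qed
qed

section \<open>Calculus of bounded Lipschitz maps\<close>

definition blip :: "'e::real_normed_vector set \<Rightarrow> ('e \<Rightarrow> 'x::real_normed_vector) \<Rightarrow> bool" where
  "blip D f \<longleftrightarrow> (\<exists>C\<ge>0. (\<forall>x\<in>D. norm (f x) \<le> C) \<and> (\<forall>x\<in>D. \<forall>y\<in>D. norm (f x - f y) \<le> C * norm (x - y)))"

lemma blipI:
  assumes "\<And>x. x \<in> D \<Longrightarrow> norm (f x) \<le> C" "\<And>x y. x \<in> D \<Longrightarrow> y \<in> D \<Longrightarrow> norm (f x - f y) \<le> L * norm (x - y)"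
  shows "blip D f"
  unfolding blip_def
proof (intro exI[of _ "max 0 (max C L)"] conjI ballI)
  fix x y assume "x \<in> D" "y \<in> D"
  then have "norm (f x - f y) \<le> L * norm (x - y)" by (rule assms)
  also have "\<dots> \<le> max 0 (max C L) * norm (x - y)" by (rule mult_right_mono) auto
  finally show "norm (f x - f y) \<le> max 0 (max C L) * norm (x - y)" .
qed (use assms in \<open>auto simp: le_max_iff_disj\<close>)

lemma blip_linear:
  assumes "bounded_linear h" "blip D f"
  shows "blip D (\<lambda>x. h (f x))"
proof -
  interpret bounded_linear h by fact
  obtain K where K: "0 \<le> K" "\<And>x. norm (h x) \<le> norm x * K" using nonneg_bounded by auto
  obtain C where C: "\<And>x. x \<in> D \<Longrightarrow> norm (f x) \<le> C" "\<And>x y. x \<in> D \<Longrightarrow> y \<in> D \<Longrightarrow> norm (f x - f y) \<le> C * norm (x - y)"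
    using assms(2) by (auto simp: blip_def)
  show ?thesis
  proof (rule blipI)
    fix x y assume x: "x \<in> D" and y: "y \<in> D"
    show "norm (h (f x)) \<le> C * K"
      using K(2)[of "f x"] mult_right_mono[OF C(1)[OF x] K(1)] by linarith
    have "norm (h (f x) - h (f y)) \<le> norm (f x - f y) * K" unfolding diff[symmetric] by (rule K)
    also have "\<dots> \<le> C * norm (x - y) * K" by (rule mult_right_mono[OF C(2)[OF x y] K(1)])
    finally show "norm (h (f x) - h (f y)) \<le> C * K * norm (x - y)" by (simp add: mult_ac)
  qed
qed

text \<open>A product of Lipschitz maps is Lipschitz when the factors are also bounded; this is why
  \<open>blip\<close> records both properties at once.\<close>

lemma blip_bilinear:
  assumes "bounded_bilinear h" "blip D f" "blip D g"
  shows "blip D (\<lambda>x. h (f x) (g x))"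
proof -
  interpret bounded_bilinear h by fact
  obtain K where K: "0 \<le> K" "\<And>x y. norm (h x y) \<le> norm x * norm y * K" using nonneg_bounded by auto
  obtain C where C: "0 \<le> C" "\<And>x. x \<in> D \<Longrightarrow> norm (f x) \<le> C" "\<And>x y. x \<in> D \<Longrightarrow> y \<in> D \<Longrightarrow> norm (f x - f y) \<le> C * norm (x - y)"
    using assms(2) by (auto simp: blip_def)
  obtain E where E: "0 \<le> E" "\<And>x. x \<in> D \<Longrightarrow> norm (g x) \<le> E" "\<And>x y. x \<in> D \<Longrightarrow> y \<in> D \<Longrightarrow> norm (g x - g y) \<le> E * norm (x - y)"
    using assms(3) by (auto simp: blip_def)
  show ?thesis
  proof (rule blipI)
    fix x y assume x: "x \<in> D" and y: "y \<in> D"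
    have "norm (h (f x) (g x)) \<le> norm (f x) * norm (g x) * K" by (rule K)
    also have "\<dots> \<le> C * E * K" using C E K x by (intro mult_right_mono mult_mono) auto
    finally show "norm (h (f x) (g x)) \<le> C * E * K" .
    have "h (f x) (g x) - h (f y) (g y) = h (f x - f y) (g x) + h (f y) (g x - g y)"
      by (simp add: diff_left diff_right)
    also have "norm \<dots> \<le> norm (f x - f y) * norm (g x) * K + norm (f y) * norm (g x - g y) * K"
      by (rule order_trans[OF norm_triangle_ineq add_mono[OF K(2) K(2)]])
    also have "\<dots> \<le> (C * norm (x - y)) * E * K + C * (E * norm (x - y)) * K"
      using C E K x y by (intro add_mono mult_right_mono mult_mono) auto
    finally show "norm (h (f x) (g x) - h (f y) (g y)) \<le> (2 * C * E * K) * norm (x - y)" by (simp add: algebra_simps)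
  qed
qed

lemma blip_add:
  assumes "blip D f" "blip D g" shows "blip D (\<lambda>x. f x + g x)"
proof -
  obtain C where C: "\<And>x. x \<in> D \<Longrightarrow> norm (f x) \<le> C" "\<And>x y. x \<in> D \<Longrightarrow> y \<in> D \<Longrightarrow> norm (f x - f y) \<le> C * norm (x - y)"
    using assms(1) by (auto simp: blip_def)
  obtain E where E: "\<And>x. x \<in> D \<Longrightarrow> norm (g x) \<le> E" "\<And>x y. x \<in> D \<Longrightarrow> y \<in> D \<Longrightarrow> norm (g x - g y) \<le> E * norm (x - y)"
    using assms(2) by (auto simp: blip_def)
  show ?thesis
  proof (rule blipI)
    fix x y assume x: "x \<in> D" and y: "y \<in> D"
    show "norm (f x + g x) \<le> C + E" by (rule order_trans[OF norm_triangle_ineq add_mono[OF C(1)[OF x] E(1)[OF x]]])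
    have "f x + g x - (f y + g y) = (f x - f y) + (g x - g y)" by simp
    also have "norm \<dots> \<le> C * norm (x - y) + E * norm (x - y)"
      by (rule order_trans[OF norm_triangle_ineq add_mono[OF C(2)[OF x y] E(2)[OF x y]]])
    finally show "norm (f x + g x - (f y + g y)) \<le> (C + E) * norm (x - y)" by (simp add: distrib_right)
  qed
qed

lemma blip_const: "blip D (\<lambda>x. c)"
  by (rule blipI[where C="norm c" and L=0]) auto

lemma blip_sum:
  assumes "\<And>i. i \<in> I \<Longrightarrow> blip D (f i)" shows "blip D (\<lambda>x. \<Sum>i\<in>I. f i x)"
  using assms by (induction I rule: infinite_finite_induct) (auto intro!: blip_const blip_add)

lemma blip_scaleR: "blip D f \<Longrightarrow> blip D (\<lambda>x. c *\<^sub>R f x)"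
  by (rule blip_linear[OF bounded_linear_scaleR_right])

lemma blip_uminus: "blip D f \<Longrightarrow> blip D (\<lambda>x. - f x)"
  using blip_scaleR[of D f "-1"] by simp

lemma blip_diff: "blip D f \<Longrightarrow> blip D g \<Longrightarrow> blip D (\<lambda>x. f x - g x)"
  using blip_add[of D f "\<lambda>x. - g x"] blip_uminus[of D g] by simp

lemma blip_Pair:
  assumes "blip D f" "blip D g" shows "blip D (\<lambda>x. (f x, g x))"
proof -
  have 1: "bounded_linear (\<lambda>a. (a, 0))" by (intro bounded_linear_Pair bounded_linear_ident bounded_linear_zero)
  have 2: "bounded_linear (\<lambda>a. (0, a))" by (intro bounded_linear_Pair bounded_linear_ident bounded_linear_zero)
  show ?thesis using blip_add[OF blip_linear[OF 1 assms(1)] blip_linear[OF 2 assms(2)]] by simp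
qed

lemma norm_fst_le_norm: "norm (fst y) \<le> norm y"
  and norm_snd_le_norm: "norm (snd y) \<le> norm y"
  using norm_fst_le[of "fst y" "snd y"] norm_snd_le[of "snd y" "fst y"] by simp_all

section \<open>The vector field on the lifted phase space\<close>

type_synonym phase = "(cfg, complex) l2 \<times> (real^3, real^3) l2 \<times> (real^3, real^3) l2"

definition rot :: "nat \<Rightarrow> real \<Rightarrow> phase \<Rightarrow> phase" where
  "rot N s y = (W N s (fst y), snd y)"

lemma norm_rot [simp]: "norm (rot N s y) = norm y"
  by (simp add: rot_def norm_prod_def)

lemma rot_diff: "rot N s y - rot N s z = rot N s (y - z)"
  by (simp add: rot_def W_diff)

lemma continuous_rot: "continuous_on UNIV (\<lambda>z. rot N (fst z) (snd z))"
  unfolding rot_def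
  by (intro continuous_intros continuous_on_compose2[OF continuous_W, where f="\<lambda>z. (fst z, fst (snd z))", simplified])

text \<open>The displacement component is unrestricted: the field depends on it through translates
  of the ion density, whose bounds are uniform.\<close>

definition dom :: "real \<Rightarrow> phase set" where
  "dom b = {y. norm (fst y) \<le> b \<and> norm (snd (snd y)) \<le> b}"

locale spn_dyn = spn +
  fixes M :: real
  assumes M: "0 < M" and e: "0 < e"
begin

text \<open>The force written as a sum over coordinate axes, a form to which the closure rules for
  \<open>blip\<close> apply directly.\<close>

definition gforce :: "(cfg, complex) l2 \<Rightarrow> (real^3 \<Rightarrow> real^3) \<Rightarrow> real^3 \<Rightarrow> real^3" where
  "gforce u q n = (\<Sum>k\<in>UNIV. (real N ^ 3 * Re (l2_apply (grad_op N (rhat u q) (sg (n + q n))) k)) *\<^sub>R axis k 1)"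

text \<open>The right-hand side with the Laplacian left out. The sequence space has real scalars
  only, so multiplication by the imaginary unit enters as the isometry \<open>mult_l2\<close>.
  Displacements stand for arbitrary lifts.\<close>

definition field :: "phase \<Rightarrow> phase" where
  "field y = (e *\<^sub>R mult_l2 (\<lambda>_. \<i>) (\<Sum>j<N^3. mul_op N j (rhat (fst y) (l2_apply (fst (snd y)))) (fst y)),
     (1 / M) *\<^sub>R snd (snd y),
     - (\<Sum>n\<in>Gam N. single_l2 n (gforce (fst y) (l2_apply (fst (snd y))) n)))"

lemma blip_field: "blip (dom b) field"
proof -
  have u: "blip (dom b) fst"
    by (rule blipI[where C=b and L=1]) (auto simp: dom_def intro: order_trans[OF norm_fst_le] simp flip: fst_diff)
  have p: "blip (dom b) (\<lambda>y. snd (snd y))"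
  proof (rule blipI[where C=b and L=1])
    fix x y :: phase
    show "norm (snd (snd x) - snd (snd y)) \<le> 1 * norm (x - y)"
      using norm_snd_le_norm[of "snd (x - y)"] norm_snd_le_norm[of "x - y"] by simp
  qed (auto simp: dom_def)
  have s: "blip (dom b) (\<lambda>y. sg (n + l2_apply (fst (snd y)) n))" for n
  proof (rule blipI[where C=B and L=B])
    fix x y :: phase
    have "norm (sg (n + l2_apply (fst (snd x)) n) - sg (n + l2_apply (fst (snd y)) n)) \<le> B * norm (l2_apply (fst (snd x) - fst (snd y)) n)"
      using sg_lipschitz[of "n + l2_apply (fst (snd x)) n" "n + l2_apply (fst (snd y)) n"] by simp
    also have "\<dots> \<le> B * norm (x - y)"
    proof (rule mult_left_mono[OF _ B])
      have "norm (l2_apply (fst (snd x) - fst (snd y)) n) \<le> norm (fst (snd x) - fst (snd y))" by (rule norm_l2_apply_le)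
      also have "\<dots> \<le> norm (x - y)"
        using norm_fst_le_norm[of "snd (x - y)"] norm_snd_le_norm[of "x - y"] by simp
      finally show "norm (l2_apply (fst (snd x) - fst (snd y)) n) \<le> norm (x - y)" .
    qed
    finally show "norm (sg (n + l2_apply (fst (snd x)) n) - sg (n + l2_apply (fst (snd y)) n)) \<le> B * norm (x - y)" .
  qed (rule norm_sg)
  have r: "blip (dom b) (\<lambda>y. rhat (fst y) (l2_apply (fst (snd y))))"
    unfolding rhat_def
    by (intro blip_diff blip_sum blip_scaleR s blip_bilinear[OF bounded_bilinear_den_op[OF N]] u) auto
  have g: "blip (dom b) (\<lambda>y. gforce (fst y) (l2_apply (fst (snd y))) n)" for n
  proof -
    have lin: "bounded_linear (\<lambda>v. (real N ^ 3 * Re (l2_apply v k)) *\<^sub>R (axis k 1 :: real^3))" for k :: 3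
      by (intro bounded_linear_scaleR_const bounded_linear_const_mult bounded_linear_compose[OF bounded_linear_Re bounded_linear_l2_apply])
    show ?thesis unfolding gforce_def
      by (intro blip_sum blip_linear[OF lin] blip_bilinear[OF bounded_bilinear_grad_op[OF N]] r s)
  qed
  have i: "bounded_linear (mult_l2 (\<lambda>_::cfg. \<i>))" by (rule bounded_linear_mult_l2) simp
  show ?thesis unfolding field_def
    by (intro blip_Pair blip_scaleR blip_uminus blip_sum blip_linear[OF i] blip_linear[OF bounded_linear_single_l2]
        blip_bilinear[OF bounded_bilinear_mul_op[OF N]] r u p g) auto
qed

text \<open>Every point has a unit ball inside some \<open>dom b\<close>, and there the Lipschitz
  bound gives continuity; \<open>picard\<close> asks for it on the whole space.\<close>

lemma continuous_field: "continuous_on UNIV field"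
proof (rule continuous_at_imp_continuous_on, intro ballI)
  fix x :: phase
  define b where "b = norm x + 1"
  obtain K where K: "0 \<le> K" "\<And>y z. y \<in> dom b \<Longrightarrow> z \<in> dom b \<Longrightarrow> norm (field y - field z) \<le> K * norm (y - z)"
    using blip_field[of b] unfolding blip_def by blast
  have "K-lipschitz_on (dom b) field"
    using K by (intro lipschitz_onI) (auto simp: dist_norm)
  then have "continuous_on (dom b) field" by (rule lipschitz_on_continuous_on)
  moreover have "ball x 1 \<subseteq> dom b"
  proof
    fix y assume "y \<in> ball x 1"
    then have "norm y \<le> b" using norm_triangle_ineq2[of y x] by (simp add: b_def dist_norm norm_minus_commute)
    then show "y \<in> dom b"
      using norm_fst_le_norm[of y] norm_snd_le_norm[of y] norm_snd_le_norm[of "snd y"]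
      by (simp add: dom_def)
  qed
  ultimately have "continuous_on (ball x 1) field" by (rule continuous_on_subset)
  then show "continuous (at x) field" by (simp add: continuous_on_eq_continuous_at)
qed

definition vf :: "real \<Rightarrow> phase \<Rightarrow> phase" where
  "vf s y = rot N (- s) (field (rot N s y))"

lemma continuous_vf: "continuous_on UNIV (\<lambda>z. vf (fst z) (snd z))"
proof -
  have "continuous_on UNIV (\<lambda>z. field (rot N (fst z) (snd z)))"
    by (rule continuous_on_compose2[OF continuous_field continuous_rot]) auto
  then have "continuous_on UNIV (\<lambda>z. (- fst z, field (rot N (fst z) (snd z))))"
    by (intro continuous_intros)
  from continuous_on_compose2[OF continuous_rot this] show ?thesis by (simp add: vf_def)
qed

lemma picard_vf:
  obtains \<tau> K where "0 < \<tau>" "picard vf (dom b) \<tau> K K"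
proof -
  obtain K where K: "0 \<le> K" "\<And>y. y \<in> dom b \<Longrightarrow> norm (field y) \<le> K"
    "\<And>y z. y \<in> dom b \<Longrightarrow> z \<in> dom b \<Longrightarrow> norm (field y - field z) \<le> K * norm (y - z)"
    using blip_field[of b] unfolding blip_def by blast
  have rot: "rot N s y \<in> dom b" if "y \<in> dom b" for s y
    using that by (simp add: dom_def rot_def)
  \<comment> \<open>This makes \<open>\<tau> * K\<close> less than one half, which serves both
    smallness conditions; adding 1 covers \<open>K = 0\<close>. Since \<open>K\<close> comes from
    \<open>dom b\<close>, the time depends on the initial data only through
    \<open>b\<close>.\<close>
  define \<tau> where "\<tau> = 1 / (2 * (K + 1))"
  have "picard vf (dom b) \<tau> K K"
  proof
    show "0 < \<tau>" "0 \<le> K" "\<tau> * K < 1" "\<tau> * K \<le> 1 / 2" using K(1) by (auto simp: \<tau>_def field_simps)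
    show "continuous_on UNIV (\<lambda>z. vf (fst z) (snd z))" by (rule continuous_vf)
    show "norm (vf s y) \<le> K" if "y \<in> dom b" for s y using K(2)[OF rot[OF that]] by (simp add: vf_def)
    show "norm (vf s y - vf s z) \<le> K * norm (y - z)" if "y \<in> dom b" "z \<in> dom b" for s y z
      using K(3)[OF rot[OF that(1), of s] rot[OF that(2), of s]] by (simp add: vf_def rot_diff)
  qed
  moreover have "0 < \<tau>" using K(1) by (simp add: \<tau>_def)
  ultimately show ?thesis using that by blast
qed

lemma admissible_W: "admissible u \<Longrightarrow> admissible (W N s u)"
  by (auto simp: admissible_def csq_permute)

lemma sh_permute:
  assumes "\<pi> permutes {..<N^3}" shows "sh j \<xi> (\<eta> \<circ> \<pi>) = sh (\<pi> j) \<xi> \<eta> \<circ> \<pi>"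
  using permutes_inj[OF assms] by (auto simp: sh_def fun_eq_iff inj_eq)

text \<open>A permutation carries the \<open>j\<close>-th summand into the one for
  \<open>\<pi> j\<close> and brings out the sign, so antisymmetry holds for the sum over all
  particles and not for the single summands.\<close>

lemma admissible_mul_op:
  assumes u: "admissible u"
  shows "admissible (\<Sum>j<N^3. mul_op N j r u)"
  unfolding admissible_def
proof (intro conjI allI impI)
  fix \<eta> assume "\<eta> \<notin> XiC N"
  then show "l2_apply (\<Sum>j<N^3. mul_op N j r u) \<eta> = 0"
    by (simp add: l2_apply_mul_op[OF N] mul_term_def)
next
  fix \<pi> \<eta> assume \<pi>: "\<pi> permutes {..<N^3}" and \<eta>: "\<eta> \<in> XiC N"
  have \<pi>j: "\<pi> j < N^3 \<longleftrightarrow> j < N^3" for j using permutes_in_image[OF \<pi>, of j] by simp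
  have "l2_apply (mul_op N j r u) (\<eta> \<circ> \<pi>) = of_int (sign \<pi>) * l2_apply (mul_op N (\<pi> j) r u) \<eta>" if j: "j < N^3" for j
  proof -
    have "mul_term N j (\<eta> \<circ> \<pi>) \<xi> r u = of_int (sign \<pi>) * mul_term N (\<pi> j) \<eta> \<xi> r u" if \<xi>: "\<xi> \<in> Xi N" for \<xi>
    proof -
      have "sh (\<pi> j) (- \<xi>) \<eta> \<in> XiC N" using \<pi>j j \<xi> \<eta> by (intro sh_XiC Xi_uminus) auto
      then have "l2_apply u (sh (\<pi> j) (- \<xi>) \<eta> \<circ> \<pi>) = of_int (sign \<pi>) * l2_apply u (sh (\<pi> j) (- \<xi>) \<eta>)"
        using u \<pi> by (simp add: admissible_def)
      then show ?thesis
        by (simp add: mul_term_def mul_kernel_def sh_permute[OF \<pi>] \<eta> XiC_permute[OF \<pi> \<eta>] wt_def csq_permute[OF \<pi>])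
    qed
    then have "(\<Sum>\<^sub>\<infinity>\<xi>\<in>Xi N - {0}. mul_term N j (\<eta> \<circ> \<pi>) \<xi> r u) = (\<Sum>\<^sub>\<infinity>\<xi>\<in>Xi N - {0}. of_int (sign \<pi>) * mul_term N (\<pi> j) \<eta> \<xi> r u)"
      by (intro infsum_cong) auto
    then show ?thesis using j \<pi>j by (simp add: l2_apply_mul_op[OF N] infsum_cmult_right')
  qed
  then have "l2_apply (\<Sum>j<N^3. mul_op N j r u) (\<eta> \<circ> \<pi>) = of_int (sign \<pi>) * (\<Sum>j<N^3. l2_apply (mul_op N (\<pi> j) r u) \<eta>)"
    by (simp add: sum_distrib_left)
  also have "(\<Sum>j<N^3. l2_apply (mul_op N (\<pi> j) r u) \<eta>) = (\<Sum>j<N^3. l2_apply (mul_op N j r u) \<eta>)"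
    using sum.permute[OF \<pi>, of "\<lambda>j. l2_apply (mul_op N j r u) \<eta>"] by (simp add: comp_def)
  finally show "l2_apply (\<Sum>j<N^3. mul_op N j r u) (\<eta> \<circ> \<pi>) = of_int (sign \<pi>) * l2_apply (\<Sum>j<N^3. mul_op N j r u) \<eta>"
    by (simp only: l2_apply_sum)
qed

lemma admissible_vf:
  assumes "admissible (fst y)" shows "admissible (fst (vf s y))"
proof -
  have "admissible (\<Sum>j<N^3. mul_op N j (rhat (W N s (fst y)) (l2_apply (fst (snd y)))) (W N s (fst y)))"
    by (intro admissible_mul_op admissible_W assms)
  then have "admissible (e *\<^sub>R mult_l2 (\<lambda>_. \<i>) (\<Sum>j<N^3. mul_op N j (rhat (W N s (fst y)) (l2_apply (fst (snd y)))) (W N s (fst y))))"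
    unfolding admissible_def by (simp add: l2_apply_mult del: l2_apply_sum)
  then show ?thesis by (simp add: vf_def rot_def field_def admissible_W)
qed

end

section \<open>Representation of states\<close>

context spn_dyn
begin

definition pl2 :: "(real^3 \<Rightarrow> real^3) \<Rightarrow> (real^3, real^3) l2" where
  "pl2 p = (\<Sum>n\<in>Gam N. single_l2 n (p n))"

lemma l2_apply_pl2 [simp]: "l2_apply (pl2 p) n = (if n \<in> Gam N then p n else 0)"
  unfolding pl2_def using finite_Gam[of N] by (simp add: sum.delta)

lemma norm_pl2: "norm (pl2 p) = pnorm N p"
proof -
  have "(\<Sum>\<^sub>\<infinity>n. (norm (l2_apply (pl2 p) n))\<^sup>2) = (\<Sum>\<^sub>\<infinity>n\<in>Gam N. (norm (p n))\<^sup>2)"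
    by (rule infsum_cong_neutral) auto
  then show ?thesis by (simp add: norm_l2_def pnorm_def finite_Gam)
qed

lemma pl2_diff: "pl2 p - pl2 p' = pl2 (\<lambda>n. p n - p' n)"
  by (rule l2_eqI) simp

text \<open>The ambiguity of a lift: two points of space represent the same point of the torus when
  their difference satisfies \<open>latt\<close>. The equivalent form \<open>latt_iff\<close> is the
  one in which the displacement equation is posed.\<close>

definition latt :: "real^3 \<Rightarrow> bool" where
  "latt d \<longleftrightarrow> (\<exists>z. (\<forall>i. z$i \<in> \<int>) \<and> d = real N *\<^sub>R z)"

lemma latt_iff: "latt d \<longleftrightarrow> (\<forall>k. \<exists>m::int. d$k = real N * of_int m)"
proof
  assume "latt d"
  then obtain z where z: "\<forall>i. z$i \<in> \<int>" "d = real N *\<^sub>R z" by (auto simp: latt_def)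
  show "\<forall>k. \<exists>m::int. d$k = real N * of_int m"
  proof
    fix k
    obtain m where "z$k = of_int m" using z(1) Ints_cases by metis
    then show "\<exists>m::int. d$k = real N * of_int m" using z(2) by auto
  qed
next
  assume "\<forall>k. \<exists>m::int. d$k = real N * of_int m"
  from choice[OF this] obtain m where m: "\<And>k. d$k = real N * of_int (m k)" by blast
  show "latt d" unfolding latt_def
    by (rule exI[of _ "\<chi> k. of_int (m k)"]) (simp add: vec_eq_iff m)
qed

lemma latt_0 [simp]: "latt 0"
  by (auto simp: latt_def intro!: exI[of _ 0])

lemma latt_diff: "latt a \<Longrightarrow> latt b \<Longrightarrow> latt (a - b)"
proof -
  assume "latt a" "latt b"
  then obtain x y where "\<forall>i. x$i \<in> \<int>" "a = real N *\<^sub>R x" "\<forall>i. y$i \<in> \<int>" "b = real N *\<^sub>R y"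
    by (auto simp: latt_def)
  then show ?thesis unfolding latt_def
    by (intro exI[of _ "x - y"]) (auto simp: scaleR_diff_right)
qed

lemma sg_cong: "latt (a - b) \<Longrightarrow> sg a = sg b"
proof -
  assume "latt (a - b)"
  then obtain z where z: "\<forall>i. z$i \<in> \<int>" "a - b = real N *\<^sub>R z" by (auto simp: latt_def)
  then have "a = b + real N *\<^sub>R z" by (simp add: algebra_simps)
  then show ?thesis using sg_periodic[OF z(1)] by simp
qed

lemma rhat_cong: "(\<And>n. n \<in> Gam N \<Longrightarrow> latt (q n - q' n)) \<Longrightarrow> rhat u q = rhat u q'"
  unfolding rhat_def by (intro arg_cong2[where f=minus] sum.cong refl sg_cong) simp

lemma gforce_cong:
  assumes "\<And>n. n \<in> Gam N \<Longrightarrow> latt (q n - q' n)" "n \<in> Gam N"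
  shows "gforce u q n = gforce u q' n"
proof -
  have "sg (n + q n) = sg (n + q' n)" using assms by (intro sg_cong) simp
  then show ?thesis unfolding gforce_def using rhat_cong[of q q' u] assms(1) by simp
qed

lemma gforce_eq_force: "H1 (psi X) \<Longrightarrow> gforce (emb (psi X)) (qq X) n = force N e \<sigma> X n"
  unfolding gforce_def force_eq
  by (simp add: vec_eq_iff axis_def if_distrib[of "\<lambda>t. _ * t"] cong: if_cong)

lemma tdist_bdd: "bdd_below {norm (a - b - real N *\<^sub>R k) | k. \<forall>i. k$i \<in> \<int>}"
  by (rule bdd_belowI[of _ 0]) auto

lemma tdist_le: "latt d \<Longrightarrow> tdist N a b \<le> norm (a - b - d)"
  unfolding tdist_def by (rule cInf_lower[OF _ tdist_bdd]) (auto simp: latt_def)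

lemma tdist_nonneg: "0 \<le> tdist N a b"
  unfolding tdist_def by (rule cInf_greatest) (auto intro!: exI[of _ 0])

lemma tdist_lessD: "tdist N a b < \<delta> \<Longrightarrow> \<exists>d. latt d \<and> norm (a - b - d) < \<delta>"
proof -
  assume less: "tdist N a b < \<delta>"
  have "{norm (a - b - real N *\<^sub>R k) | k. \<forall>i. k$i \<in> \<int>} \<noteq> {}" by (auto intro!: exI[of _ 0])
  from cInf_lessD[OF this less[unfolded tdist_def]]
  obtain k where "\<forall>i. k$i \<in> \<int>" "norm (a - b - real N *\<^sub>R k) < \<delta>" by auto
  then show ?thesis by (auto simp: latt_def)
qed

lemma normF_nonneg: "0 \<le> normF N \<psi>"
  unfolding normF_def L2norm2_def gradnorm2_def
  by (intro real_sqrt_ge_zero add_nonneg_nonneg mult_nonneg_nonneg infsum_nonneg) (auto simp: csq_def sum_nonneg)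

lemma qdist_nonneg: "0 \<le> qdist N q q'"
  unfolding qdist_def by (simp add: sum_nonneg)

lemma pnorm_nonneg: "0 \<le> pnorm N p"
  unfolding pnorm_def by (simp add: sum_nonneg)

lemma dV_nonneg: "0 \<le> dV N X X'"
  unfolding dV_def by (intro add_nonneg_nonneg normF_nonneg qdist_nonneg pnorm_nonneg)

lemma V_ge_1: "1 \<le> sqrt V"
  using N by (simp add: one_le_power)

lemma normF_diff: "inF N \<psi> \<Longrightarrow> inF N \<phi> \<Longrightarrow> normF N (\<lambda>x. \<psi> x - \<phi> x) = sqrt V * norm (emb \<psi> - emb \<phi>)"
  by (simp add: inF_H1 normF_emb[OF H1_diff(1)] H1_diff(2))

text \<open>A point of the Hilbert space represents a state if it carries its Fourier coefficients in the
  interaction picture, a lift of the ion displacements from the torus to space, and the momenta.\<close>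

definition rel :: "state \<Rightarrow> real \<Rightarrow> phase \<Rightarrow> bool" where
  "rel X t y \<longleftrightarrow> inF N (psi X) \<and> emb (psi X) = W N t (fst y) \<and>
    (\<forall>n\<in>Gam N. latt (qq X n - l2_apply (fst (snd y)) n) \<and> pp X n = l2_apply (snd (snd y)) n)"

text \<open>The two times may differ, as continuity in time requires; then the propagators do not
  cancel. At equal times they do, because \<open>W\<close> is isometric, which gives
  \<open>dV_le_same_time\<close>.\<close>

lemma dV_le:
  assumes X: "rel X t y" and X': "rel X' t' y'"
  shows "dV N X X' \<le> sqrt V * norm (W N t (fst y) - W N t' (fst y')) + norm (fst (snd y) - fst (snd y'))
     + norm (snd (snd y) - snd (snd y'))"
  unfolding dV_def
proof (intro add_mono)
  show "normF N (\<lambda>x. psi X x - psi X' x) \<le> sqrt V * norm (W N t (fst y) - W N t' (fst y'))"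
    using X X' normF_diff[of "psi X" "psi X'"] by (simp add: rel_def)
  have "tdist N (qq X n) (qq X' n) \<le> norm (l2_apply (fst (snd y) - fst (snd y')) n)" if "n \<in> Gam N" for n
  proof -
    have "latt ((qq X n - l2_apply (fst (snd y)) n) - (qq X' n - l2_apply (fst (snd y')) n))"
      by (rule latt_diff) (use X X' that in \<open>auto simp: rel_def\<close>)
    from tdist_le[OF this, of "qq X n" "qq X' n"] show ?thesis by (simp add: algebra_simps)
  qed
  then have "(\<Sum>n\<in>Gam N. (tdist N (qq X n) (qq X' n))\<^sup>2) \<le> (\<Sum>n\<in>Gam N. (norm (l2_apply (fst (snd y) - fst (snd y')) n))\<^sup>2)"
    by (intro sum_mono power_mono tdist_nonneg) auto
  also have "\<dots> \<le> (norm (fst (snd y) - fst (snd y')))\<^sup>2" by (rule l2_sum_le[OF finite_Gam])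
  finally show "qdist N (qq X) (qq X') \<le> norm (fst (snd y) - fst (snd y'))"
    unfolding qdist_def by (simp add: real_le_lsqrt sum_nonneg)
  have "(\<Sum>n\<in>Gam N. (norm (pp X n - pp X' n))\<^sup>2) = (\<Sum>n\<in>Gam N. (norm (l2_apply (snd (snd y) - snd (snd y')) n))\<^sup>2)"
    using X X' by (intro sum.cong) (auto simp: rel_def)
  also have "\<dots> \<le> (norm (snd (snd y) - snd (snd y')))\<^sup>2" by (rule l2_sum_le[OF finite_Gam])
  finally show "pnorm N (\<lambda>n. pp X n - pp X' n) \<le> norm (snd (snd y) - snd (snd y'))"
    unfolding pnorm_def by (simp add: real_le_lsqrt sum_nonneg)
qed

lemma dV_le_same_time:
  assumes X: "rel X t y" and X': "rel X' t y'"
  shows "dV N X X' \<le> (sqrt V + 2) * norm (y - y')"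
proof -
  have 1: "norm (fst y - fst y') \<le> norm (y - y')" using norm_fst_le_norm[of "y - y'"] by simp
  have 2: "norm (snd y - snd y') \<le> norm (y - y')" using norm_snd_le_norm[of "y - y'"] by simp
  have 3: "norm (fst (snd y) - fst (snd y')) \<le> norm (y - y')" using norm_fst_le_norm[of "snd y - snd y'"] 2 by simp
  have 4: "norm (snd (snd y) - snd (snd y')) \<le> norm (y - y')" using norm_snd_le_norm[of "snd y - snd y'"] 2 by simp
  have "dV N X X' \<le> sqrt V * norm (fst y - fst y') + norm (fst (snd y) - fst (snd y')) + norm (snd (snd y) - snd (snd y'))"
    using dV_le[OF X X'] unfolding W_diff norm_W .
  also have "\<dots> \<le> sqrt V * norm (y - y') + norm (y - y') + norm (y - y')"
    using 1 3 4 V_ge_1 by (intro add_mono mult_left_mono) auto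
  finally show ?thesis by (simp add: algebra_simps)
qed

lemma field_fst:
  assumes X: "rel X t y" and \<eta>: "\<eta> \<in> XiC N"
  shows "l2_apply (fst (vf t y)) \<eta> = cis (t * csq N \<eta> / 2) *
    (\<i> * complex_of_real e * (complex_of_real (sqrt (wt N \<eta>)) * fcoef N (mulPhi N (Phi N e \<sigma> X) (psi X)) \<eta>))"
proof -
  have h: "H1 (psi X)" using X by (simp add: rel_def inF_H1)
  have r: "rhat (emb (psi X)) (l2_apply (fst (snd y))) = rhat (emb (psi X)) (qq X)"
    using X by (intro rhat_cong[symmetric]) (auto simp: rel_def)
  have u: "W N t (fst y) = emb (psi X)" using X by (simp add: rel_def)
  have "l2_apply (fst (vf t y)) \<eta> = cis (t * csq N \<eta> / 2) *
      (e *\<^sub>R (\<i> * l2_apply (\<Sum>j<N^3. mul_op N j (rhat (emb (psi X)) (qq X)) (emb (psi X))) \<eta>))"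
    by (simp add: vf_def rot_def field_def u r l2_apply_mult)
  also have "\<dots> = cis (t * csq N \<eta> / 2) *
    (\<i> * complex_of_real e * (complex_of_real (sqrt (wt N \<eta>)) * fcoef N (mulPhi N (Phi N e \<sigma> X) (psi X)) \<eta>))"
    unfolding fcoef_mulPhi[OF h \<eta>] by (simp add: scaleR_conv_of_real mult_ac)
  finally show ?thesis .
qed

lemma field_snd: "fst (snd (vf t y)) = (1 / M) *\<^sub>R snd (snd y)"
  by (simp add: vf_def rot_def field_def)

lemma field_thd:
  assumes X: "rel X t y"
  shows "l2_apply (snd (snd (vf t y))) n = (if n \<in> Gam N then - force N e \<sigma> X n else 0)"
proof -
  have h: "H1 (psi X)" using X by (simp add: rel_def inF_H1)
  have u: "W N t (fst y) = emb (psi X)" using X by (simp add: rel_def)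
  have "gforce (emb (psi X)) (l2_apply (fst (snd y))) n = force N e \<sigma> X n" if "n \<in> Gam N" for n
    using X that gforce_cong[of "qq X" "l2_apply (fst (snd y))" n "emb (psi X)"] gforce_eq_force[OF h, of n]
    by (auto simp: rel_def)
  moreover have "snd (snd (vf t y)) = - pl2 (gforce (emb (psi X)) (l2_apply (fst (snd y))))"
    by (simp add: vf_def rot_def field_def u pl2_def)
  ultimately show ?thesis by simp
qed

lemma bounded_linear_coord1: "bounded_linear (\<lambda>y::phase. l2_apply (fst y) \<eta>)"
  by (rule bounded_linear_compose[OF bounded_linear_l2_apply bounded_linear_fst])

lemma bounded_linear_coord2: "bounded_linear (\<lambda>y::phase. l2_apply (fst (snd y)) n)"
  by (rule bounded_linear_compose[OF bounded_linear_l2_apply bounded_linear_compose[OF bounded_linear_fst bounded_linear_snd]])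

lemma bounded_linear_coord3: "bounded_linear (\<lambda>y::phase. l2_apply (snd (snd y)) n)"
  by (rule bounded_linear_compose[OF bounded_linear_l2_apply bounded_linear_compose[OF bounded_linear_snd bounded_linear_snd]])

lemma continuous_on_vf: "continuous_on A y \<Longrightarrow> continuous_on A (\<lambda>s. vf s (y s))"
  using continuous_on_compose2[OF continuous_vf, of A "\<lambda>s. (s, y s)"] by (simp add: continuous_on_Pair continuous_on_id)

section \<open>Duhamel integrals as coordinates of the integral equation\<close>

context
  fixes T :: real and X :: "real \<Rightarrow> state" and y :: "real \<Rightarrow> phase"
  assumes T: "0 < T" and cont: "continuous_on {-T..T} y" and rel: "\<And>t. t \<in> {-T..T} \<Longrightarrow> rel (X t) t (y t)"
begin

text \<open>Up to the nonzero constant \<open>k\<close>, the Duhamel integrand is the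
  \<open>\<eta>\<close>-coordinate of the vector field along the curve. Dividing by \<open>k\<close>
  turns continuity of the field into continuity, and hence integrability, of the integrand.\<close>

lemma psi_integral:
  assumes t: "t \<in> {-T..T}" and \<eta>: "\<eta> \<in> XiC N"
  shows "interval_lebesgue_integrable lborel (ereal 0) (ereal t)
      (\<lambda>s. cis (- ((t - s) * csq N \<eta> / 2)) * fcoef N (mulPhi N (Phi N e \<sigma> (X s)) (psi (X s))) \<eta>)"
    and "l2_apply (fst (oint T (\<lambda>s. vf s (y s)) t)) \<eta> = cis (t * csq N \<eta> / 2) * complex_of_real (sqrt (wt N \<eta>)) *
      (\<i> * complex_of_real e * interval_lebesgue_integral lborel (ereal 0) (ereal t)
      (\<lambda>s. cis (- ((t - s) * csq N \<eta> / 2)) * fcoef N (mulPhi N (Phi N e \<sigma> (X s)) (psi (X s))) \<eta>))"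
proof -
  define h where "h = (\<lambda>s. cis (- ((t - s) * csq N \<eta> / 2)) * fcoef N (mulPhi N (Phi N e \<sigma> (X s)) (psi (X s))) \<eta>)"
  define k where "k = cis (t * csq N \<eta> / 2) * complex_of_real (sqrt (wt N \<eta>)) * (\<i> * complex_of_real e)"
  have k: "k \<noteq> 0" using e by (simp add: k_def)
  have kh: "k * h s = l2_apply (fst (vf s (y s))) \<eta>" if "s \<in> {-T..T}" for s
  proof -
    have "cis (t * csq N \<eta> / 2) * cis (- ((t - s) * csq N \<eta> / 2)) = cis (s * csq N \<eta> / 2)"
      by (simp add: cis_mult) (simp add: algebra_simps diff_divide_distrib)
    moreover have "k * h s = (cis (t * csq N \<eta> / 2) * cis (- ((t - s) * csq N \<eta> / 2))) *
        (complex_of_real (sqrt (wt N \<eta>)) * (\<i> * complex_of_real e) * fcoef N (mulPhi N (Phi N e \<sigma> (X s)) (psi (X s))) \<eta>)"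
      unfolding k_def h_def by (simp only: mult_ac)
    ultimately have "k * h s = cis (s * csq N \<eta> / 2) * (complex_of_real (sqrt (wt N \<eta>)) * (\<i> * complex_of_real e) * fcoef N (mulPhi N (Phi N e \<sigma> (X s)) (psi (X s))) \<eta>)"
      by (simp only:)
    then show ?thesis unfolding field_fst[OF rel[OF that] \<eta>] by (simp add: mult_ac)
  qed
  have c1: "continuous_on {-T..T} (\<lambda>s. l2_apply (fst (vf s (y s))) \<eta>)"
    by (rule bounded_linear.continuous_on[OF bounded_linear_coord1 continuous_on_vf[OF cont]])
  have "continuous_on {-T..T} (\<lambda>s. l2_apply (fst (vf s (y s))) \<eta> / k)"
    using k by (intro continuous_intros c1) auto
  then have ch: "continuous_on {-T..T} h"
    by (rule continuous_on_eq) (use kh k in \<open>auto simp flip: kh\<close>)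
  show "interval_lebesgue_integrable lborel (ereal 0) (ereal t)
      (\<lambda>s. cis (- ((t - s) * csq N \<eta> / 2)) * fcoef N (mulPhi N (Phi N e \<sigma> (X s)) (psi (X s))) \<eta>)"
    unfolding h_def[symmetric] by (rule interval_integral_eq_oint(1)[OF less_imp_le[OF T] ch t])
  have "l2_apply (fst (oint T (\<lambda>s. vf s (y s)) t)) \<eta> = oint T (\<lambda>s. l2_apply (fst (vf s (y s))) \<eta>) t"
    by (rule bounded_linear_oint[OF less_imp_le[OF T] continuous_on_vf[OF cont] bounded_linear_coord1 t])
  also have "\<dots> = oint T (\<lambda>s. k * h s) t"
    unfolding oint_def using kh t T by (intro arg_cong2[where f=minus] integral_cong) auto
  also have "\<dots> = k * oint T h t"
    by (rule bounded_linear_oint[OF less_imp_le[OF T] ch bounded_linear_mult_right t, symmetric])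
  also have "oint T h t = interval_lebesgue_integral lborel (ereal 0) (ereal t) h"
    by (rule interval_integral_eq_oint(2)[OF less_imp_le[OF T] ch t, symmetric])
  finally show "l2_apply (fst (oint T (\<lambda>s. vf s (y s)) t)) \<eta> = cis (t * csq N \<eta> / 2) * complex_of_real (sqrt (wt N \<eta>)) *
      (\<i> * complex_of_real e * interval_lebesgue_integral lborel (ereal 0) (ereal t)
      (\<lambda>s. cis (- ((t - s) * csq N \<eta> / 2)) * fcoef N (mulPhi N (Phi N e \<sigma> (X s)) (psi (X s))) \<eta>))"
    unfolding h_def[symmetric] by (simp only: k_def mult_ac)
qed

lemma pp_integral:
  assumes t: "t \<in> {-T..T}" and n: "n \<in> Gam N"
  shows "interval_lebesgue_integrable lborel (ereal 0) (ereal t) (\<lambda>s. pp (X s) n)"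
    and "l2_apply (fst (snd (oint T (\<lambda>s. vf s (y s)) t))) n =
      (1 / M) *\<^sub>R interval_lebesgue_integral lborel (ereal 0) (ereal t) (\<lambda>s. pp (X s) n)"
proof -
  have pe: "pp (X s) n = l2_apply (snd (snd (y s))) n" if "s \<in> {-T..T}" for s
    using rel[OF that] n by (simp add: rel_def)
  have cp: "continuous_on {-T..T} (\<lambda>s. pp (X s) n)"
    by (rule continuous_on_eq[OF bounded_linear.continuous_on[OF bounded_linear_coord3 cont]]) (simp add: pe)
  show "interval_lebesgue_integrable lborel (ereal 0) (ereal t) (\<lambda>s. pp (X s) n)"
    by (rule interval_integral_eq_oint(1)[OF less_imp_le[OF T] cp t])
  have "l2_apply (fst (snd (oint T (\<lambda>s. vf s (y s)) t))) n = oint T (\<lambda>s. l2_apply (fst (snd (vf s (y s)))) n) t"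
    by (rule bounded_linear_oint[OF less_imp_le[OF T] continuous_on_vf[OF cont] bounded_linear_coord2 t])
  also have "\<dots> = oint T (\<lambda>s. (1 / M) *\<^sub>R pp (X s) n) t"
    unfolding oint_def using pe t T by (intro arg_cong2[where f=minus] integral_cong) (auto simp: field_snd)
  also have "\<dots> = (1 / M) *\<^sub>R oint T (\<lambda>s. pp (X s) n) t"
    by (rule bounded_linear_oint[OF less_imp_le[OF T] cp bounded_linear_scaleR_right t, symmetric])
  also have "oint T (\<lambda>s. pp (X s) n) t = interval_lebesgue_integral lborel (ereal 0) (ereal t) (\<lambda>s. pp (X s) n)"
    by (rule interval_integral_eq_oint(2)[OF less_imp_le[OF T] cp t, symmetric])
  finally show "l2_apply (fst (snd (oint T (\<lambda>s. vf s (y s)) t))) n =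
      (1 / M) *\<^sub>R interval_lebesgue_integral lborel (ereal 0) (ereal t) (\<lambda>s. pp (X s) n)" .
qed

lemma force_integral:
  assumes t: "t \<in> {-T..T}" and n: "n \<in> Gam N"
  shows "interval_lebesgue_integrable lborel (ereal 0) (ereal t) (\<lambda>s. force N e \<sigma> (X s) n)"
    and "l2_apply (snd (snd (oint T (\<lambda>s. vf s (y s)) t))) n =
      - interval_lebesgue_integral lborel (ereal 0) (ereal t) (\<lambda>s. force N e \<sigma> (X s) n)"
proof -
  have fe: "- l2_apply (snd (snd (vf s (y s)))) n = force N e \<sigma> (X s) n" if "s \<in> {-T..T}" for s
    using field_thd[OF rel[OF that], of n] n by simp
  have cv: "continuous_on {-T..T} (\<lambda>s. l2_apply (snd (snd (vf s (y s)))) n)"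
    by (rule bounded_linear.continuous_on[OF bounded_linear_coord3 continuous_on_vf[OF cont]])
  have cf: "continuous_on {-T..T} (\<lambda>s. force N e \<sigma> (X s) n)"
    by (rule continuous_on_eq[OF continuous_on_minus[OF cv]]) (simp add: fe)
  show "interval_lebesgue_integrable lborel (ereal 0) (ereal t) (\<lambda>s. force N e \<sigma> (X s) n)"
    by (rule interval_integral_eq_oint(1)[OF less_imp_le[OF T] cf t])
  have "l2_apply (snd (snd (oint T (\<lambda>s. vf s (y s)) t))) n = oint T (\<lambda>s. l2_apply (snd (snd (vf s (y s)))) n) t"
    by (rule bounded_linear_oint[OF less_imp_le[OF T] continuous_on_vf[OF cont] bounded_linear_coord3 t])
  also have "\<dots> = oint T (\<lambda>s. - force N e \<sigma> (X s) n) t"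
    unfolding oint_def using t T by (intro arg_cong2[where f=minus] integral_cong) (auto simp flip: fe)
  also have "\<dots> = - oint T (\<lambda>s. force N e \<sigma> (X s) n) t"
    by (rule bounded_linear_oint[OF less_imp_le[OF T] cf bounded_linear_minus[OF bounded_linear_ident] t, symmetric])
  also have "oint T (\<lambda>s. force N e \<sigma> (X s) n) t = interval_lebesgue_integral lborel (ereal 0) (ereal t) (\<lambda>s. force N e \<sigma> (X s) n)"
    by (rule interval_integral_eq_oint(2)[OF less_imp_le[OF T] cf t, symmetric])
  finally show "l2_apply (snd (snd (oint T (\<lambda>s. vf s (y s)) t))) n =
      - interval_lebesgue_integral lborel (ereal 0) (ereal t) (\<lambda>s. force N e \<sigma> (X s) n)" .
qed

end

end

section \<open>Local well-posedness\<close>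

context spn_dyn
begin

lemma oint_0: "oint T g 0 = 0"
  by (simp add: oint_def)

text \<open>A solution prescribes displacements only modulo the lattice, so a continuous lift is
  produced by integrating the momenta from a starting point \<open>q0\<close>. Any representative of
  the initial displacement is allowed, since a second solution may be close to the first only for
  one particular representative.\<close>

lemma solution_imp_integral_equation:
  assumes T: "0 < T" and sol: "is_solution N e M \<sigma> {-T..T} X"
    and q0: "\<And>n. n \<in> Gam N \<Longrightarrow> latt (q0 n - qq (X 0) n)"
  obtains y where "continuous_on {-T..T} y" "\<And>t. t \<in> {-T..T} \<Longrightarrow> rel (X t) t (y t)"
    "\<And>t. t \<in> {-T..T} \<Longrightarrow> y t = (emb (psi (X 0)), pl2 q0, pl2 (pp (X 0))) + oint T (\<lambda>s. vf s (y s)) t"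
proof -
  have inF: "inF N (psi (X t))" if "t \<in> {-T..T}" for t
    using sol that by (auto simp: is_solution_def inV_def)
  have cX: "\<exists>\<delta>>0. \<forall>s\<in>{-T..T}. \<bar>s - t\<bar> < \<delta> \<longrightarrow> dV N (X s) (X t) < \<epsilon>" if "t \<in> {-T..T}" "\<epsilon> > 0" for t \<epsilon>
    using sol that unfolding is_solution_def by blast
  have duhamel: "fcoef N (psi (X t)) \<eta> = cis (- (t * csq N \<eta> / 2)) * fcoef N (psi (X 0)) \<eta>
        + \<i> * complex_of_real e * interval_lebesgue_integral lborel (ereal 0) (ereal t)
          (\<lambda>s. cis (- ((t - s) * csq N \<eta> / 2)) * fcoef N (mulPhi N (Phi N e \<sigma> (X s)) (psi (X s))) \<eta>)"
    if "t \<in> {-T..T}" "\<eta> \<in> XiC N" for t \<eta>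
    using sol that unfolding is_solution_def by blast
  have qeq: "latt (qq (X t) n - qq (X 0) n - (1 / M) *\<^sub>R interval_lebesgue_integral lborel (ereal 0) (ereal t) (\<lambda>s. pp (X s) n))"
    if "t \<in> {-T..T}" "n \<in> Gam N" for t n
    using sol that unfolding is_solution_def latt_iff by blast
  have peq: "pp (X t) n = pp (X 0) n - interval_lebesgue_integral lborel (ereal 0) (ereal t) (\<lambda>s. force N e \<sigma> (X s) n)"
    if "t \<in> {-T..T}" "n \<in> Gam N" for t n
    using sol that unfolding is_solution_def by blast
  have psi_dist: "norm (emb (psi (X s)) - emb (psi (X t))) \<le> dV N (X s) (X t)"
    and pp_dist: "norm (pl2 (pp (X s)) - pl2 (pp (X t))) \<le> dV N (X s) (X t)"
    if "s \<in> {-T..T}" "t \<in> {-T..T}" for s t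
  proof -
    have "1 * norm (emb (psi (X s)) - emb (psi (X t))) \<le> sqrt V * norm (emb (psi (X s)) - emb (psi (X t)))"
      by (rule mult_right_mono[OF V_ge_1]) simp
    also have "\<dots> = normF N (\<lambda>x. psi (X s) x - psi (X t) x)"
      using normF_diff[OF inF[OF that(1)] inF[OF that(2)]] by simp
    also have "\<dots> \<le> dV N (X s) (X t)"
      unfolding dV_def using qdist_nonneg[of "qq (X s)" "qq (X t)"] pnorm_nonneg[of "\<lambda>n. pp (X s) n - pp (X t) n"] by linarith
    finally show "norm (emb (psi (X s)) - emb (psi (X t))) \<le> dV N (X s) (X t)" by simp
    show "norm (pl2 (pp (X s)) - pl2 (pp (X t))) \<le> dV N (X s) (X t)"
      unfolding dV_def pl2_diff norm_pl2
      using qdist_nonneg[of "qq (X s)" "qq (X t)"] normF_nonneg[of "\<lambda>x. psi (X s) x - psi (X t) x"] by linarith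
  qed
  have cu: "continuous_on {-T..T} (\<lambda>t. emb (psi (X t)))"
    unfolding continuous_on_iff dist_norm real_norm_def
    using cX psi_dist by (meson order_le_less_trans)
  have cp: "continuous_on {-T..T} (\<lambda>t. pl2 (pp (X t)))"
    unfolding continuous_on_iff dist_norm real_norm_def
    using cX pp_dist by (meson order_le_less_trans)
  have cpn: "continuous_on {-T..T} (\<lambda>s. pp (X s) n)" if "n \<in> Gam N" for n
    using bounded_linear.continuous_on[OF bounded_linear_l2_apply[of n] cp] that by simp
  \<comment> \<open>The displacement equation says exactly that this continuous path projects to the
    given displacement at every time.\<close>
  define Q where "Q t n = q0 n + (1 / M) *\<^sub>R oint T (\<lambda>s. pp (X s) n) t" for t n
  define y where "y t = (W N (- t) (emb (psi (X t))), pl2 (Q t), pl2 (pp (X t)))" for t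
  have cQ: "continuous_on {-T..T} (\<lambda>t. pl2 (Q t))"
    unfolding pl2_def Q_def using T cpn
    by (intro continuous_on_sum bounded_linear.continuous_on[OF bounded_linear_single_l2] continuous_intros continuous_on_oint) auto
  have cW: "continuous_on {-T..T} (\<lambda>t. W N (- t) (emb (psi (X t))))"
    using continuous_on_compose2[OF continuous_W, of "{-T..T}" "\<lambda>t. (- t, emb (psi (X t)))" N]
    by (simp add: continuous_on_Pair continuous_on_minus continuous_on_id cu)
  have cy: "continuous_on {-T..T} y" unfolding y_def by (intro continuous_on_Pair cW cQ cp)
  have ry: "rel (X t) t (y t)" if t: "t \<in> {-T..T}" for t
  proof -
    have "latt (qq (X t) n - Q t n)" if n: "n \<in> Gam N" for n
    proof -
      have "interval_lebesgue_integral lborel (ereal 0) (ereal t) (\<lambda>s. pp (X s) n) = oint T (\<lambda>s. pp (X s) n) t"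
        by (rule interval_integral_eq_oint(2)[OF less_imp_le[OF T] cpn[OF n] t])
      then have "latt ((qq (X t) n - qq (X 0) n - (1 / M) *\<^sub>R oint T (\<lambda>s. pp (X s) n) t) - (q0 n - qq (X 0) n))"
        using qeq[OF t n] q0[OF n] by (intro latt_diff[OF _ q0[OF n]]) simp
      then show ?thesis by (simp add: Q_def algebra_simps)
    qed
    then show ?thesis using inF[OF t] by (simp add: rel_def y_def W_W)
  qed
  have eq: "y t = (emb (psi (X 0)), pl2 q0, pl2 (pp (X 0))) + oint T (\<lambda>s. vf s (y s)) t" if t: "t \<in> {-T..T}" for t
  proof (intro prod_eqI l2_eqI)
    have 0: "0 \<in> {-T..T}" using T by simp
    have h: "H1 (psi (X t))" "H1 (psi (X 0))" using inF[OF t] inF[OF 0] by (auto simp: inF_H1)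
    show "l2_apply (fst (y t)) \<eta> = l2_apply (fst ((emb (psi (X 0)), pl2 q0, pl2 (pp (X 0))) + oint T (\<lambda>s. vf s (y s)) t)) \<eta>" for \<eta>
    proof (cases "\<eta> \<in> XiC N")
      case True
      have "cis (t * csq N \<eta> / 2) * cis (- (t * csq N \<eta> / 2)) = 1" by (simp add: cis_mult)
      then have "l2_apply (fst (y t)) \<eta> = complex_of_real (sqrt (wt N \<eta>)) * fcoef N (psi (X 0)) \<eta>
          + cis (t * csq N \<eta> / 2) * complex_of_real (sqrt (wt N \<eta>)) *
          (\<i> * complex_of_real e * interval_lebesgue_integral lborel (ereal 0) (ereal t)
          (\<lambda>s. cis (- ((t - s) * csq N \<eta> / 2)) * fcoef N (mulPhi N (Phi N e \<sigma> (X s)) (psi (X s))) \<eta>))"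
        using True unfolding y_def by (simp add: l2_apply_emb[OF h(1)] duhamel[OF t True] distrib_left mult.assoc mult.left_commute)
      also have "\<dots> = l2_apply (emb (psi (X 0))) \<eta> + l2_apply (fst (oint T (\<lambda>s. vf s (y s)) t)) \<eta>"
        using psi_integral(2)[where X=X, OF T cy _ t True] ry True by (simp add: l2_apply_emb[OF h(2)])
      finally show ?thesis by simp
    next
      \<comment> \<open>Outside the dual lattice both sides are 0: the curve is admissible, and the
        field preserves admissibility.\<close>
      case False
      have "l2_apply (fst (vf s (y s))) \<eta> = 0" if "s \<in> {-T..T}" for s
      proof -
        have "admissible (fst (y s))" unfolding y_def by (simp add: admissible_W admissible_emb inF[OF that])
        then show ?thesis using admissible_vf[of "y s" s] False by (simp add: admissible_def)
      qed
      then have "oint T (\<lambda>s. l2_apply (fst (vf s (y s))) \<eta>) t = oint T (\<lambda>s. 0) t"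
        unfolding oint_def using t T by (intro arg_cong2[where f=minus] integral_cong) auto
      then have "l2_apply (fst (oint T (\<lambda>s. vf s (y s)) t)) \<eta> = 0"
        using bounded_linear_oint[OF less_imp_le[OF T] continuous_on_vf[OF cy] bounded_linear_coord1 t, of \<eta>]
        by (simp add: oint_def)
      then show ?thesis using False by (simp add: y_def l2_apply_emb[OF h(1)] l2_apply_emb[OF h(2)])
    qed
    show "l2_apply (fst (snd (y t))) n = l2_apply (fst (snd ((emb (psi (X 0)), pl2 q0, pl2 (pp (X 0))) + oint T (\<lambda>s. vf s (y s)) t))) n" for n
    proof (cases "n \<in> Gam N")
      case True
      then show ?thesis
        using pp_integral(2)[OF T cy ry t True] interval_integral_eq_oint(2)[OF less_imp_le[OF T] cpn[OF True] t]
        by (simp add: y_def Q_def)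
    next
      case False
      have "l2_apply (fst (snd (oint T (\<lambda>s. vf s (y s)) t))) n = oint T (\<lambda>s. l2_apply (fst (snd (vf s (y s)))) n) t"
        by (rule bounded_linear_oint[OF less_imp_le[OF T] continuous_on_vf[OF cy] bounded_linear_coord2 t])
      also have "\<dots> = 0" using False by (simp add: field_snd y_def oint_def)
      finally show ?thesis using False by (simp add: y_def)
    qed
    show "l2_apply (snd (snd (y t))) n = l2_apply (snd (snd ((emb (psi (X 0)), pl2 q0, pl2 (pp (X 0))) + oint T (\<lambda>s. vf s (y s)) t))) n" for n
    proof (cases "n \<in> Gam N")
      case True
      then show ?thesis
        using force_integral(2)[OF T cy ry t True] peq[OF t True] by (simp add: y_def)
    next
      case False
      have "l2_apply (snd (snd (oint T (\<lambda>s. vf s (y s)) t))) n = oint T (\<lambda>s. l2_apply (snd (snd (vf s (y s)))) n) t"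
        by (rule bounded_linear_oint[OF less_imp_le[OF T] continuous_on_vf[OF cy] bounded_linear_coord3 t])
      also have "\<dots> = oint T (\<lambda>s. 0) t"
        unfolding oint_def using t T field_thd[OF ry, of _ n] False by (intro arg_cong2[where f=minus] integral_cong) auto
      also have "\<dots> = 0" by (simp add: oint_def)
      finally show ?thesis using False by (simp add: y_def)
    qed
  qed
  show ?thesis by (rule that[OF cy ry eq])
qed

text \<open>Admissibility of the curve is what allows its propagated first component to be realized
  at each time by an antisymmetric wave function; displacements are the projections of the lifted
  ones.\<close>

lemma integral_equation_imp_solution:
  assumes T: "0 < T" and X0: "inV N X0"
    and cy: "continuous_on {-T..T} y"
    and eq: "\<And>t. t \<in> {-T..T} \<Longrightarrow> y t = (emb (psi X0), pl2 (qq X0), pl2 (pp X0)) + oint T (\<lambda>s. vf s (y s)) t"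
    and adm: "\<And>t. t \<in> {-T..T} \<Longrightarrow> admissible (fst (y t))"
  obtains X where "is_solution N e M \<sigma> {-T..T} X" "X 0 = X0"
proof -
  have 0: "0 \<in> {-T..T}" using T by simp
  have y0: "y 0 = (emb (psi X0), pl2 (qq X0), pl2 (pp X0))" using eq[OF 0] by (simp add: oint_0)
  have "\<exists>\<psi>. inF N \<psi> \<and> emb \<psi> = W N t (fst (y t))" if "t \<in> {-T..T}" for t
    using admissible_obtain[OF admissible_W[OF adm[OF that]], of t] by blast
  then obtain \<Psi> where \<Psi>: "\<And>t. t \<in> {-T..T} \<Longrightarrow> inF N (\<Psi> t) \<and> emb (\<Psi> t) = W N t (fst (y t))" by metis
  \<comment> \<open>The wave function chosen at time 0 agrees with the initial one only up to a null
    set, whereas the initial state has to be attained exactly; hence the separate value at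
    0.\<close>
  define X where "X t = (if t = 0 then X0 else (\<Psi> t, l2_apply (fst (snd (y t))), l2_apply (snd (snd (y t)))))" for t
  have ry: "rel (X t) t (y t)" if "t \<in> {-T..T}" for t
  proof (cases "t = 0")
    case True
    then show ?thesis using X0 by (simp add: rel_def X_def y0 inV_def)
  next
    case False
    then show ?thesis using \<Psi>[OF that] by (simp add: rel_def X_def psi_def qq_def pp_def)
  qed
  have "is_solution N e M \<sigma> {-T..T} X"
    unfolding is_solution_def
  proof (intro conjI ballI allI impI)
    show "inV N (X t)" if "t \<in> {-T..T}" for t using ry[OF that] by (simp add: rel_def inV_def)
  next
    fix t \<epsilon> :: real assume t: "t \<in> {-T..T}" and \<epsilon>: "0 < \<epsilon>"
    define g where "g s = sqrt V * norm (W N s (fst (y s)) - W N t (fst (y t))) + norm (fst (snd (y s)) - fst (snd (y t)))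
      + norm (snd (snd (y s)) - snd (snd (y t)))" for s
    have cW: "continuous_on {-T..T} (\<lambda>s. W N s (fst (y s)))"
      using continuous_on_compose2[OF continuous_W, of "{-T..T}" "\<lambda>t. (t, fst (y t))" N]
      by (simp add: continuous_on_Pair continuous_on_id continuous_on_fst[OF cy])
    have "continuous_on {-T..T} g"
      unfolding g_def by (intro continuous_intros cW cy)
    then obtain \<delta> where \<delta>: "0 < \<delta>" "\<And>s. s \<in> {-T..T} \<Longrightarrow> dist s t < \<delta> \<Longrightarrow> dist (g s) (g t) < \<epsilon>"
      using t \<epsilon> unfolding continuous_on_iff by blast
    show "\<exists>\<delta>>0. \<forall>s\<in>{-T..T}. \<bar>s - t\<bar> < \<delta> \<longrightarrow> dV N (X s) (X t) < \<epsilon>"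
    proof (intro exI[of _ \<delta>] conjI ballI impI \<delta>(1))
      fix s assume s: "s \<in> {-T..T}" "\<bar>s - t\<bar> < \<delta>"
      have "dV N (X s) (X t) \<le> g s" unfolding g_def by (rule dV_le[OF ry[OF s(1)] ry[OF t]])
      also have "g s < \<epsilon>" using \<delta>(2)[OF s(1)] s(2) by (simp add: dist_real_def g_def)
      finally show "dV N (X s) (X t) < \<epsilon>" .
    qed
  next
    fix t \<eta> assume t: "t \<in> {-T..T}" and \<eta>: "\<eta> \<in> XiC N"
    show "interval_lebesgue_integrable lborel (ereal 0) (ereal t)
        (\<lambda>s. cis (- ((t - s) * csq N \<eta> / 2)) * fcoef N (mulPhi N (Phi N e \<sigma> (X s)) (psi (X s))) \<eta>)"
      by (rule psi_integral(1)[OF T cy ry t \<eta>])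
    define I where "I = interval_lebesgue_integral lborel (ereal 0) (ereal t)
          (\<lambda>s. cis (- ((t - s) * csq N \<eta> / 2)) * fcoef N (mulPhi N (Phi N e \<sigma> (X s)) (psi (X s))) \<eta>)"
    define w where "w = complex_of_real (sqrt (wt N \<eta>))"
    have w: "w \<noteq> 0" by (simp add: w_def)
    define c where "c = cis (- (t * csq N \<eta> / 2))"
    have c: "c * cis (t * csq N \<eta> / 2) = 1" by (simp add: c_def cis_mult)
    have emb: "l2_apply (emb (psi (X s))) \<eta> = w * fcoef N (psi (X s)) \<eta>" if "s \<in> {-T..T}" for s
    proof -
      have "H1 (psi (X s))" using ry[OF that] by (simp add: rel_def inF_H1)
      then show ?thesis using \<eta> by (simp add: l2_apply_emb w_def)
    qed
    have "w * fcoef N (psi (X t)) \<eta> = l2_apply (W N t (fst (y t))) \<eta>"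
      using emb[OF t] ry[OF t] by (simp add: rel_def del: l2_apply_W)
    also have "\<dots> = c * (w * fcoef N (psi (X 0)) \<eta> + cis (t * csq N \<eta> / 2) * w * (\<i> * complex_of_real e * I))"
      using eq[OF t] psi_integral(2)[OF T cy ry t \<eta>] emb[OF 0]
      by (simp add: c_def I_def w_def X_def)
    also have "\<dots> = w * (c * fcoef N (psi (X 0)) \<eta>) + (c * cis (t * csq N \<eta> / 2)) * (w * (\<i> * complex_of_real e * I))"
      by (simp only: distrib_left mult_ac)
    also have "\<dots> = w * (c * fcoef N (psi (X 0)) \<eta> + \<i> * complex_of_real e * I)"
      by (simp only: c distrib_left mult_1)
    finally show "fcoef N (psi (X t)) \<eta> = cis (- (t * csq N \<eta> / 2)) * fcoef N (psi (X 0)) \<eta>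
        + \<i> * complex_of_real e * interval_lebesgue_integral lborel (ereal 0) (ereal t)
          (\<lambda>s. cis (- ((t - s) * csq N \<eta> / 2)) * fcoef N (mulPhi N (Phi N e \<sigma> (X s)) (psi (X s))) \<eta>)"
      using w unfolding c_def[symmetric] I_def[symmetric] by simp
  next
    fix t n assume t: "t \<in> {-T..T}" and n: "n \<in> Gam N"
    show "interval_lebesgue_integrable lborel (ereal 0) (ereal t) (\<lambda>s. pp (X s) n)"
      by (rule pp_integral(1)[OF T cy ry t n])
    have "l2_apply (fst (snd (y t))) n = qq X0 n + (1 / M) *\<^sub>R interval_lebesgue_integral lborel (ereal 0) (ereal t) (\<lambda>s. pp (X s) n)"
      using eq[OF t] pp_integral(2)[OF T cy ry t n] n by simp
    moreover have "latt (qq (X t) n - l2_apply (fst (snd (y t))) n)" using ry[OF t] n by (simp add: rel_def)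
    ultimately have "latt (qq (X t) n - qq (X 0) n - (1 / M) *\<^sub>R interval_lebesgue_integral lborel (ereal 0) (ereal t) (\<lambda>s. pp (X s) n))"
      by (simp add: X_def diff_diff_eq)
    then show "\<exists>m::int. (qq (X t) n - qq (X 0) n - (1 / M) *\<^sub>R interval_lebesgue_integral lborel (ereal 0) (ereal t) (\<lambda>s. pp (X s) n)) $ k = real N * of_int m" for k
      unfolding latt_iff by blast
  next
    fix t n assume t: "t \<in> {-T..T}" and n: "n \<in> Gam N"
    show "interval_lebesgue_integrable lborel (ereal 0) (ereal t) (\<lambda>s. force N e \<sigma> (X s) n)"
      by (rule force_integral(1)[OF T cy ry t n])
    have "pp (X t) n = l2_apply (snd (snd (y t))) n" using ry[OF t] n by (simp add: rel_def)
    also have "\<dots> = pp X0 n - interval_lebesgue_integral lborel (ereal 0) (ereal t) (\<lambda>s. force N e \<sigma> (X s) n)"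
      using eq[OF t] force_integral(2)[OF T cy ry t n] n by simp
    finally show "pp (X t) n = pp (X 0) n - interval_lebesgue_integral lborel (ereal 0) (ereal t) (\<lambda>s. force N e \<sigma> (X s) n)"
      by (simp add: X_def)
  qed
  then show ?thesis using that by (simp add: X_def)
qed

text \<open>Since \<open>sqrt V\<close> is at least 1, the bound \<open>R\<close> on the initial
  state also bounds its image under \<open>emb\<close>. The added 1 is the radius of the ball in
  which the Picard argument works.\<close>

lemma initial_in_dom:
  assumes "inV N X0" "absV N X0 \<le> R"
  shows "cball (emb (psi X0), q, pl2 (pp X0)) 1 \<subseteq> dom (R + 1)"
proof
  fix y assume y: "y \<in> cball (emb (psi X0), q, pl2 (pp X0)) 1"
  have "1 * norm (emb (psi X0)) \<le> sqrt V * norm (emb (psi X0))" by (rule mult_right_mono[OF V_ge_1]) simp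
  then have "norm (emb (psi X0)) \<le> normF N (psi X0)"
    using normF_emb[of "psi X0"] assms(1) by (simp add: inV_def inF_H1)
  then have 1: "norm (emb (psi X0)) \<le> R" "norm (pl2 (pp X0)) \<le> R"
    using assms(2) normF_nonneg[of "psi X0"] pnorm_nonneg[of "pp X0"] by (auto simp: absV_def norm_pl2)
  have d: "norm (y - (emb (psi X0), q, pl2 (pp X0))) \<le> 1" using y by (simp add: dist_norm norm_minus_commute)
  have "norm (fst y - emb (psi X0)) \<le> 1"
    using norm_fst_le_norm[of "y - (emb (psi X0), q, pl2 (pp X0))"] d by simp
  moreover have "norm (snd (snd y) - pl2 (pp X0)) \<le> 1"
    using norm_snd_le_norm[of "snd (y - (emb (psi X0), q, pl2 (pp X0)))"] norm_snd_le_norm[of "y - (emb (psi X0), q, pl2 (pp X0))"] d by simp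
  ultimately show "y \<in> dom (R + 1)"
    using 1 norm_triangle_ineq2[of "fst y" "emb (psi X0)"] norm_triangle_ineq2[of "snd (snd y)" "pl2 (pp X0)"]
    by (simp add: dom_def)
qed

text \<open>Admissibility as the common kernel of bounded linear functionals, the form of constraint
  that \<open>sol_exists\<close> preserves.\<close>

definition adm_functionals :: "(phase \<Rightarrow> complex) set" where
  "adm_functionals = {\<lambda>y. l2_apply (fst y) \<eta> | \<eta>. \<eta> \<notin> XiC N} \<union>
    {\<lambda>y. l2_apply (fst y) (\<eta> \<circ> \<pi>) - of_int (sign \<pi>) * l2_apply (fst y) \<eta> | \<pi> \<eta>. \<pi> permutes {..<N^3} \<and> \<eta> \<in> XiC N}"

lemma adm_functionals_bounded_linear: "\<phi> \<in> adm_functionals \<Longrightarrow> bounded_linear \<phi>"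
  unfolding adm_functionals_def
  by (auto intro!: bounded_linear_sub bounded_linear_coord1 bounded_linear_const_mult)

lemma admissible_iff_functionals: "admissible (fst y) \<longleftrightarrow> (\<forall>\<phi>\<in>adm_functionals. \<phi> y = 0)"
proof
  assume "admissible (fst y)"
  then show "\<forall>\<phi>\<in>adm_functionals. \<phi> y = 0" by (auto simp: admissible_def adm_functionals_def)
next
  assume all: "\<forall>\<phi>\<in>adm_functionals. \<phi> y = 0"
  show "admissible (fst y)" unfolding admissible_def
  proof (intro conjI allI impI)
    fix \<eta> assume "\<eta> \<notin> XiC N"
    then have "(\<lambda>y. l2_apply (fst y) \<eta>) \<in> adm_functionals" by (auto simp: adm_functionals_def)
    from bspec[OF all this] show "l2_apply (fst y) \<eta> = 0" .
  next
    fix \<pi> \<eta> assume "\<pi> permutes {..<N^3}" "\<eta> \<in> XiC N"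
    then have "(\<lambda>y. l2_apply (fst y) (\<eta> \<circ> \<pi>) - of_int (sign \<pi>) * l2_apply (fst y) \<eta>) \<in> adm_functionals"
      unfolding adm_functionals_def by blast
    from bspec[OF all this] show "l2_apply (fst y) (\<eta> \<circ> \<pi>) = of_int (sign \<pi>) * l2_apply (fst y) \<eta>" by simp
  qed
qed

theorem local_well_posedness:
  assumes "0 < R"
  shows "\<exists>\<tau>>0.
     (\<forall>X0. inV N X0 \<and> absV N X0 \<le> R \<longrightarrow>
        (\<exists>X. is_solution N e M \<sigma> {-\<tau>..\<tau>} X \<and> X 0 = X0)
      \<and> (\<forall>X Y. is_solution N e M \<sigma> {-\<tau>..\<tau>} X \<and> X 0 = X0
               \<and> is_solution N e M \<sigma> {-\<tau>..\<tau>} Y \<and> Y 0 = X0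
               \<longrightarrow> (\<forall>t\<in>{-\<tau>..\<tau>}. dV N (X t) (Y t) = 0)))
   \<and> (\<forall>t\<in>{-\<tau>..\<tau>}. \<forall>X0. inV N X0 \<and> absV N X0 \<le> R \<longrightarrow>
        (\<forall>\<epsilon>>0. \<exists>\<delta>>0. \<forall>X0'. inV N X0' \<and> absV N X0' \<le> R \<and> dV N X0' X0 < \<delta> \<longrightarrow>
           (\<forall>X X'. is_solution N e M \<sigma> {-\<tau>..\<tau>} X \<and> X 0 = X0
                 \<and> is_solution N e M \<sigma> {-\<tau>..\<tau>} X' \<and> X' 0 = X0'
                 \<longrightarrow> dV N (X' t) (X t) < \<epsilon>)))"
proof -
  obtain \<tau> K where \<tau>: "0 < \<tau>" and pic: "picard vf (dom (R + 1)) \<tau> K K" using picard_vf .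
  interpret P: picard vf "dom (R + 1)" \<tau> K K by (rule pic)
  define C where "C = 2 * (sqrt V + 2)"
  have C: "0 < C" unfolding C_def by (intro mult_pos_pos add_nonneg_pos) auto
  \<comment> \<open>This Lipschitz estimate in the initial data serves twice: equal data give
    uniqueness, close data give continuity. The lift \<open>q0\<close> of the second displacement
    stays free until then. In \<open>C\<close>, 2 comes from the integral equation and
    \<open>sqrt V + 2\<close> from the comparison of \<open>dV\<close> with the norm.\<close>
  have stab: "dV N (X' t) (X t) \<le> C * (norm (emb (psi (X' 0)) - emb (psi (X 0))) + norm (pl2 q0 - pl2 (qq (X 0))) + norm (pl2 (pp (X' 0)) - pl2 (pp (X 0))))"
    if X: "is_solution N e M \<sigma> {-\<tau>..\<tau>} X" "inV N (X 0)" "absV N (X 0) \<le> R"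
      and X': "is_solution N e M \<sigma> {-\<tau>..\<tau>} X'" "inV N (X' 0)" "absV N (X' 0) \<le> R"
      and q0: "\<And>n. n \<in> Gam N \<Longrightarrow> latt (q0 n - qq (X' 0) n)" and t: "t \<in> {-\<tau>..\<tau>}" for X X' q0 t
  proof -
    obtain y where y: "continuous_on {-\<tau>..\<tau>} y" "\<And>t. t \<in> {-\<tau>..\<tau>} \<Longrightarrow> rel (X t) t (y t)"
      "\<And>t. t \<in> {-\<tau>..\<tau>} \<Longrightarrow> y t = (emb (psi (X 0)), pl2 (qq (X 0)), pl2 (pp (X 0))) + oint \<tau> (\<lambda>s. vf s (y s)) t"
      by (rule solution_imp_integral_equation[OF \<tau> X(1), of "qq (X 0)"]) auto
    obtain y' where y': "continuous_on {-\<tau>..\<tau>} y'" "\<And>t. t \<in> {-\<tau>..\<tau>} \<Longrightarrow> rel (X' t) t (y' t)"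
      "\<And>t. t \<in> {-\<tau>..\<tau>} \<Longrightarrow> y' t = (emb (psi (X' 0)), pl2 q0, pl2 (pp (X' 0))) + oint \<tau> (\<lambda>s. vf s (y' s)) t"
      by (rule solution_imp_integral_equation[OF \<tau> X'(1) q0]) auto
    have s: "P.sol (emb (psi (X 0)), pl2 (qq (X 0)), pl2 (pp (X 0))) y" "P.sol (emb (psi (X' 0)), pl2 q0, pl2 (pp (X' 0))) y'"
      using y y' by (auto simp: P.sol_def)
    define D where "D = (emb (psi (X' 0)), pl2 q0, pl2 (pp (X' 0))) - (emb (psi (X 0)), pl2 (qq (X 0)), pl2 (pp (X 0)))"
    have a1: "norm (y' t - y t) \<le> 2 * norm D"
      unfolding D_def by (rule P.sol_dist[OF initial_in_dom[OF X'(2,3)] initial_in_dom[OF X(2,3)] s(2,1) t])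
    have a2: "norm D \<le> norm (emb (psi (X' 0)) - emb (psi (X 0))) + (norm (pl2 q0 - pl2 (qq (X 0))) + norm (pl2 (pp (X' 0)) - pl2 (pp (X 0))))"
      unfolding D_def by (simp add: order_trans[OF norm_Pair_le add_left_mono[OF norm_Pair_le]])
    have 1: "norm (y' t - y t) \<le> 2 * (norm (emb (psi (X' 0)) - emb (psi (X 0))) + norm (pl2 q0 - pl2 (qq (X 0))) + norm (pl2 (pp (X' 0)) - pl2 (pp (X 0))))"
      by (rule order_trans[OF a1 mult_left_mono[OF a2[unfolded add.assoc[symmetric]]]]) simp
    have "dV N (X' t) (X t) \<le> (sqrt V + 2) * norm (y' t - y t)" by (rule dV_le_same_time[OF y'(2)[OF t] y(2)[OF t]])
    also have "\<dots> \<le> (sqrt V + 2) * (2 * (norm (emb (psi (X' 0)) - emb (psi (X 0))) + norm (pl2 q0 - pl2 (qq (X 0))) + norm (pl2 (pp (X' 0)) - pl2 (pp (X 0)))))"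
      using 1 V_ge_1 by (intro mult_left_mono) auto
    finally show ?thesis unfolding C_def by (simp only: mult_ac)
  qed
  show ?thesis
  proof (rule exI[of _ \<tau>], intro conjI allI impI ballI \<tau>)
    fix X0 assume X0: "inV N X0 \<and> absV N X0 \<le> R"
    have adm0: "admissible (fst (emb (psi X0), pl2 (qq X0), pl2 (pp X0)))" using X0 by (simp add: inV_def admissible_emb)
    obtain y where y: "P.sol (emb (psi X0), pl2 (qq X0), pl2 (pp X0)) y" "\<And>t \<phi>. t \<in> {-\<tau>..\<tau>} \<Longrightarrow> \<phi> \<in> adm_functionals \<Longrightarrow> \<phi> (y t) = 0"
    proof (rule P.sol_exists[of "(emb (psi X0), pl2 (qq X0), pl2 (pp X0))" adm_functionals])
      show "cball (emb (psi X0), pl2 (qq X0), pl2 (pp X0)) 1 \<subseteq> dom (R + 1)" using X0 by (intro initial_in_dom) auto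
      show "bounded_linear \<phi>" if "\<phi> \<in> adm_functionals" for \<phi> using that by (rule adm_functionals_bounded_linear)
      show "\<phi> (emb (psi X0), pl2 (qq X0), pl2 (pp X0)) = 0" if "\<phi> \<in> adm_functionals" for \<phi>
        using adm0 that unfolding admissible_iff_functionals by blast
      show "\<phi> (vf s y) = 0" if "\<phi> \<in> adm_functionals" "\<And>\<phi>. \<phi> \<in> adm_functionals \<Longrightarrow> \<phi> y = 0" for \<phi> s y
        using admissible_vf[of y s] that unfolding admissible_iff_functionals by blast
    qed blast
    have "admissible (fst (y t))" if "t \<in> {-\<tau>..\<tau>}" for t
      unfolding admissible_iff_functionals using y(2)[OF that] by blast
    then show "\<exists>X. is_solution N e M \<sigma> {-\<tau>..\<tau>} X \<and> X 0 = X0"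
      using integral_equation_imp_solution[OF \<tau>, of X0 y] X0 y(1) unfolding P.sol_def by blast
  next
    fix X0 X Y t assume X0: "inV N X0 \<and> absV N X0 \<le> R" and t: "t \<in> {-\<tau>..\<tau>}"
      and XY: "is_solution N e M \<sigma> {-\<tau>..\<tau>} X \<and> X 0 = X0 \<and> is_solution N e M \<sigma> {-\<tau>..\<tau>} Y \<and> Y 0 = X0"
    have "dV N (X t) (Y t) \<le> C * (norm (emb (psi (X 0)) - emb (psi (Y 0))) + norm (pl2 (qq X0) - pl2 (qq (Y 0))) + norm (pl2 (pp (X 0)) - pl2 (pp (Y 0))))"
      using XY X0 t by (intro stab) auto
    also have "\<dots> = 0" using XY by simp
    finally show "dV N (X t) (Y t) = 0" using dV_nonneg[of "X t" "Y t"] by linarith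
  next
    fix t X0 and \<epsilon> :: real
    assume t: "t \<in> {-\<tau>..\<tau>}" and X0: "inV N X0 \<and> absV N X0 \<le> R" and \<epsilon>: "0 < \<epsilon>"
    \<comment> \<open>One share of \<open>\<delta>\<close> for each ion displacement, one for the
      wave function and one for the momenta. The extra 2 in \<open>\<delta>\<close> makes the final
      inequality strict.\<close>
    define m where "m = real (card (Gam N)) + 2"
    have m: "0 < m" by (simp add: m_def)
    define \<delta> where "\<delta> = \<epsilon> / (2 * C * m)"
    have \<delta>: "0 < \<delta>" using \<epsilon> C m by (simp add: \<delta>_def)
    show "\<exists>\<delta>>0. \<forall>X0'. inV N X0' \<and> absV N X0' \<le> R \<and> dV N X0' X0 < \<delta> \<longrightarrow>
           (\<forall>X X'. is_solution N e M \<sigma> {-\<tau>..\<tau>} X \<and> X 0 = X0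
                 \<and> is_solution N e M \<sigma> {-\<tau>..\<tau>} X' \<and> X' 0 = X0'
                 \<longrightarrow> dV N (X' t) (X t) < \<epsilon>)"
    proof (intro exI[of _ \<delta>] conjI allI impI \<delta>)
      fix X0' X X'
      assume X0': "inV N X0' \<and> absV N X0' \<le> R \<and> dV N X0' X0 < \<delta>"
        and XX: "is_solution N e M \<sigma> {-\<tau>..\<tau>} X \<and> X 0 = X0 \<and> is_solution N e M \<sigma> {-\<tau>..\<tau>} X' \<and> X' 0 = X0'"
      have nonneg: "0 \<le> normF N (\<lambda>x. psi X0' x - psi X0 x)" "0 \<le> qdist N (qq X0') (qq X0)" "0 \<le> pnorm N (\<lambda>n. pp X0' n - pp X0 n)"
        by (auto intro: normF_nonneg qdist_nonneg pnorm_nonneg)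
      have parts: "normF N (\<lambda>x. psi X0' x - psi X0 x) < \<delta>" "qdist N (qq X0') (qq X0) < \<delta>" "pnorm N (\<lambda>n. pp X0' n - pp X0 n) < \<delta>"
        using X0' nonneg unfolding dV_def by linarith+
      \<comment> \<open>The torus distance is an infimum over lattice shifts. A shift below
        \<open>\<delta>\<close> is chosen for each ion, and the second displacement is lifted so
        that it lies close to the first in space.\<close>
      have "\<exists>d. latt d \<and> norm (qq X0' n - qq X0 n - d) < \<delta>" if n: "n \<in> Gam N" for n
      proof (rule tdist_lessD)
        have "(tdist N (qq X0' n) (qq X0 n))\<^sup>2 \<le> (\<Sum>n\<in>Gam N. (tdist N (qq X0' n) (qq X0 n))\<^sup>2)"
          by (rule member_le_sum[OF n]) (auto simp: finite_Gam)
        then have "tdist N (qq X0' n) (qq X0 n) \<le> qdist N (qq X0') (qq X0)"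
          unfolding qdist_def by (rule real_le_rsqrt)
        then show "tdist N (qq X0' n) (qq X0 n) < \<delta>" using parts(2) by linarith
      qed
      then obtain d where d: "\<And>n. n \<in> Gam N \<Longrightarrow> latt (d n)" "\<And>n. n \<in> Gam N \<Longrightarrow> norm (qq X0' n - qq X0 n - d n) < \<delta>"
        by metis
      define q0 where "q0 n = qq X0' n - d n" for n
      have q0: "latt (q0 n - qq X0' n)" if "n \<in> Gam N" for n
        using latt_diff[OF latt_0 d(1)[OF that]] by (simp add: q0_def)
      have 1: "norm (emb (psi X0') - emb (psi X0)) \<le> \<delta>"
      proof -
        have "1 * norm (emb (psi X0') - emb (psi X0)) \<le> sqrt V * norm (emb (psi X0') - emb (psi X0))"
          by (rule mult_right_mono[OF V_ge_1]) simp
        then show ?thesis using normF_diff[of "psi X0'" "psi X0"] X0 X0' parts(1) by (simp add: inV_def)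
      qed
      have 2: "norm (pl2 q0 - pl2 (qq X0)) \<le> real (card (Gam N)) * \<delta>"
      proof -
        have "norm (pl2 q0 - pl2 (qq X0)) = norm (\<Sum>n\<in>Gam N. single_l2 n (q0 n - qq X0 n))"
          unfolding pl2_diff by (simp only: pl2_def)
        also have "\<dots> \<le> (\<Sum>n\<in>Gam N. norm (single_l2 n (q0 n - qq X0 n)))" by (rule norm_sum)
        also have "\<dots> \<le> (\<Sum>n\<in>Gam N. \<delta>)"
        proof (rule sum_mono)
          fix n assume n: "n \<in> Gam N"
          have "norm (single_l2 n (q0 n - qq X0 n)) \<le> norm (q0 n - qq X0 n)" by (rule norm_single_l2)
          also have "\<dots> \<le> \<delta>" using d(2)[OF n] by (simp add: q0_def algebra_simps)
          finally show "norm (single_l2 n (q0 n - qq X0 n)) \<le> \<delta>" .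
        qed
        finally show ?thesis by simp
      qed
      have 3: "norm (pl2 (pp X0') - pl2 (pp X0)) \<le> \<delta>"
        using parts(3) unfolding pl2_diff norm_pl2 by simp
      have "dV N (X' t) (X t) \<le> C * (norm (emb (psi (X' 0)) - emb (psi (X 0))) + norm (pl2 q0 - pl2 (qq (X 0))) + norm (pl2 (pp (X' 0)) - pl2 (pp (X 0))))"
        using XX X0 X0' t q0 by (intro stab) auto
      also have "\<dots> \<le> C * (\<delta> + real (card (Gam N)) * \<delta> + \<delta>)"
        using 1 2 3 C XX by (intro mult_left_mono add_mono) auto
      also have "\<dots> = C * m * \<delta>" by (simp add: m_def algebra_simps)
      also have "\<dots> = \<epsilon> / 2" using C m by (simp add: \<delta>_def)
      also have "\<dots> < \<epsilon>" using \<epsilon> by simp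
      finally show "dV N (X' t) (X t) < \<epsilon>" .
    qed
  qed
qed

end

theorem theoremA2:
  fixes N :: nat and e Z M R :: real and \<sigma> :: "real^3 \<Rightarrow> real"
  assumes "N \<ge> 1" and "e > 0" and "Z > 0" and "M > 0"
    and "C2 \<sigma>"
    and "\<forall>x k. \<sigma> (x + real N *\<^sub>R axis k 1) = \<sigma> x"
    and "(LINT x|lebesgue_on (cube N). \<sigma> x) = e * Z"
    and "R > 0"
  shows "\<exists>\<tau>>0.
     (\<forall>X0. inV N X0 \<and> absV N X0 \<le> R \<longrightarrow>
        (\<exists>X. is_solution N e M \<sigma> {-\<tau>..\<tau>} X \<and> X 0 = X0)
      \<and> (\<forall>X Y. is_solution N e M \<sigma> {-\<tau>..\<tau>} X \<and> X 0 = X0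
               \<and> is_solution N e M \<sigma> {-\<tau>..\<tau>} Y \<and> Y 0 = X0
               \<longrightarrow> (\<forall>t\<in>{-\<tau>..\<tau>}. dV N (X t) (Y t) = 0)))
   \<and> (\<forall>t\<in>{-\<tau>..\<tau>}. \<forall>X0. inV N X0 \<and> absV N X0 \<le> R \<longrightarrow>
        (\<forall>\<epsilon>>0. \<exists>\<delta>>0. \<forall>X0'. inV N X0' \<and> absV N X0' \<le> R \<and> dV N X0' X0 < \<delta> \<longrightarrow>
           (\<forall>X X'. is_solution N e M \<sigma> {-\<tau>..\<tau>} X \<and> X 0 = X0
                 \<and> is_solution N e M \<sigma> {-\<tau>..\<tau>} X' \<and> X' 0 = X0'
                 \<longrightarrow> dV N (X' t) (X t) < \<epsilon>)))"
proof -
  have N: "0 < N" using assms(1) by simp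
  obtain B where B: "\<And>x. \<bar>\<sigma> x\<bar> \<le> B" "\<And>x y. \<bar>\<sigma> x - \<sigma> y\<bar> \<le> B * norm (x - y)"
    using periodic_C2_bounded_lipschitz[OF N assms(5,6)] by blast
  interpret spn_dyn N e \<sigma> B M
    by unfold_locales (use N assms B in auto)
  show ?thesis by (rule local_well_posedness[OF assms(8)])
qed

end
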